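(* (1) Any structure that is bi-interpretable (with parameters) with a rich structure is rich. (2) Any structure that is absolutely bi-interpretable with an absolutely rich structure is absolutely rich. (3) In the situations of (1) and (2), if one of the two structures is effectively rich (respectively, effectively absolutely rich), then so is the other.
   Context: Languages are finite. For a set $A$ let $HF_0(A)=A$, $HF_{k+1}(A)=HF_k(A)\cup\{\text{finite subsets of }HF_k(A)\}$, $HF(A)=\bigcup_k HF_k(A)$; for an $L$-structure $\mathbb{A}$ (operations replaced by their graphs), $HF(\mathbb{A})=\langle HF(A);L,P_A,\in\rangle$ with $L$ interpreted on $A$, $P_A$ a unary predicate for $A$ and $\in$ membership. A WSOL formula $\phi(x_1,\dots,x_n)$ of $\mathbb{A}$ is a first-order formula of the language of $HF(\mathbb{A})$ whose only free variables are $x_1,\dots,x_n$, ranging over $A$. $\mathbb{A}$ is rich if for every WSOL formula $\phi(\bar x)$ there are a first-order $L$-formula $\phi^\diamond(\bar x,\bar y)$ and a tuple $\bar p$ in $A$ with $HF(\mathbb{A})\models\phi(\bar a)\iff\mathbb{A}\models\phi^\diamond(\bar a,\bar p)$ for all $\bar a$ in $A$; absolutely rich if $\phi^\diamond$ can always be taken without parameters; effectively rich (resp. effectively absolutely rich) if moreover the map $\phi\mapsto\phi^\diamond$ is computable. Interpretation: $\mathbb{A}$ is interpretable in $\mathbb{B}$ with parameters $\bar p$ via a code $\Gamma$ if there are $L(\mathbb{B})$-formulas $U_\Gamma(\bar x,\bar y)$, $E_\Gamma(\bar x_1,\bar x_2,\bar y)$ and, for each symbol $Q$ of $L(\mathbb{A})$,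 $Q_\Gamma(\bar x_1,\dots,\bar x_t,\bar y)$ (all $\bar x$'s of the same length $n$) such that with $\bar y:=\bar p$, $U_\Gamma$ defines $A_\Gamma\subseteq B^n$, $E_\Gamma$ defines an equivalence relation $\sim$ on $A_\Gamma$, the $Q_\Gamma$ define full preimages of graphs of the symbols on $A_\Gamma/\sim$, and the resulting $L(\mathbb{A})$-structure $\Gamma(\mathbb{B},\bar p)$ is isomorphic to $\mathbb{A}$; the induced surjection $\mu_\Gamma:A_\Gamma\to A$ is the coordinate map. Absolute interpretation: $\bar p$ empty. If $\mathbb{A}\simeq\Gamma(\mathbb{B},\bar p)$ and $\mathbb{B}\simeq\Delta(\mathbb{A},\bar q)$, then replacing each formula of $\Gamma$ by its $\Delta$-translation gives a code $\Gamma\circ\Delta$ interpreting $\mathbb{A}$ in itself with parameters $\bar p^*=(\bar p_0,\bar q)$, $\bar p_0\in\mu_\Delta^{-1}(\bar p)$, with coordinate map $\mu_\Gamma\circ\mu_\Delta$; similarly $\Delta\circ\Gamma$ interprets $\mathbb{B}$ in itself with parameters $\bar q^*$. $\mathbb{A}$ and $\mathbb{B}$ are bi-interpretable (with parameters) if such interpretations exist together with an $L(\mathbb{A})$-formula $\theta_{\mathbb{A}}(\bar u,x,\bar p^* )$ defining in $\mathbb{A}$ an isomorphism (coordinate map) $\Gamma\circ\Delta(\mathbb{A},\bar p^* )\to\mathbb{A}$ and an $L(\mathbb{B})$-formula $\theta_{\mathbb{B}}(\bar v,x,\bar q^* )$ defining in $\mathbb{B}$ an isomorphism $\Delta\circ\Gamma(\mathbb{B},\bar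 q^* )\to\mathbb{B}$. They are absolutely bi-interpretable if all parameter tuples are empty. *)

theory Defs
  imports "HOL-Library.FSet" "HOL-Library.Nat_Bijection"
begin

text \<open>
  A finite language is given by the arities of its finitely many function symbols (constants are
  function symbols of arity 0) and relation symbols; the symbols themselves are list positions.
  Only the values of \<open>fn\<close> and \<open>rel\<close> at existing symbols, on tuples over the
  universe of the right length, are meaningful.
\<close>

record language =
  funs :: "nat list"
  rels :: "nat list"

record 'a struct =
  lang :: language
  universe :: "'a set"
  fn :: "nat \<Rightarrow> 'a list \<Rightarrow> 'a"
  rel :: "nat \<Rightarrow> 'a list \<Rightarrow> bool"

definition tuples :: "nat \<Rightarrow> 'a set \<Rightarrow> 'a list set" where
  "tuples n X = {xs. length xs = n \<and> set xs \<subseteq> X}"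

definition is_struct :: "'a struct \<Rightarrow> bool" where
  "is_struct A \<longleftrightarrow> universe A \<noteq> {} \<and>
     (\<forall>f < length (funs (lang A)). \<forall>as \<in> tuples (funs (lang A) ! f) (universe A).
        fn A f as \<in> universe A)"

definition isomorphism :: "('a \<Rightarrow> 'b) \<Rightarrow> 'a struct \<Rightarrow> 'b struct \<Rightarrow> bool" where
  "isomorphism h A B \<longleftrightarrow> lang A = lang B \<and> bij_betw h (universe A) (universe B) \<and>
     (\<forall>f < length (funs (lang A)). \<forall>as \<in> tuples (funs (lang A) ! f) (universe A).
        h (fn A f as) = fn B f (map h as)) \<and>
     (\<forall>r < length (rels (lang A)). \<forall>as \<in> tuples (rels (lang A) ! r) (universe A).
        rel A r as \<longleftrightarrow> rel B r (map h as))"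

text \<open>
  Variables are de Bruijn indices into a list of values: in \<open>Ex \<phi>\<close> the bound variable
  is number 0 of \<open>\<phi>\<close> and the other variables are shifted by one.  A formula
  \<open>\<phi>(x\<^sub>1,\<dots>,x\<^sub>n)\<close> is a formula satisfying \<open>wf_fm L n\<close>; it is evaluated at
  the list of the values of \<open>x\<^sub>1,\<dots>,x\<^sub>n\<close>.
\<close>

datatype tm = Var nat | Fn nat "tm list"

datatype fm = Eq tm tm | Rel nat "tm list" | Neg fm | Conj fm fm | Ex fm

fun wf_tm :: "language \<Rightarrow> nat \<Rightarrow> tm \<Rightarrow> bool" where
  "wf_tm L n (Var i) \<longleftrightarrow> i < n"
| "wf_tm L n (Fn f ts) \<longleftrightarrow>
     f < length (funs L) \<and> length ts = funs L ! f \<and> (\<forall>t \<in> set ts. wf_tm L n t)"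

fun wf_fm :: "language \<Rightarrow> nat \<Rightarrow> fm \<Rightarrow> bool" where
  "wf_fm L n (Eq s t) \<longleftrightarrow> wf_tm L n s \<and> wf_tm L n t"
| "wf_fm L n (Rel r ts) \<longleftrightarrow>
     r < length (rels L) \<and> length ts = rels L ! r \<and> (\<forall>t \<in> set ts. wf_tm L n t)"
| "wf_fm L n (Neg \<phi>) \<longleftrightarrow> wf_fm L n \<phi>"
| "wf_fm L n (Conj \<phi> \<psi>) \<longleftrightarrow> wf_fm L n \<phi> \<and> wf_fm L n \<psi>"
| "wf_fm L n (Ex \<phi>) \<longleftrightarrow> wf_fm L (Suc n) \<phi>"

primrec eval_tm :: "'a struct \<Rightarrow> 'a list \<Rightarrow> tm \<Rightarrow> 'a" where
  "eval_tm A e (Var i) = e ! i"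
| "eval_tm A e (Fn f ts) = fn A f (map (eval_tm A e) ts)"

primrec sat :: "'a struct \<Rightarrow> 'a list \<Rightarrow> fm \<Rightarrow> bool" where
  "sat A e (Eq s t) \<longleftrightarrow> eval_tm A e s = eval_tm A e t"
| "sat A e (Rel r ts) \<longleftrightarrow> rel A r (map (eval_tm A e) ts)"
| "sat A e (Neg \<phi>) \<longleftrightarrow> \<not> sat A e \<phi>"
| "sat A e (Conj \<phi> \<psi>) \<longleftrightarrow> sat A e \<phi> \<and> sat A e \<psi>"
| "sat A e (Ex \<phi>) \<longleftrightarrow> (\<exists>a \<in> universe A. sat A (a # e) \<phi>)"

text \<open>Elements of the base set are urelements: \<open>Ur a\<close> is never a set.\<close>

datatype 'a hf = Ur 'a | HSet "'a hf fset"

primrec HF_level :: "'a set \<Rightarrow> nat \<Rightarrow> 'a hf set" where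
  "HF_level A 0 = Ur ` A"
| "HF_level A (Suc k) = HF_level A k \<union> {HSet s | s. fset s \<subseteq> HF_level A k}"

definition HF_set :: "'a set \<Rightarrow> 'a hf set" where
  "HF_set A = (\<Union>k. HF_level A k)"

text \<open>
  The language of \<open>HF(A)\<close> is relational.  Its symbols are, in this order: the graphs of the
  function symbols of \<open>L\<close> (arguments first, value last), the relation symbols of
  \<open>L\<close>, the unary predicate for the base set, and membership.
\<close>

definition HF_lang :: "language \<Rightarrow> language" where
  "HF_lang L = \<lparr>funs = [], rels = map Suc (funs L) @ rels L @ [1, 2]\<rparr>"

definition HF :: "'a struct \<Rightarrow> 'a hf struct" where
  "HF A = (let nf = length (funs (lang A)); nr = length (rels (lang A)) in
     \<lparr>lang = HF_lang (lang A),
      universe = HF_set (universe A),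
      fn = (\<lambda>_ _. undefined),
      rel = (\<lambda>i xs.
        if i < nf then
          \<exists>as a. set (as @ [a]) \<subseteq> universe A \<and> xs = map Ur (as @ [a]) \<and> fn A i as = a
        else if i < nf + nr then
          \<exists>as. set as \<subseteq> universe A \<and> xs = map Ur as \<and> rel A (i - nf) as
        else if i = nf + nr then \<exists>a \<in> universe A. xs = [Ur a]
        else \<exists>x s. xs = [x, HSet s] \<and> x |\<in>| s)\<rparr>)"

text \<open>Kleene's partial recursive functions, with their graphs as big-step semantics; \<open>Mu\<close> is unbounded search.\<close>

datatype recf =
  Zero | Succ | Proj nat | Comp recf "recf list" | PrimRec recf recf | Mu recf

inductive computes :: "recf \<Rightarrow> nat list \<Rightarrow> nat \<Rightarrow> bool" where
  "computes Zero xs 0"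
| "computes Succ [x] (Suc x)"
| "i < length xs \<Longrightarrow> computes (Proj i) xs (xs ! i)"
| "list_all2 (\<lambda>g y. computes g xs y) gs ys \<Longrightarrow> computes f ys z \<Longrightarrow> computes (Comp f gs) xs z"
| "computes f xs y \<Longrightarrow> computes (PrimRec f g) (0 # xs) y"
| "computes (PrimRec f g) (k # xs) r \<Longrightarrow> computes g (k # r # xs) y \<Longrightarrow>
     computes (PrimRec f g) (Suc k # xs) y"
| "(\<forall>i < k. \<exists>y > 0. computes f (i # xs) y) \<Longrightarrow> computes f (k # xs) 0 \<Longrightarrow>
     computes (Mu f) xs k"

definition computable :: "(nat \<Rightarrow> nat) \<Rightarrow> bool" where
  "computable F \<longleftrightarrow> (\<exists>c. \<forall>x. computes c [x] (F x))"

text \<open>Goedel numbering by means of the standard codings of pairs and lists.\<close>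

primrec tm_code :: "tm \<Rightarrow> nat" where
  "tm_code (Var i) = prod_encode (0, i)"
| "tm_code (Fn f ts) = prod_encode (1, prod_encode (f, list_encode (map tm_code ts)))"

primrec fm_code :: "fm \<Rightarrow> nat" where
  "fm_code (Eq s t) = prod_encode (0, prod_encode (tm_code s, tm_code t))"
| "fm_code (Rel r ts) = prod_encode (1, prod_encode (r, list_encode (map tm_code ts)))"
| "fm_code (Neg \<phi>) = prod_encode (2, fm_code \<phi>)"
| "fm_code (Conj \<phi> \<psi>) = prod_encode (3, prod_encode (fm_code \<phi>, fm_code \<psi>))"
| "fm_code (Ex \<phi>) = prod_encode (4, fm_code \<phi>)"

definition computable_fm_map :: "(nat \<times> fm \<Rightarrow> nat \<times> fm) \<Rightarrow> bool" where
  "computable_fm_map D \<longleftrightarrow> (\<exists>F. computable F \<and>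
     (\<forall>n \<phi> m \<psi>. D (n, \<phi>) = (m, \<psi>) \<longrightarrow>
        F (prod_encode (n, fm_code \<phi>)) = prod_encode (m, fm_code \<psi>)))"

text \<open>A WSOL formula of \<open>A\<close> is a formula \<open>\<phi>\<close> with \<open>wsol A n \<phi>\<close>; only its
  free variables are restricted to \<open>A\<close>, which is expressed by evaluating it at urelements.\<close>

definition wsol :: "'a struct \<Rightarrow> nat \<Rightarrow> fm \<Rightarrow> bool" where
  "wsol A n \<phi> \<longleftrightarrow> wf_fm (lang (HF A)) n \<phi>"

text \<open>\<open>\<psi>(x\<^sub>1,\<dots>,x\<^sub>n,y\<^sub>1,\<dots>,y\<^sub>m)\<close> at parameters \<open>p\<close> is a first-order equivalent
  of the WSOL formula \<open>\<phi>(x\<^sub>1,\<dots>,x\<^sub>n)\<close>.\<close>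

definition fo_equiv :: "'a struct \<Rightarrow> nat \<Rightarrow> fm \<Rightarrow> nat \<Rightarrow> fm \<Rightarrow> 'a list \<Rightarrow> bool" where
  "fo_equiv A n \<phi> m \<psi> p \<longleftrightarrow>
     wf_fm (lang A) (n + m) \<psi> \<and> p \<in> tuples m (universe A) \<and>
     (\<forall>a \<in> tuples n (universe A). sat (HF A) (map Ur a) \<phi> \<longleftrightarrow> sat A (a @ p) \<psi>)"

definition rich :: "'a struct \<Rightarrow> bool" where
  "rich A \<longleftrightarrow> (\<forall>n \<phi>. wsol A n \<phi> \<longrightarrow> (\<exists>m \<psi> p. fo_equiv A n \<phi> m \<psi> p))"

definition absolutely_rich :: "'a struct \<Rightarrow> bool" where
  "absolutely_rich A \<longleftrightarrow> (\<forall>n \<phi>. wsol A n \<phi> \<longrightarrow> (\<exists>\<psi>. fo_equiv A n \<phi> 0 \<psi> []))"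

definition effectively_rich :: "'a struct \<Rightarrow> bool" where
  "effectively_rich A \<longleftrightarrow> (\<exists>D. computable_fm_map D \<and>
     (\<forall>n \<phi>. wsol A n \<phi> \<longrightarrow> (\<exists>m \<psi> p. D (n, \<phi>) = (m, \<psi>) \<and> fo_equiv A n \<phi> m \<psi> p)))"

definition effectively_absolutely_rich :: "'a struct \<Rightarrow> bool" where
  "effectively_absolutely_rich A \<longleftrightarrow> (\<exists>D. computable_fm_map D \<and>
     (\<forall>n \<phi>. wsol A n \<phi> \<longrightarrow> (\<exists>\<psi>. D (n, \<phi>) = (0, \<psi>) \<and> fo_equiv A n \<phi> 0 \<psi> [])))"

text \<open>
  In the formulas of a code, the tuples \<open>x\<^sub>1,\<dots>,x\<^sub>t\<close>, each of length \<open>dim\<close>, come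
  first, followed by \<open>npars\<close> parameter variables.  \<open>fun_fm f\<close> is the formula for the
  graph of the function symbol \<open>f\<close>, with the tuple for the value after those for the
  arguments.  The values of \<open>fun_fm\<close> and \<open>rel_fm\<close> outside the symbols of the
  interpreted language are immaterial.
\<close>

record interp_code =
  dim :: nat
  npars :: nat
  dom_fm :: fm
  eq_fm :: fm
  fun_fm :: "nat \<Rightarrow> fm"
  rel_fm :: "nat \<Rightarrow> fm"

definition is_code :: "language \<Rightarrow> language \<Rightarrow> interp_code \<Rightarrow> bool" where
  "is_code L K \<Gamma> \<longleftrightarrow>
     wf_fm K (dim \<Gamma> + npars \<Gamma>) (dom_fm \<Gamma>) \<and>
     wf_fm K (2 * dim \<Gamma> + npars \<Gamma>) (eq_fm \<Gamma>) \<and>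
     (\<forall>f < length (funs L). wf_fm K (Suc (funs L ! f) * dim \<Gamma> + npars \<Gamma>) (fun_fm \<Gamma> f)) \<and>
     (\<forall>r < length (rels L). wf_fm K ((rels L ! r) * dim \<Gamma> + npars \<Gamma>) (rel_fm \<Gamma> r))"

definition code_dom :: "interp_code \<Rightarrow> 'b struct \<Rightarrow> 'b list \<Rightarrow> 'b list set" where
  "code_dom \<Gamma> B p = {b \<in> tuples (dim \<Gamma>) (universe B). sat B (b @ p) (dom_fm \<Gamma>)}"

definition code_eqv :: "interp_code \<Rightarrow> 'b struct \<Rightarrow> 'b list \<Rightarrow> ('b list \<times> 'b list) set" where
  "code_eqv \<Gamma> B p =
     {(b, c) \<in> code_dom \<Gamma> B p \<times> code_dom \<Gamma> B p. sat B (b @ c @ p) (eq_fm \<Gamma>)}"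

abbreviation code_class :: "interp_code \<Rightarrow> 'b struct \<Rightarrow> 'b list \<Rightarrow> 'b list \<Rightarrow> 'b list set" where
  "code_class \<Gamma> B p b \<equiv> code_eqv \<Gamma> B p `` {b}"

text \<open>
  \<open>code_struct L \<Gamma> B p S\<close>: the code defines an \<open>L\<close>-structure in \<open>B\<close> with
  parameters \<open>p\<close>, and \<open>S = \<Gamma>(B,p)\<close>.  The last two clauses say that the formulas of
  the code define the full preimages of the graphs of the symbols on the quotient.
\<close>

definition code_struct ::
  "language \<Rightarrow> interp_code \<Rightarrow> 'b struct \<Rightarrow> 'b list \<Rightarrow> 'b list set struct \<Rightarrow> bool" where
  "code_struct L \<Gamma> B p S \<longleftrightarrow> is_struct S \<and> lang S = L \<and>
     equiv (code_dom \<Gamma> B p) (code_eqv \<Gamma> B p) \<and>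
     universe S = code_dom \<Gamma> B p // code_eqv \<Gamma> B p \<and>
     (\<forall>f < length (funs L). \<forall>bs \<in> tuples (funs L ! f) (code_dom \<Gamma> B p). \<forall>b \<in> code_dom \<Gamma> B p.
        sat B (concat bs @ b @ p) (fun_fm \<Gamma> f) \<longleftrightarrow>
        fn S f (map (code_class \<Gamma> B p) bs) = code_class \<Gamma> B p b) \<and>
     (\<forall>r < length (rels L). \<forall>bs \<in> tuples (rels L ! r) (code_dom \<Gamma> B p).
        sat B (concat bs @ p) (rel_fm \<Gamma> r) \<longleftrightarrow> rel S r (map (code_class \<Gamma> B p) bs))"

text \<open>\<open>A\<close> is interpretable in \<open>B\<close> with parameters \<open>p\<close> via \<open>\<Gamma>\<close>,
  with coordinate map \<open>\<mu>\<close>.\<close>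

definition interpretation_via ::
  "interp_code \<Rightarrow> 'b struct \<Rightarrow> 'b list \<Rightarrow> 'a struct \<Rightarrow> ('b list \<Rightarrow> 'a) \<Rightarrow> bool" where
  "interpretation_via \<Gamma> B p A \<mu> \<longleftrightarrow>
     is_code (lang A) (lang B) \<Gamma> \<and> p \<in> tuples (npars \<Gamma>) (universe B) \<and>
     (\<exists>S h. code_struct (lang A) \<Gamma> B p S \<and> isomorphism h S A \<and>
        (\<forall>b \<in> code_dom \<Gamma> B p. \<mu> b = h (code_class \<Gamma> B p b)))"

primrec rename_tm :: "(nat \<Rightarrow> nat) \<Rightarrow> tm \<Rightarrow> tm" where
  "rename_tm \<rho> (Var i) = Var (\<rho> i)"
| "rename_tm \<rho> (Fn f ts) = Fn f (map (rename_tm \<rho>) ts)"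

primrec rename :: "(nat \<Rightarrow> nat) \<Rightarrow> fm \<Rightarrow> fm" where
  "rename \<rho> (Eq s t) = Eq (rename_tm \<rho> s) (rename_tm \<rho> t)"
| "rename \<rho> (Rel r ts) = Rel r (map (rename_tm \<rho>) ts)"
| "rename \<rho> (Neg \<phi>) = Neg (rename \<rho> \<phi>)"
| "rename \<rho> (Conj \<phi> \<psi>) = Conj (rename \<rho> \<phi>) (rename \<rho> \<psi>)"
| "rename \<rho> (Ex \<phi>) = Ex (rename (case_nat 0 (\<lambda>i. Suc (\<rho> i))) \<phi>)"

text \<open>
  A formula in \<open>k\<close> variables is translated along \<open>\<Delta>\<close> into a formula about
  \<open>k\<close> tuples: its variables are \<open>k\<close> consecutive blocks of length \<open>dim \<Delta>\<close>
  followed by the parameters of \<open>\<Delta>\<close>.  In such a context, \<open>at_blocks \<Delta> k is \<phi>\<close>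
  is the formula \<open>\<phi>\<close> of the code \<open>\<Delta>\<close> applied to the blocks with numbers
  \<open>is\<close>, and \<open>ex_blocks \<Delta> k m \<phi>\<close> quantifies over \<open>m\<close> new blocks from the
  domain of \<open>\<Delta>\<close>, which \<open>\<phi>\<close> sees in front of the \<open>k\<close> old ones.
\<close>

definition at_blocks :: "interp_code \<Rightarrow> nat \<Rightarrow> nat list \<Rightarrow> fm \<Rightarrow> fm" where
  "at_blocks \<Delta> k is \<phi> = rename (\<lambda>j.
     if j < length is * dim \<Delta> then (is ! (j div dim \<Delta>)) * dim \<Delta> + j mod dim \<Delta>
     else k * dim \<Delta> + (j - length is * dim \<Delta>)) \<phi>"

definition in_dom :: "interp_code \<Rightarrow> nat \<Rightarrow> nat \<Rightarrow> fm \<Rightarrow> fm" where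
  "in_dom \<Delta> k m \<phi> = foldr Conj (map (\<lambda>i. at_blocks \<Delta> k [i] (dom_fm \<Delta>)) [0..<m]) \<phi>"

definition ex_blocks :: "interp_code \<Rightarrow> nat \<Rightarrow> nat \<Rightarrow> fm \<Rightarrow> fm" where
  "ex_blocks \<Delta> k m \<phi> = (Ex ^^ (m * dim \<Delta>)) (in_dom \<Delta> (k + m) m \<phi>)"

text \<open>
  \<open>tr_tm \<Delta> k d s t\<close>: block \<open>s\<close> represents the value of \<open>t\<close>, where variable
  \<open>i\<close> of \<open>t\<close> is represented by block \<open>d + i\<close>.  In \<open>tr_tms\<close> the consecutive
  blocks \<open>s, s + 1, \<dots>\<close> represent the values of the terms of a list.
\<close>

fun tr_tm :: "interp_code \<Rightarrow> nat \<Rightarrow> nat \<Rightarrow> nat \<Rightarrow> tm \<Rightarrow> fm"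
  and tr_tms :: "interp_code \<Rightarrow> nat \<Rightarrow> nat \<Rightarrow> nat \<Rightarrow> tm list \<Rightarrow> fm list" where
  "tr_tm \<Delta> k d s (Var i) = at_blocks \<Delta> k [s, d + i] (eq_fm \<Delta>)"
| "tr_tm \<Delta> k d s (Fn f ts) = (let m = length ts in
     ex_blocks \<Delta> k m (foldr Conj (tr_tms \<Delta> (k + m) (d + m) 0 ts)
       (at_blocks \<Delta> (k + m) ([0..<m] @ [s + m]) (fun_fm \<Delta> f))))"
| "tr_tms \<Delta> k d s [] = []"
| "tr_tms \<Delta> k d s (t # ts) = tr_tm \<Delta> k d s t # tr_tms \<Delta> k d (Suc s) ts"

primrec tr_fm :: "interp_code \<Rightarrow> nat \<Rightarrow> fm \<Rightarrow> fm" where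
  "tr_fm \<Delta> k (Eq s t) =
     ex_blocks \<Delta> k 2 (foldr Conj (tr_tms \<Delta> (k + 2) 2 0 [s, t])
       (at_blocks \<Delta> (k + 2) [0, 1] (eq_fm \<Delta>)))"
| "tr_fm \<Delta> k (Rel r ts) = (let m = length ts in
     ex_blocks \<Delta> k m (foldr Conj (tr_tms \<Delta> (k + m) m 0 ts)
       (at_blocks \<Delta> (k + m) [0..<m] (rel_fm \<Delta> r))))"
| "tr_fm \<Delta> k (Neg \<phi>) = Neg (tr_fm \<Delta> k \<phi>)"
| "tr_fm \<Delta> k (Conj \<phi> \<psi>) = Conj (tr_fm \<Delta> k \<phi>) (tr_fm \<Delta> k \<psi>)"
| "tr_fm \<Delta> k (Ex \<phi>) = ex_blocks \<Delta> k 1 (tr_fm \<Delta> (Suc k) \<phi>)"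

text \<open>
  \<open>\<Gamma> \<circ> \<Delta>\<close> for a code \<open>\<Gamma>\<close> of \<open>L\<close>-structures.  Its parameters are
  \<open>npars \<Gamma>\<close> blocks standing for the parameters of \<open>\<Gamma>\<close>, followed by the
  parameters of \<open>\<Delta>\<close>.
\<close>

definition compose :: "language \<Rightarrow> interp_code \<Rightarrow> interp_code \<Rightarrow> interp_code" where
  "compose L \<Gamma> \<Delta> = (let n = dim \<Gamma>; m = npars \<Gamma> in
     \<lparr>dim = n * dim \<Delta>,
      npars = m * dim \<Delta> + npars \<Delta>,
      dom_fm = in_dom \<Delta> (n + m) n (tr_fm \<Delta> (n + m) (dom_fm \<Gamma>)),
      eq_fm = tr_fm \<Delta> (2 * n + m) (eq_fm \<Gamma>),
      fun_fm = (\<lambda>f. tr_fm \<Delta> (Suc (funs L ! f) * n + m) (fun_fm \<Gamma> f)),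
      rel_fm = (\<lambda>r. tr_fm \<Delta> ((rels L ! r) * n + m) (rel_fm \<Gamma> r))\<rparr>)"

text \<open>\<open>\<theta>(u,x,p)\<close> defines in \<open>A\<close> an isomorphism (seen as coordinate map)
  from \<open>\<Gamma>(A,p)\<close> onto \<open>A\<close>.\<close>

definition defines_isomorphism ::
  "fm \<Rightarrow> interp_code \<Rightarrow> 'a struct \<Rightarrow> 'a list \<Rightarrow> bool" where
  "defines_isomorphism \<theta> \<Gamma> A p \<longleftrightarrow>
     wf_fm (lang A) (dim \<Gamma> + 1 + npars \<Gamma>) \<theta> \<and>
     (\<exists>\<mu>. interpretation_via \<Gamma> A p A \<mu> \<and>
        (\<forall>u \<in> code_dom \<Gamma> A p. \<forall>x \<in> universe A. sat A (u @ [x] @ p) \<theta> \<longleftrightarrow> \<mu> u = x))"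

definition bi_interpretation ::
  "interp_code \<Rightarrow> interp_code \<Rightarrow> 'a struct \<Rightarrow> 'a list \<Rightarrow> 'b struct \<Rightarrow> 'b list \<Rightarrow> bool" where
  "bi_interpretation \<Gamma> \<Delta> A q B p \<longleftrightarrow>
     (\<exists>\<mu>\<^sub>\<Gamma> \<mu>\<^sub>\<Delta> p\<^sub>0 q\<^sub>0 \<theta>\<^sub>A \<theta>\<^sub>B.
        interpretation_via \<Gamma> B p A \<mu>\<^sub>\<Gamma> \<and> interpretation_via \<Delta> A q B \<mu>\<^sub>\<Delta> \<and>
        set p\<^sub>0 \<subseteq> code_dom \<Delta> A q \<and> map \<mu>\<^sub>\<Delta> p\<^sub>0 = p \<and>
        set q\<^sub>0 \<subseteq> code_dom \<Gamma> B p \<and> map \<mu>\<^sub>\<Gamma> q\<^sub>0 = q \<and>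
        defines_isomorphism \<theta>\<^sub>A (compose (lang A) \<Gamma> \<Delta>) A (concat p\<^sub>0 @ q) \<and>
        defines_isomorphism \<theta>\<^sub>B (compose (lang B) \<Delta> \<Gamma>) B (concat q\<^sub>0 @ p))"

definition bi_interpretable :: "'a struct \<Rightarrow> 'b struct \<Rightarrow> bool" where
  "bi_interpretable A B \<longleftrightarrow> (\<exists>\<Gamma> \<Delta> p q. bi_interpretation \<Gamma> \<Delta> A q B p)"

definition absolutely_bi_interpretable :: "'a struct \<Rightarrow> 'b struct \<Rightarrow> bool" where
  "absolutely_bi_interpretable A B \<longleftrightarrow> (\<exists>\<Gamma> \<Delta>. bi_interpretation \<Gamma> \<Delta> A [] B [])"

end

(* Along an interpretation of A in B, the structure HF(A) is interpretable in HF(B): hereditarily finite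
   sets over A are coded by hereditarily finite sets over B, and equality of codes is the existence of a
   bisimulation, which is a single element of HF(B). Hence every WSOL formula of A becomes one of B, which
   richness of B turns into a first-order formula of B, which the interpretation of B in A turns into a
   first-order formula of A. That formula speaks about the copy of A inside the copy of B inside A; the
   definable isomorphism of this copy with A makes it a formula about A itself. The definable isomorphism
   may differ from the composed coordinate map by an automorphism of A, which is absorbed by changing the
   coordinate map of A in B. For effectiveness, the only recursive step is the translation of formulas along
   a code, a recursion over Goedel numbers whose parameters change; it is carried out by a stack machine. *)

theory Submission
  imports Defs
begin

section \<open>Computable functions\<close>

text \<open>A code is never unique, since an element of A may be represented by many tuples.
  Equality of codes is a recursion along membership, which a first-order formula cannot follow; a
  finite bisimulation takes its place. Being a code at all meets the same obstacle and gets the same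
  cure: a finite certificate that is one element of HF(B).

  Richness of B may bring in further parameters, and how many there are is known only after its map
  on formulas has been applied. The formulas built around the result must therefore be computable
  with the numbers of variables and parameters as inputs.

  The formulas of the codes and the defining formula of the isomorphism are chosen before the input
  formula. Renaming them with computed indices unfolds a known syntax tree outside the computation;
  only the translation of an unknown formula needs genuine recursion on Goedel numbers.\<close>

definition ncomp :: "nat \<Rightarrow> (nat list \<Rightarrow> nat) \<Rightarrow> bool" where
  "ncomp n f \<longleftrightarrow> (\<exists>c. \<forall>xs. length xs = n \<longrightarrow> computes c xs (f xs))"

lemma ncomp_zero: "ncomp n (\<lambda>_. 0)"
  unfolding ncomp_def by (blast intro: computes.intros)

lemma ncomp_proj: "i < n \<Longrightarrow> ncomp n (\<lambda>xs. xs ! i)"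
  unfolding ncomp_def by (metis computes.intros(3))

lemma ncomp_suc: "ncomp 1 (\<lambda>xs. Suc (xs ! 0))"
  unfolding ncomp_def
  by (rule exI[of _ Succ]) (auto simp: length_Suc_conv intro: computes.intros)

lemma ncomp_comp:
  assumes f: "ncomp (length gs) f" and gs: "\<forall>g \<in> set gs. ncomp n g"
  shows "ncomp n (\<lambda>xs. f (map (\<lambda>g. g xs) gs))"
proof -
  obtain c where c: "\<forall>xs. length xs = length gs \<longrightarrow> computes c xs (f xs)"
    using f unfolding ncomp_def by blast
  obtain d where d: "\<forall>g \<in> set gs. \<forall>xs. length xs = n \<longrightarrow> computes (d g) xs (g xs)"
    using gs unfolding ncomp_def by metis
  have "computes (Comp c (map d gs)) xs (f (map (\<lambda>g. g xs) gs))" if "length xs = n" for xs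
    using c d that
    by (intro computes.intros(4)[where ys = "map (\<lambda>g. g xs) gs"]) (auto simp: list_all2_conv_all_nth)
  then show ?thesis unfolding ncomp_def by blast
qed

lemma ncomp_comp1:
  assumes "ncomp 1 (\<lambda>xs. f (xs ! 0))" "ncomp n g"
  shows "ncomp n (\<lambda>xs. f (g xs))"
  using ncomp_comp[of "[g]" "\<lambda>xs. f (xs ! 0)" n] assms by simp

lemma ncomp_comp2:
  assumes "ncomp 2 (\<lambda>xs. f (xs ! 0) (xs ! 1))" "ncomp n g" "ncomp n h"
  shows "ncomp n (\<lambda>xs. f (g xs) (h xs))"
  using ncomp_comp[of "[g, h]" "\<lambda>xs. f (xs ! 0) (xs ! 1)" n] assms by (simp add: numeral_2_eq_2)

lemma ncomp_primrec:
  assumes f: "ncomp n f" and g: "ncomp (Suc (Suc n)) g"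
  shows "ncomp (Suc n) (\<lambda>xs. rec_nat (f (tl xs)) (\<lambda>k r. g (k # r # tl xs)) (hd xs))"
proof -
  obtain c d where c: "\<And>xs. length xs = n \<Longrightarrow> computes c xs (f xs)"
    and d: "\<And>xs. length xs = Suc (Suc n) \<Longrightarrow> computes d xs (g xs)"
    using assms unfolding ncomp_def by blast
  have "computes (PrimRec c d) (k # ys) (rec_nat (f ys) (\<lambda>k r. g (k # r # ys)) k)"
    if "length ys = n" for k ys
    using that by (induction k) (auto intro!: computes.intros(5,6) c d)
  then have "computes (PrimRec c d) xs (rec_nat (f (tl xs)) (\<lambda>k r. g (k # r # tl xs)) (hd xs))"
    if "length xs = Suc n" for xs
    using that by (cases xs) auto
  then show ?thesis unfolding ncomp_def by blast
qed

text \<open>The function \<open>h\<close> enters through its recursion equations, so existing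
  functions such as addition or \<open>triangle\<close> need not first be rewritten with
  \<open>rec_nat\<close>.\<close>

lemma ncomp_primrec2:
  assumes f: "ncomp 1 (\<lambda>xs. f (xs ! 0))" and g: "ncomp 3 (\<lambda>xs. g (xs ! 0) (xs ! 1) (xs ! 2))"
    and h: "\<And>y. h 0 y = f y" "\<And>k y. h (Suc k) y = g k (h k y) y"
  shows "ncomp 2 (\<lambda>xs. h (xs ! 0) (xs ! 1))"
proof -
  have *: "h k y = rec_nat (f y) (\<lambda>k r. g k r y) k" for k y
    by (induction k) (auto simp: h)
  have "ncomp (Suc 1) (\<lambda>xs. rec_nat (f (tl xs ! 0)) (\<lambda>k r. (\<lambda>xs. g (xs ! 0) (xs ! 1) (xs ! 2))
    (k # r # tl xs)) (hd xs))"
    by (rule ncomp_primrec[OF f]) (use g in \<open>simp add: numeral_3_eq_3\<close>)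
  then show ?thesis
    unfolding ncomp_def *
    by (elim ex_forward all_forward) (auto simp: numeral_2_eq_2 length_Suc_conv)
qed

text \<open>Only total functions are considered, hence the premise that a zero exists. Minimality
  makes all earlier values positive, as the rule for \<open>Mu\<close> demands.\<close>

lemma ncomp_mu:
  assumes f: "ncomp (Suc n) f" and ex: "\<And>xs. length xs = n \<Longrightarrow> \<exists>k. f (k # xs) = 0"
  shows "ncomp n (\<lambda>xs. LEAST k. f (k # xs) = 0)"
proof -
  obtain c where c: "\<And>xs. length xs = Suc n \<Longrightarrow> computes c xs (f xs)"
    using f unfolding ncomp_def by blast
  have "computes (Mu c) xs (LEAST k. f (k # xs) = 0)" if "length xs = n" for xs
  proof (rule computes.intros(7), intro allI impI)
    fix i assume "i < (LEAST k. f (k # xs) = 0)"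
    then have "f (i # xs) > 0" using not_less_Least by blast
    then show "\<exists>y>0. computes c (i # xs) y" using c that by (metis length_Cons)
  next
    have "f ((LEAST k. f (k # xs) = 0) # xs) = 0" using ex[OF that] by (rule LeastI_ex)
    then show "computes c ((LEAST k. f (k # xs) = 0) # xs) 0" using c that by (metis length_Cons)
  qed
  then show ?thesis unfolding ncomp_def by blast
qed

lemma computable_iff_ncomp: "computable F \<longleftrightarrow> ncomp 1 (\<lambda>xs. F (xs ! 0))"
  unfolding computable_def ncomp_def
  by (rule ex_cong1) (force simp: length_Suc_conv)

lemma ncomp_computable: "computable F \<Longrightarrow> ncomp n g \<Longrightarrow> ncomp n (\<lambda>xs. F (g xs))"
  unfolding computable_iff_ncomp by (rule ncomp_comp1)

lemma computable_comp: "computable f \<Longrightarrow> computable g \<Longrightarrow> computable (\<lambda>x. f (g x))"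
  unfolding computable_iff_ncomp by (rule ncomp_comp1)

lemma computable_comp2:
  "ncomp 2 (\<lambda>xs. f (xs ! 0) (xs ! 1)) \<Longrightarrow> computable g \<Longrightarrow> computable h \<Longrightarrow>
    computable (\<lambda>x. f (g x) (h x))"
  unfolding computable_iff_ncomp by (rule ncomp_comp2)

lemma computable_id: "computable (\<lambda>x. x)"
  unfolding computable_iff_ncomp by (rule ncomp_proj) simp

lemma ncomp_Suc: "ncomp n f \<Longrightarrow> ncomp n (\<lambda>xs. Suc (f xs))"
  by (rule ncomp_comp1[OF ncomp_suc])

lemma ncomp_add: "ncomp n f \<Longrightarrow> ncomp n g \<Longrightarrow> ncomp n (\<lambda>xs. f xs + g xs)"
proof (rule ncomp_comp2[of "(+)"])
  show "ncomp 2 (\<lambda>xs. xs ! 0 + xs ! 1)"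
    by (rule ncomp_primrec2[of "\<lambda>y. y" "\<lambda>k r y. Suc r"]) (intro ncomp_Suc ncomp_proj; simp | simp)+
qed

lemma ncomp_mult: "ncomp n f \<Longrightarrow> ncomp n g \<Longrightarrow> ncomp n (\<lambda>xs. f xs * g xs)"
proof (rule ncomp_comp2[of "(*)"])
  show "ncomp 2 (\<lambda>xs. xs ! 0 * xs ! 1)"
    by (rule ncomp_primrec2[of "\<lambda>y. 0" "\<lambda>k r y. r + y"])
      (intro ncomp_add ncomp_zero ncomp_proj; simp | simp)+
qed

lemma ncomp_pred: "ncomp n f \<Longrightarrow> ncomp n (\<lambda>xs. f xs - 1)"
\<comment> \<open>The scheme \<open>ncomp_primrec2\<close> has exactly one parameter, so the unary
  predecessor takes a dummy second argument.\<close>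
proof (rule ncomp_comp2[of "\<lambda>x y. x - 1" n f f])
  show "ncomp 2 (\<lambda>xs. (\<lambda>x y. x - 1) (xs ! 0) (xs ! 1))"
    by (rule ncomp_primrec2[of "\<lambda>y. 0" "\<lambda>k r y. k" "\<lambda>x y. x - 1"]) (intro ncomp_zero ncomp_proj; simp | simp)+
qed

lemma ncomp_diff:
  assumes "ncomp n f" "ncomp n g"
  shows "ncomp n (\<lambda>xs. f xs - g xs)"
\<comment> \<open>The recursion runs on the number that is subtracted, and
  \<open>ncomp_primrec2\<close> recurs on the first argument; hence the swap.\<close>
proof (rule ncomp_comp2[of "\<lambda>x y. y - x", OF _ assms(2,1)])
  show "ncomp 2 (\<lambda>xs. (\<lambda>x y. y - x) (xs ! 0) (xs ! 1))"
    by (rule ncomp_primrec2[of "\<lambda>y. y" "\<lambda>k r y. r - 1" "\<lambda>x y. y - x"]) (intro ncomp_pred ncomp_proj; simp | simp)+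
qed

lemma ncomp_triangle: "ncomp n f \<Longrightarrow> ncomp n (\<lambda>xs. triangle (f xs))"
proof (rule ncomp_comp2[of "\<lambda>x y. triangle x" n f f])
  show "ncomp 2 (\<lambda>xs. (\<lambda>x y. triangle x) (xs ! 0) (xs ! 1))"
    by (rule ncomp_primrec2[of "\<lambda>y. 0" "\<lambda>k r y. r + Suc k" "\<lambda>x y. triangle x"])
      (intro ncomp_zero ncomp_proj ncomp_add ncomp_Suc; simp | simp)+
qed

lemma ncomp_prod_encode:
  "ncomp n f \<Longrightarrow> ncomp n g \<Longrightarrow> ncomp n (\<lambda>xs. prod_encode (f xs, g xs))"
  unfolding prod_encode_def prod.case by (intro ncomp_add ncomp_triangle)

lemma computable_Suc: "computable f \<Longrightarrow> computable (\<lambda>x. Suc (f x))"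
  unfolding computable_iff_ncomp by (rule ncomp_Suc)

lemma computable_const: "computable (\<lambda>_. c)"
proof (induction c)
  case 0
  show ?case unfolding computable_iff_ncomp by (rule ncomp_zero)
qed (rule computable_Suc)

lemma computable_add: "computable f \<Longrightarrow> computable g \<Longrightarrow> computable (\<lambda>x. f x + g x)"
  unfolding computable_iff_ncomp by (rule ncomp_add)

lemma computable_mult: "computable f \<Longrightarrow> computable g \<Longrightarrow> computable (\<lambda>x. f x * g x)"
  unfolding computable_iff_ncomp by (rule ncomp_mult)

lemma computable_diff: "computable f \<Longrightarrow> computable g \<Longrightarrow> computable (\<lambda>x. f x - g x)"
  unfolding computable_iff_ncomp by (rule ncomp_diff)

lemma computable_prod_encode:
  "computable f \<Longrightarrow> computable g \<Longrightarrow> computable (\<lambda>x. prod_encode (f x, g x))"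
  unfolding computable_iff_ncomp by (rule ncomp_prod_encode)

section \<open>Unpairing, and recursion for unary functions\<close>

abbreviation lft :: "nat \<Rightarrow> nat" where "lft z \<equiv> fst (prod_decode z)"
abbreviation rgt :: "nat \<Rightarrow> nat" where "rgt z \<equiv> snd (prod_decode z)"

text \<open>The sum of the components is the diagonal of \<open>z\<close> in Cantor's enumeration,
  the least \<open>w\<close> with \<open>z < triangle (Suc w)\<close>. A vanishing truncated
  difference is the form of this condition that minimisation accepts.\<close>

lemma Least_triangle: "(LEAST w. Suc z - triangle (Suc w) = 0) = lft z + rgt z"
proof (rule Least_equality)
  have z: "z = triangle (lft z + rgt z) + lft z"
    using prod_decode_inverse[of z] by (simp add: prod_encode_def split: prod.splits)
  show "Suc z - triangle (Suc (lft z + rgt z)) = 0"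
    using z by simp
  show "lft z + rgt z \<le> w" if w: "Suc z - triangle (Suc w) = 0" for w
  proof (rule ccontr)
    assume "\<not> ?thesis"
    then have le: "Suc w \<le> lft z + rgt z" by simp
    have "mono triangle" unfolding mono_def triangle_def by (intro allI impI div_le_mono mult_le_mono) auto
    then have "triangle (Suc w) \<le> triangle (lft z + rgt z)" using le by (rule monoD)
    then show False using z w by linarith
  qed
qed

lemma computable_diag: "computable (\<lambda>z. lft z + rgt z)"
proof -
  have "ncomp 1 (\<lambda>xs. LEAST k. (\<lambda>ys. Suc (ys ! 1) - triangle (Suc (ys ! 0))) (k # xs) = 0)"
  proof (rule ncomp_mu)
    show "ncomp (Suc 1) (\<lambda>ys. Suc (ys ! 1) - triangle (Suc (ys ! 0)))"
      by (intro ncomp_diff ncomp_triangle ncomp_Suc ncomp_proj) auto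
    show "\<exists>k. Suc ((k # xs) ! 1) - triangle (Suc ((k # xs) ! 0)) = 0" for xs
      by (rule exI[of _ "xs ! 0"]) simp
  qed
  then show ?thesis
    unfolding computable_iff_ncomp
    by (simp only: nth_Cons_0 nth_Cons_Suc One_nat_def Least_triangle)
qed

lemma lft_eq: "lft z = z - triangle (lft z + rgt z)"
  using prod_decode_inverse[of z] by (simp add: prod_encode_def split: prod.splits)

lemma computable_lft: "computable f \<Longrightarrow> computable (\<lambda>x. lft (f x))"
proof (rule computable_comp[of lft])
  have triangle: "computable triangle"
    unfolding computable_iff_ncomp by (intro ncomp_triangle ncomp_proj) simp
  have "computable (\<lambda>z. z - triangle (lft z + rgt z))"
    by (intro computable_diff computable_id
        computable_comp[OF triangle] computable_diag)
  then show "computable lft" by (simp only: lft_eq[symmetric])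
qed

lemma computable_rgt: "computable f \<Longrightarrow> computable (\<lambda>x. rgt (f x))"
proof (rule computable_comp[of rgt])
  have "computable (\<lambda>z. lft z + rgt z - lft z)"
    by (intro computable_diff computable_diag computable_lft computable_id)
  then show "computable rgt" by simp
qed

text \<open>From here on all functions are unary and several arguments travel as one pair: the step
  function reads the input, the counter and the previous value from \<open>z\<close>.\<close>

lemma computable_rec:
  assumes b: "computable b"
    and g: "computable (\<lambda>z. g (lft z) (lft (rgt z)) (rgt (rgt z)))"
    and n: "computable n"
  shows "computable (\<lambda>x. rec_nat (b x) (\<lambda>k r. g x k r) (n x))"
proof -
  have "ncomp 3 (\<lambda>xs. (\<lambda>z. g (lft z) (lft (rgt z)) (rgt (rgt z)))
      (prod_encode (xs ! 2, prod_encode (xs ! 0, xs ! 1))))"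
    by (intro ncomp_computable[OF g] ncomp_prod_encode ncomp_proj) auto
  then have g': "ncomp 3 (\<lambda>xs. (\<lambda>k r y. g y k r) (xs ! 0) (xs ! 1) (xs ! 2))"
    by simp
  have "ncomp 2 (\<lambda>xs. rec_nat (b (xs ! 1)) (\<lambda>k r. g (xs ! 1) k r) (xs ! 0))"
    by (rule ncomp_primrec2[OF b[unfolded computable_iff_ncomp] g',
        of "\<lambda>k y. rec_nat (b y) (\<lambda>k r. g y k r) k"]) auto
  then show ?thesis by (rule computable_comp2[OF _ n computable_id])
qed

lemma computable_Least:
  assumes f: "computable (\<lambda>z. f (lft z) (rgt z))" and ex: "\<And>x. \<exists>k. f x k = 0"
  shows "computable (\<lambda>x. LEAST k. f x k = 0)"
proof -
  have "ncomp 1 (\<lambda>xs. LEAST k. (\<lambda>ys. (\<lambda>z. f (lft z) (rgt z)) (prod_encode (ys ! 1, ys ! 0))) (k # xs) = 0)"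
  proof (rule ncomp_mu)
    show "ncomp (Suc 1) (\<lambda>ys. (\<lambda>z. f (lft z) (rgt z)) (prod_encode (ys ! 1, ys ! 0)))"
      by (intro ncomp_computable[OF f] ncomp_prod_encode ncomp_proj) auto
  qed (use ex in simp)
  then show ?thesis unfolding computable_iff_ncomp by simp
qed

text \<open>A case distinction is a recursion whose step ignores the counter and the previous
  value.\<close>

lemma computable_if0:
  assumes c: "computable c" and f: "computable f" and g: "computable g"
  shows "computable (\<lambda>x. if c x = 0 then f x else g x)"
proof -
  have "computable (\<lambda>x. rec_nat (f x) (\<lambda>k r. g x) (c x))"
    by (intro computable_rec f c computable_comp[OF g] computable_lft computable_id)
  moreover have "rec_nat (f x) (\<lambda>k r. g x) (c x) = (if c x = 0 then f x else g x)" for x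
    by (cases "c x") auto
  ultimately show ?thesis by simp
qed

lemma computable_if_eq:
  assumes "computable c" "computable d" "computable f" "computable g"
  shows "computable (\<lambda>x. if c x = d x then f x else g x)"
proof -
  have "computable (\<lambda>x. if (c x - d x) + (d x - c x) = 0 then f x else g x)"
    by (intro computable_if0 computable_add computable_diff assms)
  moreover have "(c x - d x) + (d x - c x) = 0 \<longleftrightarrow> c x = d x" for x
    by auto
  ultimately show ?thesis by (simp only:)
qed

lemma computable_if_less:
  assumes "computable c" "computable d" "computable f" "computable g"
  shows "computable (\<lambda>x. if c x < d x then f x else g x)"
proof -
  have "computable (\<lambda>x. if Suc (c x) - d x = 0 then f x else g x)"
    by (intro computable_if0 computable_Suc computable_diff assms)
  then show ?thesis by (simp add: Suc_le_eq)
qed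

lemmas computable_intros = computable_const computable_id computable_Suc computable_add
  computable_mult computable_diff computable_prod_encode computable_lft computable_rgt
  computable_if_eq computable_if_less

lemma computable_funpow:
  assumes f: "computable f" and n: "computable n" and b: "computable b"
  shows "computable (\<lambda>x. (f ^^ n x) (b x))"
proof -
  have "computable (\<lambda>x. rec_nat (b x) (\<lambda>k r. f r) (n x))"
    by (intro computable_rec computable_comp[OF f] computable_intros assms)
  moreover have "rec_nat y (\<lambda>k r. f r) k = (f ^^ k) y" for y k
    by (induction k) auto
  ultimately show ?thesis by simp
qed

section \<open>A stack machine for tree recursion\<close>

definition frame :: "nat \<Rightarrow> nat \<Rightarrow> nat \<Rightarrow> nat \<Rightarrow> nat" where
  "frame y cs acc S = Suc (prod_encode (prod_encode (y, prod_encode (cs, acc)), S))"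

text \<open>A state is a stack paired with a value. A frame holds an argument, the calls still to be
  made for it and the results so far, latest first. The empty stack is 0, and the \<open>Suc\<close>
  in \<open>frame\<close> keeps nonempty stacks apart from it. An empty stack means that the machine
  has halted; only then is the value meaningful.\<close>

definition step :: "(nat \<Rightarrow> nat) \<Rightarrow> (nat \<Rightarrow> nat) \<Rightarrow> nat \<Rightarrow> nat" where
  "step ch cb s =
    (let S = lft s; f = lft (S - 1); S' = rgt (S - 1);
         y = lft f; cs = lft (rgt f); acc = rgt (rgt f); v = cb (prod_encode (y, acc));
         f' = lft (S' - 1)
     in if S = 0 then s
        else if cs = 0 then
          (if S' = 0 then prod_encode (0, v)
           else prod_encode (frame (lft f') (lft (rgt f')) (Suc (prod_encode (v, rgt (rgt f'))))
             (rgt (S' - 1)), 0))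
        else prod_encode (frame (lft (cs - 1)) (ch (lft (cs - 1))) 0
          (frame y (rgt (cs - 1)) acc S'), 0))"

lemma computable_step:
  assumes "computable ch" "computable cb"
  shows "computable (step ch cb)"
  unfolding step_def[abs_def] Let_def frame_def
  by (intro computable_intros computable_comp[OF assms(1)] computable_comp[OF assms(2)])

lemma step_halted: "lft s = 0 \<Longrightarrow> (step ch cb ^^ n) s = s"
  by (induction n) (auto simp: step_def)

text \<open>Halted states are fixed points, so the state at the least halting time is the state at
  every later time.\<close>

lemma halted_value:
  assumes n: "(step ch cb ^^ n) s = prod_encode (0, v)"
  shows "rgt ((step ch cb ^^ (LEAST n. lft ((step ch cb ^^ n) s) = 0)) s) = v"
proof -
  define f where "f = step ch cb"
  define N where "N = (LEAST n. lft ((f ^^ n) s) = 0)"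
  have n0: "lft ((f ^^ n) s) = 0" using n by (simp add: f_def)
  then have "N \<le> n" unfolding N_def by (rule Least_le)
  then have "(f ^^ n) s = (f ^^ (n - N)) ((f ^^ N) s)"
    by (subst funpow_add[THEN fun_cong, unfolded comp_apply, symmetric]) simp
  moreover have "lft ((f ^^ N) s) = 0"
    unfolding N_def by (rule LeastI[of "\<lambda>n. lft ((f ^^ n) s) = 0", OF n0])
  ultimately have "(f ^^ N) s = prod_encode (0, v)"
    using n step_halted unfolding f_def by metis
  then show ?thesis unfolding N_def f_def by simp
qed

lemma step_call:
  "step ch cb (prod_encode (frame y (Suc (prod_encode (c, cs))) acc S, v)) =
    prod_encode (frame c (ch c) 0 (frame y cs acc S), 0)"
  by (simp add: step_def frame_def)

lemma step_return:
  "step ch cb (prod_encode (frame c 0 acc (frame y cs acc' S), v)) =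
    prod_encode (frame y cs (Suc (prod_encode (cb (prod_encode (c, acc)), acc'))) S, 0)"
  by (simp add: step_def frame_def)

lemma step_finish:
  "step ch cb (prod_encode (frame c 0 acc 0, v)) = prod_encode (0, cb (prod_encode (c, acc)))"
  by (simp add: step_def frame_def)

text \<open>Hiding the number of steps spares all counting; a search for the halting time recovers
  it at the end.\<close>

definition reaches :: "('a \<Rightarrow> 'a) \<Rightarrow> 'a \<Rightarrow> 'a \<Rightarrow> bool" where
  "reaches f s t \<longleftrightarrow> (\<exists>n. (f ^^ n) s = t)"

lemma reaches_refl: "reaches f s s"
  unfolding reaches_def by (rule exI[of _ 0]) simp

lemma reaches_step: "reaches f (f s) t \<Longrightarrow> reaches f s t"
  unfolding reaches_def by (metis comp_apply funpow_Suc_right)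

lemma reaches_trans: "reaches f s t \<Longrightarrow> reaches f t u \<Longrightarrow> reaches f s u"
  unfolding reaches_def by (metis comp_apply funpow_add)

text \<open>Arguments are arbitrary numbers, so they may change freely from call to call. The
  measure \<open>M\<close> only guarantees termination and is never evaluated by the machine.
  Results come in reverse order because each new one is put in front of the accumulator.\<close>

theorem computable_tree_recursion:
  fixes M :: "nat \<Rightarrow> nat"
  assumes ch: "computable ch" and cb: "computable cb"
    and dec: "\<And>y c. c \<in> set (list_decode (ch y)) \<Longrightarrow> M c < M y"
  obtains F where "computable F"
    "\<And>y. F y = cb (prod_encode (y, list_encode (rev (map F (list_decode (ch y))))))"
proof -
  define H where "H F y = cb (prod_encode (y, list_encode (rev (map F (list_decode (ch y))))))"
    for F :: "nat \<Rightarrow> nat" and y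
  \<comment> \<open>The solution exists by well-founded recursion; what remains is that the machine
    computes it.\<close>
  define F where "F = wfrec (measure M) H"
  have F: "F y = cb (prod_encode (y, list_encode (rev (map F (list_decode (ch y))))))" for y
  proof -
    have "F y = H (cut F (measure M) y) y"
      unfolding F_def by (rule wfrec) simp
    also have "map (cut F (measure M) y) (list_decode (ch y)) = map F (list_decode (ch y))"
      by (rule map_cong[OF refl]) (simp add: cut_apply dec)
    then have "H (cut F (measure M) y) y = H F y"
      by (simp only: H_def)
    finally show ?thesis unfolding H_def .
  qed
  let ?s = "step ch cb"
  \<comment> \<open>One frame works off its list of calls, provided that each single call is carried
    out correctly on top of an arbitrary stack.\<close>
  have args: "\<exists>v'. reaches ?s (prod_encode (frame y (list_encode cs) (list_encode as) S, v))
      (prod_encode (frame y 0 (list_encode (rev (map F cs) @ as)) S, v'))"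
    if "\<And>c y' cs' acc' S v. c \<in> set cs \<Longrightarrow>
        reaches ?s (prod_encode (frame c (ch c) 0 (frame y' cs' acc' S), v))
          (prod_encode (frame y' cs' (Suc (prod_encode (F c, acc'))) S, 0))"
    for y cs as S v
    using that
  proof (induction cs arbitrary: as v)
    case Nil
    then show ?case by (auto intro: reaches_refl)
  next
    case (Cons c cs)
    have "reaches ?s (prod_encode (frame y (list_encode (c # cs)) (list_encode as) S, v))
        (prod_encode (frame y (list_encode cs) (list_encode (F c # as)) S, 0))"
      by (rule reaches_step) (simp add: step_call Cons.prems)
    moreover obtain v' where
      "reaches ?s (prod_encode (frame y (list_encode cs) (list_encode (F c # as)) S, 0))
        (prod_encode (frame y 0 (list_encode (rev (map F cs) @ F c # as)) S, v'))"
      using Cons.IH[of "F c # as" 0] Cons.prems by (metis list.set_intros(2))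
    ultimately show ?case by (auto intro: reaches_trans)
  qed
  \<comment> \<open>The frame below, the rest of the stack and the stale value \<open>v\<close> stay
    arbitrary, because nested calls run on top of other frames.\<close>
  have eval: "reaches ?s (prod_encode (frame c (ch c) 0 (frame y' cs' acc' S), v))
      (prod_encode (frame y' cs' (Suc (prod_encode (F c, acc'))) S, 0))" for c y' cs' acc' S v
  proof (induction "M c" arbitrary: c y' cs' acc' S v rule: less_induct)
    case less
    obtain v' where
      "reaches ?s (prod_encode (frame c (ch c) 0 (frame y' cs' acc' S), v))
        (prod_encode (frame c 0 (list_encode (rev (map F (list_decode (ch c))))) (frame y' cs' acc' S), v'))"
      using args[of "list_decode (ch c)" c "[]" "frame y' cs' acc' S" v] less dec by auto
    then show ?case
      by (rule reaches_trans) (rule reaches_step, simp add: step_return F[of c, symmetric] reaches_refl)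
  qed
  let ?init = "\<lambda>y. prod_encode (frame y (ch y) 0 0, 0)"
  have run: "\<exists>n. (?s ^^ n) (?init y) = prod_encode (0, F y)" for y
  proof -
    obtain v' where "reaches ?s (?init y)
        (prod_encode (frame y 0 (list_encode (rev (map F (list_decode (ch y))))) 0, v'))"
      using args[of "list_decode (ch y)" y "[]" 0 0] eval by auto
    then have "reaches ?s (?init y) (prod_encode (0, F y))"
      by (rule reaches_trans) (rule reaches_step, simp add: step_finish F[of y, symmetric] reaches_refl)
    then show ?thesis unfolding reaches_def .
  qed
  have halt: "\<exists>n. lft ((?s ^^ n) (?init y)) = 0" for y
  proof -
    obtain n where "(?s ^^ n) (?init y) = prod_encode (0, F y)" using run by blast
    then show ?thesis by (intro exI[of _ n]) simp
  qed
  have F_eq: "F y = rgt ((?s ^^ (LEAST n. lft ((?s ^^ n) (?init y)) = 0)) (?init y))" for y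
  proof -
    obtain n where "(?s ^^ n) (?init y) = prod_encode (0, F y)" using run by blast
    then show ?thesis by (rule halted_value[symmetric])
  qed
  have init: "computable ?init"
    unfolding frame_def by (intro computable_intros computable_comp[OF ch])
  then have "computable (\<lambda>y. rgt ((?s ^^ (LEAST n. lft ((?s ^^ n) (?init y)) = 0)) (?init y)))"
    by (intro computable_rgt computable_funpow computable_step ch cb computable_lft
        computable_Least[OF _ halt] computable_comp[OF init] computable_id)
  then have "computable F" by (simp only: F_eq[symmetric])
  then show ?thesis using F that by blast
qed

section \<open>Translation of formulas along an interpretation\<close>

lemma tuplesD: "xs \<in> tuples n X \<Longrightarrow> length xs = n"
  by (simp add: tuples_def)

lemma tuples_Nil [simp]: "xs \<in> tuples 0 X \<longleftrightarrow> xs = []"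
  by (auto simp: tuples_def)

lemma tuples_append: "xs \<in> tuples m X \<Longrightarrow> ys \<in> tuples n X \<Longrightarrow> xs @ ys \<in> tuples (m + n) X"
  by (auto simp: tuples_def)

lemma tuples_nth: "xs \<in> tuples n X \<Longrightarrow> i < n \<Longrightarrow> xs ! i \<in> X"
  by (auto simp: tuples_def)

lemma tuples_Cons: "x # xs \<in> tuples (Suc n) X \<longleftrightarrow> x \<in> X \<and> xs \<in> tuples n X"
  by (auto simp: tuples_def)

lemma tuples_splitE:
  assumes "xs \<in> tuples (m + n) X"
  obtains ys zs where "xs = ys @ zs" "ys \<in> tuples m X" "zs \<in> tuples n X"
  by (rule that[of "take m xs" "drop m xs"])
    (use assms in \<open>auto simp: tuples_def dest: in_set_takeD in_set_dropD\<close>)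

lemma length_concat_tuples: "cs \<in> tuples k (tuples d X) \<Longrightarrow> length (concat cs) = k * d"
  by (induction cs arbitrary: k) (auto simp: tuples_def)

lemma concat_tuples: "cs \<in> tuples k (tuples d X) \<Longrightarrow> concat cs \<in> tuples (k * d) X"
  using length_concat_tuples[of cs k d X] by (auto simp: tuples_def)

lemma concat_tuplesE:
  assumes "xs \<in> tuples (k * d) X"
  obtains cs where "cs \<in> tuples k (tuples d X)" "concat cs = xs"
  using assms
proof (induction k arbitrary: xs thesis)
  case 0
  then show ?case by (metis concat.simps(1) mult_0 tuples_Nil)
next
  case (Suc k)
  then have "xs \<in> tuples (d + k * d) X" by simp
  then obtain ys zs where yz: "xs = ys @ zs" "ys \<in> tuples d X" "zs \<in> tuples (k * d) X"
    by (rule tuples_splitE)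
  obtain cs where "cs \<in> tuples k (tuples d X)" "concat cs = zs"
    using Suc.IH yz(3) by blast
  with yz show ?case by (intro Suc.prems(1)[of "ys # cs"]) (auto simp: tuples_Cons)
qed

lemma nth_concat_blocks:
  "cs \<in> tuples k (tuples d X) \<Longrightarrow> i < k \<Longrightarrow> j < d \<Longrightarrow> concat cs ! (i * d + j) = cs ! i ! j"
proof (induction cs arbitrary: k i)
  case (Cons c cs)
  then obtain k' where k: "k = Suc k'" by (cases k) (auto simp: tuples_def)
  then have c: "length c = d" "cs \<in> tuples k' (tuples d X)"
    using Cons.prems by (auto simp: tuples_def)
  then show ?case
    using Cons.IH[of k' "i - 1"] Cons.prems k by (cases i) (auto simp: nth_append)
qed (simp add: tuples_def)

lemma block_index_less: "i < k \<Longrightarrow> j < d \<Longrightarrow> i * d + j < k * (d::nat)"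
  by (metis add.commute add_less_cancel_left less_le_trans mult_Suc mult_le_mono1 Suc_leI)

lemma map_image_tuples: "xs \<in> tuples n X \<Longrightarrow> (\<And>x. x \<in> X \<Longrightarrow> f x \<in> Y) \<Longrightarrow> map f xs \<in> tuples n Y"
  by (auto simp: tuples_def)

text \<open>Applied to a coordinate map, this chooses representatives for a whole tuple of elements
  at once.\<close>

lemma tuples_image_liftE:
  assumes "ys \<in> tuples n (f ` X)"
  obtains xs where "xs \<in> tuples n X" "map f xs = ys"
proof -
  define g where "g y = (SOME x. x \<in> X \<and> f x = y)" for y
  have g: "g y \<in> X \<and> f (g y) = y" if "y \<in> f ` X" for y
    unfolding g_def by (rule someI_ex) (use that in auto)
  have "\<forall>y \<in> set ys. y \<in> f ` X" using assms by (auto simp: tuples_def)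
  then have "map f (map g ys) = ys" "set (map g ys) \<subseteq> X"
    using g by (auto intro!: map_idI)
  then show ?thesis using assms by (intro that[of "map g ys"]) (auto simp: tuples_def)
qed

section \<open>Evaluation, renaming and blocks of quantifiers\<close>

lemma eval_tm_cong:
  "wf_tm L n t \<Longrightarrow> (\<And>i. i < n \<Longrightarrow> e ! i = e' ! i) \<Longrightarrow> eval_tm A e t = eval_tm A e' t"
  by (induction t) (auto intro!: arg_cong[of _ _ "fn A _"])

lemma sat_cong:
  "wf_fm L n \<phi> \<Longrightarrow> (\<And>i. i < n \<Longrightarrow> e ! i = e' ! i) \<Longrightarrow> sat A e \<phi> = sat A e' \<phi>"
proof (induction \<phi> arbitrary: n e e')
  case (Eq s t)
  then have "eval_tm A e s = eval_tm A e' s" "eval_tm A e t = eval_tm A e' t"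
    by (auto intro: eval_tm_cong[of L n])
  then show ?case by simp
next
  case (Rel r ts)
  then have "map (eval_tm A e) ts = map (eval_tm A e') ts"
    by (auto intro: eval_tm_cong[of L n])
  then show ?case by (simp only: sat.simps)
next
  case (Ex \<phi>)
  from Ex.prems have "sat A (a # e) \<phi> = sat A (a # e') \<phi>" for a
    by (intro Ex.IH[of "Suc n"]) (auto simp: nth_Cons split: nat.split)
  then show ?case by simp
next
  case (Neg \<phi>)
  show ?case using Neg.IH[of n e e'] Neg.prems by simp
next
  case (Conj \<phi> \<psi>)
  show ?case using Conj.IH[of n e e'] Conj.prems by simp
qed

lemma sat_append: "wf_fm L n \<phi> \<Longrightarrow> length e = n \<Longrightarrow> sat A (e @ e') \<phi> = sat A e \<phi>"
  by (rule sat_cong) (auto simp: nth_append)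

lemma eval_rename_tm:
  "wf_tm L n t \<Longrightarrow> (\<And>i. i < n \<Longrightarrow> e' ! i = e ! \<rho> i) \<Longrightarrow> eval_tm A e (rename_tm \<rho> t) = eval_tm A e' t"
  by (induction t) (auto intro!: arg_cong[of _ _ "fn A _"])

lemma sat_rename:
  "wf_fm L n \<phi> \<Longrightarrow> (\<And>i. i < n \<Longrightarrow> e' ! i = e ! \<rho> i) \<Longrightarrow> sat A e (rename \<rho> \<phi>) = sat A e' \<phi>"
proof (induction \<phi> arbitrary: n \<rho> e e')
  case (Eq s t)
  then have "eval_tm A e (rename_tm \<rho> s) = eval_tm A e' s" "eval_tm A e (rename_tm \<rho> t) = eval_tm A e' t"
    by (auto intro: eval_rename_tm[of L n])
  then show ?case by simp
next
  case (Rel r ts)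
  then have "map (eval_tm A e) (map (rename_tm \<rho>) ts) = map (eval_tm A e') ts"
    by (auto intro: eval_rename_tm[of L n])
  then show ?case by (simp only: sat.simps rename.simps)
next
  case (Ex \<phi>)
  from Ex.prems have "sat A (a # e) (rename (case_nat 0 (\<lambda>i. Suc (\<rho> i))) \<phi>) = sat A (a # e') \<phi>" for a
    by (intro Ex.IH[of "Suc n"]) (auto simp: nth_Cons split: nat.split)
  then show ?case by simp
next
  case (Neg \<phi>)
  show ?case using Neg.IH[of n e' e \<rho>] Neg.prems by simp
next
  case (Conj \<phi> \<psi>)
  show ?case using Conj.IH[of n e' e \<rho>] Conj.prems by simp
qed

lemma wf_rename_tm:
  "wf_tm L n t \<Longrightarrow> (\<And>i. i < n \<Longrightarrow> \<rho> i < m) \<Longrightarrow> wf_tm L m (rename_tm \<rho> t)"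
  by (induction t) auto

lemma wf_rename:
  "wf_fm L n \<phi> \<Longrightarrow> (\<And>i. i < n \<Longrightarrow> \<rho> i < m) \<Longrightarrow> wf_fm L m (rename \<rho> \<phi>)"
proof (induction \<phi> arbitrary: n m \<rho>)
  case (Ex \<phi>)
  from Ex.prems show ?case by (auto intro!: Ex.IH[of "Suc n"] split: nat.split)
qed (auto intro: wf_rename_tm[of L])

lemma sat_Ex_pow:
  "sat A e ((Ex ^^ N) \<phi>) \<longleftrightarrow> (\<exists>bs \<in> tuples N (universe A). sat A (bs @ e) \<phi>)"
proof (induction N arbitrary: e)
  case (Suc N)
  \<comment> \<open>The outermost quantifier pushes its value first, so this value ends up last in
    the tuple; the induction therefore splits off the last entry.\<close>
  have "(\<exists>a \<in> universe A. \<exists>bs \<in> tuples N (universe A). sat A (bs @ a # e) \<phi>) \<longleftrightarrow>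
      (\<exists>bs \<in> tuples (Suc N) (universe A). sat A (bs @ e) \<phi>)" (is "?l \<longleftrightarrow> ?r")
  proof
    assume ?l
    then obtain a bs where "a \<in> universe A" "bs \<in> tuples N (universe A)" "sat A (bs @ a # e) \<phi>"
      by blast
    then show ?r by (intro bexI[of _ "bs @ [a]"]) (auto simp: tuples_def)
  next
    assume ?r
    then obtain cs where cs: "cs \<in> tuples (N + 1) (universe A)" "sat A (cs @ e) \<phi>"
      by auto
    then obtain bs a where "cs = bs @ [a]" "bs \<in> tuples N (universe A)" "a \<in> universe A"
      by (elim tuples_splitE) (auto simp: tuples_def length_Suc_conv)
    then show ?l using cs by auto
  qed
  then show ?case using Suc by simp
qed simp

lemma wf_Ex_pow: "wf_fm L n ((Ex ^^ N) \<phi>) \<longleftrightarrow> wf_fm L (N + n) \<phi>"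
  by (induction N arbitrary: n) auto

lemma sat_foldr_Conj:
  "sat A e (foldr Conj \<phi>s \<psi>) \<longleftrightarrow> (\<forall>\<phi> \<in> set \<phi>s. sat A e \<phi>) \<and> sat A e \<psi>"
  by (induction \<phi>s) auto

lemma wf_foldr_Conj:
  "wf_fm L n (foldr Conj \<phi>s \<psi>) \<longleftrightarrow> (\<forall>\<phi> \<in> set \<phi>s. wf_fm L n \<phi>) \<and> wf_fm L n \<psi>"
  by (induction \<phi>s) auto

lemma eval_tm_in_universe:
  assumes "is_struct A"
  shows "wf_tm (lang A) n t \<Longrightarrow> e \<in> tuples n (universe A) \<Longrightarrow> eval_tm A e t \<in> universe A"
proof (induction t)
  case (Fn f ts)
  then have "map (eval_tm A e) ts \<in> tuples (funs (lang A) ! f) (universe A)"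
    by (auto simp: tuples_def)
  then show ?case using assms Fn.prems by (simp add: is_struct_def)
qed (simp add: tuples_nth)

section \<open>Coordinate maps and formulas about blocks\<close>

definition coord_map ::
  "interp_code \<Rightarrow> 'b struct \<Rightarrow> 'b list \<Rightarrow> 'a struct \<Rightarrow> ('b list \<Rightarrow> 'a) \<Rightarrow> bool" where
  "coord_map \<Gamma> B p A \<mu> \<longleftrightarrow>
     is_code (lang A) (lang B) \<Gamma> \<and> p \<in> tuples (npars \<Gamma>) (universe B) \<and>
     \<mu> ` code_dom \<Gamma> B p = universe A \<and>
     (\<forall>b \<in> code_dom \<Gamma> B p. \<forall>c \<in> code_dom \<Gamma> B p. sat B (b @ c @ p) (eq_fm \<Gamma>) \<longleftrightarrow> \<mu> b = \<mu> c) \<and>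
     (\<forall>f < length (funs (lang A)). \<forall>bs \<in> tuples (funs (lang A) ! f) (code_dom \<Gamma> B p).
        \<forall>b \<in> code_dom \<Gamma> B p.
        sat B (concat bs @ b @ p) (fun_fm \<Gamma> f) \<longleftrightarrow> fn A f (map \<mu> bs) = \<mu> b) \<and>
     (\<forall>r < length (rels (lang A)). \<forall>bs \<in> tuples (rels (lang A) ! r) (code_dom \<Gamma> B p).
        sat B (concat bs @ p) (rel_fm \<Gamma> r) \<longleftrightarrow> rel A r (map \<mu> bs))"

text \<open>\<open>coord_map\<close> speaks of representatives only and forgets the quotient, so
  that one coordinate map can later be exchanged for another on the same representatives. The
  passage uses that equivalent representatives have equal classes and that the isomorphism is
  injective.\<close>

lemma interpretation_via_coord_map:
  assumes "interpretation_via \<Gamma> B p A \<mu>"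
  shows "coord_map \<Gamma> B p A \<mu>"
proof -
  let ?D = "code_dom \<Gamma> B p" and ?R = "code_eqv \<Gamma> B p"
  obtain S h where code: "is_code (lang A) (lang B) \<Gamma>" and p: "p \<in> tuples (npars \<Gamma>) (universe B)"
    and S: "code_struct (lang A) \<Gamma> B p S" and h: "isomorphism h S A"
    and \<mu>: "\<And>b. b \<in> ?D \<Longrightarrow> \<mu> b = h (code_class \<Gamma> B p b)"
    using assms unfolding interpretation_via_def by blast
  have str: "is_struct S" and lang: "lang S = lang A"
    and equiv: "equiv ?D ?R" and univ: "universe S = ?D // ?R"
    using S by (auto simp: code_struct_def)
  have bij: "bij_betw h (universe S) (universe A)" using h by (simp add: isomorphism_def)
  have cls: "code_class \<Gamma> B p b \<in> universe S" if "b \<in> ?D" for b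
    using that univ by (auto intro: quotientI)
  have h_eq: "h x = h y \<longleftrightarrow> x = y" if "x \<in> universe S" "y \<in> universe S" for x y
    using that bij by (auto simp: bij_betw_def inj_on_def)
  have map_\<mu>: "map \<mu> bs = map h (map (code_class \<Gamma> B p) bs)" if "bs \<in> tuples n ?D" for bs n
    using that \<mu> by (auto simp: tuples_def)
  have tup: "map (code_class \<Gamma> B p) bs \<in> tuples n (universe S)" if "bs \<in> tuples n ?D" for bs n
    by (rule map_image_tuples[OF that cls])
  have "\<mu> ` ?D = h ` (code_class \<Gamma> B p ` ?D)"
    unfolding image_image by (rule image_cong[OF refl \<mu>])
  also have "code_class \<Gamma> B p ` ?D = universe S"
    unfolding univ by (auto simp: quotient_def)
  finally have "\<mu> ` ?D = universe A" using bij by (simp add: bij_betw_def)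
  moreover have "sat B (b @ c @ p) (eq_fm \<Gamma>) \<longleftrightarrow> \<mu> b = \<mu> c" if "b \<in> ?D" "c \<in> ?D" for b c
  proof -
    have "sat B (b @ c @ p) (eq_fm \<Gamma>) \<longleftrightarrow> (b, c) \<in> ?R"
      using that by (simp add: code_eqv_def)
    also have "\<dots> \<longleftrightarrow> code_class \<Gamma> B p b = code_class \<Gamma> B p c"
      using eq_equiv_class_iff[OF equiv that] by simp
    finally show ?thesis using that by (simp add: \<mu> h_eq cls)
  qed
  moreover have "sat B (concat bs @ b @ p) (fun_fm \<Gamma> f) \<longleftrightarrow> fn A f (map \<mu> bs) = \<mu> b"
    if "f < length (funs (lang A))" "bs \<in> tuples (funs (lang A) ! f) ?D" "b \<in> ?D" for f bs b
  proof -
    have "sat B (concat bs @ b @ p) (fun_fm \<Gamma> f) \<longleftrightarrow>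
        fn S f (map (code_class \<Gamma> B p) bs) = code_class \<Gamma> B p b"
      using S that by (simp add: code_struct_def)
    also have "\<dots> \<longleftrightarrow> h (fn S f (map (code_class \<Gamma> B p) bs)) = \<mu> b"
      using that str tup[OF that(2)] by (simp add: \<mu> h_eq cls is_struct_def lang)
    also have "h (fn S f (map (code_class \<Gamma> B p) bs)) = fn A f (map \<mu> bs)"
      using h that tup[OF that(2)] map_\<mu>[OF that(2)]
      by (simp add: isomorphism_def lang del: map_map)
    finally show ?thesis .
  qed
  moreover have "sat B (concat bs @ p) (rel_fm \<Gamma> r) \<longleftrightarrow> rel A r (map \<mu> bs)"
    if "r < length (rels (lang A))" "bs \<in> tuples (rels (lang A) ! r) ?D" for r bs
  proof -
    have "sat B (concat bs @ p) (rel_fm \<Gamma> r) \<longleftrightarrow> rel S r (map (code_class \<Gamma> B p) bs)"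
      using S that by (simp add: code_struct_def)
    then show ?thesis
      using h that tup[OF that(2)] map_\<mu>[OF that(2)]
      by (simp add: isomorphism_def lang del: map_map)
  qed
  ultimately show ?thesis using code p by (simp add: coord_map_def)
qed

lemma coord_mapD:
  assumes "coord_map \<Gamma> B p A \<mu>"
  shows "is_code (lang A) (lang B) \<Gamma>" "p \<in> tuples (npars \<Gamma>) (universe B)"
    "\<mu> ` code_dom \<Gamma> B p = universe A"
    "\<And>b c. b \<in> code_dom \<Gamma> B p \<Longrightarrow> c \<in> code_dom \<Gamma> B p \<Longrightarrow>
      sat B (b @ c @ p) (eq_fm \<Gamma>) \<longleftrightarrow> \<mu> b = \<mu> c"
    "\<And>f bs b. f < length (funs (lang A)) \<Longrightarrow> bs \<in> tuples (funs (lang A) ! f) (code_dom \<Gamma> B p) \<Longrightarrow>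
      b \<in> code_dom \<Gamma> B p \<Longrightarrow>
      sat B (concat bs @ b @ p) (fun_fm \<Gamma> f) \<longleftrightarrow> fn A f (map \<mu> bs) = \<mu> b"
    "\<And>r bs. r < length (rels (lang A)) \<Longrightarrow> bs \<in> tuples (rels (lang A) ! r) (code_dom \<Gamma> B p) \<Longrightarrow>
      sat B (concat bs @ p) (rel_fm \<Gamma> r) \<longleftrightarrow> rel A r (map \<mu> bs)"
  using assms by (auto simp: coord_map_def)

lemma code_dom_tuples: "code_dom \<Gamma> B p \<subseteq> tuples (dim \<Gamma>) (universe B)"
  by (auto simp: code_dom_def)

lemma tuples_code_dom: "cs \<in> tuples k (code_dom \<Gamma> B p) \<Longrightarrow> cs \<in> tuples k (tuples (dim \<Gamma>) (universe B))"
  using code_dom_tuples unfolding tuples_def by blast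

lemma sat_at_blocks:
  assumes \<phi>: "wf_fm L (length is * dim \<Delta> + m) \<phi>"
    and cs: "cs \<in> tuples k (tuples (dim \<Delta>) X)" and "is": "\<forall>i \<in> set is. i < k"
  shows "sat A (concat cs @ q) (at_blocks \<Delta> k is \<phi>) \<longleftrightarrow> sat A (concat (map ((!) cs) is) @ q) \<phi>"
  unfolding at_blocks_def
proof (rule sat_rename[OF \<phi>])
  fix j assume j: "j < length is * dim \<Delta> + m"
  have bs: "map ((!) cs) is \<in> tuples (length is) (tuples (dim \<Delta>) X)"
    using tuples_nth[OF cs] "is" by (auto simp: tuples_def[of "length is"])
  show "(concat (map ((!) cs) is) @ q) ! j = (concat cs @ q) !
      (if j < length is * dim \<Delta> then is ! (j div dim \<Delta>) * dim \<Delta> + j mod dim \<Delta>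
       else k * dim \<Delta> + (j - length is * dim \<Delta>))"
  proof (cases "j < length is * dim \<Delta>")
    case True
    \<comment> \<open>Dimension zero is allowed; an index inside a block excludes it, so that
      division by the dimension is meaningful.\<close>
    then have d: "0 < dim \<Delta>" by (cases "dim \<Delta>") auto
    then have i: "j div dim \<Delta> < length is" "j mod dim \<Delta> < dim \<Delta>"
      using True by (auto simp: less_mult_imp_div_less)
    then have ik: "is ! (j div dim \<Delta>) < k" using "is" by simp
    have "concat (map ((!) cs) is) ! j = concat (map ((!) cs) is) ! (j div dim \<Delta> * dim \<Delta> + j mod dim \<Delta>)"
      by simp
    also have "\<dots> = cs ! (is ! (j div dim \<Delta>)) ! (j mod dim \<Delta>)"
      using nth_concat_blocks[OF bs i] i by simp
    also have "\<dots> = concat cs ! (is ! (j div dim \<Delta>) * dim \<Delta> + j mod dim \<Delta>)"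
      using nth_concat_blocks[OF cs ik i(2)] by simp
    finally show ?thesis
      using True block_index_less[OF ik i(2)] length_concat_tuples[OF cs] length_concat_tuples[OF bs]
      by (simp add: nth_append)
  next
    case False
    then obtain j' where "j = length is * dim \<Delta> + j'"
      by (metis le_iff_add not_less)
    then show ?thesis
      using length_concat_tuples[OF cs] length_concat_tuples[OF bs] by (simp add: nth_append)
  qed
qed

lemma wf_at_blocks:
  assumes \<phi>: "wf_fm L (length is * dim \<Delta> + m) \<phi>" and "is": "\<forall>i \<in> set is. i < k"
  shows "wf_fm L (k * dim \<Delta> + m) (at_blocks \<Delta> k is \<phi>)"
  unfolding at_blocks_def
proof (rule wf_rename[OF \<phi>])
  fix j assume j: "j < length is * dim \<Delta> + m"
  show "(if j < length is * dim \<Delta> then is ! (j div dim \<Delta>) * dim \<Delta> + j mod dim \<Delta>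
       else k * dim \<Delta> + (j - length is * dim \<Delta>)) < k * dim \<Delta> + m"
  proof (cases "j < length is * dim \<Delta>")
    case True
    then have "0 < dim \<Delta>" by (cases "dim \<Delta>") auto
    then have "j div dim \<Delta> < length is" "j mod dim \<Delta> < dim \<Delta>"
      using True by (auto simp: less_mult_imp_div_less)
    then show ?thesis
      using True block_index_less[of "is ! (j div dim \<Delta>)" k "j mod dim \<Delta>" "dim \<Delta>"] "is"
      by (simp add: trans_less_add1)
  qed (use j in simp)
qed

lemma is_codeD:
  assumes "is_code L K \<Gamma>"
  shows "wf_fm K (1 * dim \<Gamma> + npars \<Gamma>) (dom_fm \<Gamma>)" "wf_fm K (2 * dim \<Gamma> + npars \<Gamma>) (eq_fm \<Gamma>)"
    "\<And>f. f < length (funs L) \<Longrightarrow> wf_fm K (Suc (funs L ! f) * dim \<Gamma> + npars \<Gamma>) (fun_fm \<Gamma> f)"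
    "\<And>r. r < length (rels L) \<Longrightarrow> wf_fm K (rels L ! r * dim \<Gamma> + npars \<Gamma>) (rel_fm \<Gamma> r)"
  using assms by (auto simp: is_code_def)

lemma sat_in_dom:
  assumes code: "is_code L K \<Delta>" and cs: "cs \<in> tuples k (tuples (dim \<Delta>) (universe A))" and m: "m \<le> k"
  shows "sat A (concat cs @ q) (in_dom \<Delta> k m \<phi>) \<longleftrightarrow>
    (\<forall>i < m. cs ! i \<in> code_dom \<Delta> A q) \<and> sat A (concat cs @ q) \<phi>"
proof -
  have "sat A (concat cs @ q) (at_blocks \<Delta> k [i] (dom_fm \<Delta>)) \<longleftrightarrow> cs ! i \<in> code_dom \<Delta> A q" if "i < m" for i
    using sat_at_blocks[of K "[i]" \<Delta> "npars \<Delta>" "dom_fm \<Delta>" cs k "universe A" A q] is_codeD(1)[OF code]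
      that m cs tuples_nth[OF cs, of i]
    by (simp add: code_dom_def)
  then show ?thesis by (auto simp: in_dom_def sat_foldr_Conj)
qed

lemma wf_in_dom:
  assumes code: "is_code L K \<Delta>" and m: "m \<le> k" and \<phi>: "wf_fm K (k * dim \<Delta> + npars \<Delta>) \<phi>"
  shows "wf_fm K (k * dim \<Delta> + npars \<Delta>) (in_dom \<Delta> k m \<phi>)"
  using \<phi> m is_codeD(1)[OF code] by (auto simp: in_dom_def wf_foldr_Conj intro!: wf_at_blocks)

lemma sat_ex_blocks:
  assumes code: "is_code L K \<Delta>" and cs: "cs \<in> tuples k (tuples (dim \<Delta>) (universe A))"
  shows "sat A (concat cs @ q) (ex_blocks \<Delta> k m \<phi>) \<longleftrightarrow>
    (\<exists>bs \<in> tuples m (code_dom \<Delta> A q). sat A (concat (bs @ cs) @ q) \<phi>)"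
proof -
  have in_dom: "sat A (concat (bs @ cs) @ q) (in_dom \<Delta> (k + m) m \<phi>) \<longleftrightarrow>
      bs \<in> tuples m (code_dom \<Delta> A q) \<and> sat A (concat (bs @ cs) @ q) \<phi>"
    if bs: "bs \<in> tuples m (tuples (dim \<Delta>) (universe A))" for bs
  proof -
    have "bs @ cs \<in> tuples (k + m) (tuples (dim \<Delta>) (universe A))"
      using tuples_append[OF bs cs] by (simp add: add.commute)
    then show ?thesis
      using sat_in_dom[OF code, of "bs @ cs" "k + m" A m q \<phi>] bs
      by (auto simp: tuples_def nth_append in_set_conv_nth subset_iff)
  qed
  show ?thesis (is "?l \<longleftrightarrow> ?r")
  proof
    assume ?l
    then obtain xs where "xs \<in> tuples (m * dim \<Delta>) (universe A)"
      and xs: "sat A (xs @ concat cs @ q) (in_dom \<Delta> (k + m) m \<phi>)"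
      unfolding ex_blocks_def sat_Ex_pow by blast
    then obtain bs where bs: "bs \<in> tuples m (tuples (dim \<Delta>) (universe A))" "concat bs = xs"
      by (elim concat_tuplesE)
    then show ?r using in_dom[OF bs(1)] xs by auto
  next
    assume ?r
    then obtain bs where bs: "bs \<in> tuples m (code_dom \<Delta> A q)" "sat A (concat (bs @ cs) @ q) \<phi>"
      by blast
    have bs': "bs \<in> tuples m (tuples (dim \<Delta>) (universe A))" by (rule tuples_code_dom[OF bs(1)])
    show ?l
      unfolding ex_blocks_def sat_Ex_pow
      by (rule bexI[OF _ concat_tuples[OF bs']]) (use in_dom[OF bs'] bs in simp)
  qed
qed

lemma wf_ex_blocks:
  assumes code: "is_code L K \<Delta>" and \<phi>: "wf_fm K ((k + m) * dim \<Delta> + npars \<Delta>) \<phi>"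
  shows "wf_fm K (k * dim \<Delta> + npars \<Delta>) (ex_blocks \<Delta> k m \<phi>)"
  using wf_in_dom[OF code _ \<phi>, of m] by (simp add: ex_blocks_def wf_Ex_pow algebra_simps)

lemma length_tr_tms [simp]: "length (tr_tms \<Delta> k d s ts) = length ts"
  by (induction ts arbitrary: s) auto

lemma nth_tr_tms: "j < length ts \<Longrightarrow> tr_tms \<Delta> k d s ts ! j = tr_tm \<Delta> k d (s + j) (ts ! j)"
  by (induction ts arbitrary: s j) (auto simp: nth_Cons split: nat.split)

lemma wf_fun_at_blocks:
  assumes code: "is_code L K \<Delta>" and "f < length (funs L)" "length is = funs L ! f" "\<forall>i \<in> set is. i < k" "s < k"
  shows "wf_fm K (k * dim \<Delta> + npars \<Delta>) (at_blocks \<Delta> k (is @ [s]) (fun_fm \<Delta> f))"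
  using is_codeD(3)[OF code assms(2)] assms by (intro wf_at_blocks) auto

lemma wf_eq_at_blocks:
  assumes code: "is_code L K \<Delta>" and "i < k" "j < k"
  shows "wf_fm K (k * dim \<Delta> + npars \<Delta>) (at_blocks \<Delta> k [i, j] (eq_fm \<Delta>))"
  using is_codeD(2)[OF code] assms by (intro wf_at_blocks) (auto simp: mult_2)

lemma wf_tr_tm:
  assumes code: "is_code L K \<Delta>"
  shows "wf_tm L n t \<Longrightarrow> d + n \<le> k \<Longrightarrow> s < k \<Longrightarrow>
      wf_fm K (k * dim \<Delta> + npars \<Delta>) (tr_tm \<Delta> k d s t)"
    and "\<forall>t \<in> set ts. wf_tm L n t \<Longrightarrow> d + n \<le> k \<Longrightarrow> s + length ts \<le> k \<Longrightarrow>
      \<forall>\<phi> \<in> set (tr_tms \<Delta> k d s ts). wf_fm K (k * dim \<Delta> + npars \<Delta>) \<phi>"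
  using code
proof (induction \<Delta> k d s t and \<Delta> k d s ts rule: tr_tm_tr_tms.induct)
  case (1 \<Delta> k d s i)
  then show ?case by (simp add: wf_eq_at_blocks)
next
  case (2 \<Delta> k d s f ts)
  then show ?case
    by (auto simp: Let_def wf_foldr_Conj intro!: wf_ex_blocks wf_fun_at_blocks)
qed auto

lemma wf_tr_fm:
  assumes code: "is_code L K \<Delta>"
  shows "wf_fm L k \<phi> \<Longrightarrow> wf_fm K (k * dim \<Delta> + npars \<Delta>) (tr_fm \<Delta> k \<phi>)"
proof (induction \<phi> arbitrary: k)
  case (Eq s t)
  then show ?case
    using code wf_tr_tm(2)[OF code, of "[s, t]" k 2 "k + 2" 0] wf_eq_at_blocks[OF code, of 0 "k + 2" 1]
    by (auto simp: wf_foldr_Conj numeral_2_eq_2 intro!: wf_ex_blocks)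
next
  case (Rel r ts)
  then show ?case
    using code wf_tr_tm(2)[OF code, of ts k "length ts" "k + length ts" 0] is_codeD(4)[OF code, of r]
    by (auto simp: Let_def wf_foldr_Conj intro!: wf_ex_blocks wf_at_blocks)
next
  case (Ex \<phi>)
  from Ex.prems Ex.IH[of "Suc k"] show ?case
    by (auto intro!: wf_ex_blocks[OF code])
qed auto

lemma map_nth_append_upt: "map ((!) (bs @ cs)) [0..<length bs] = bs"
  by (rule nth_equalityI) (auto simp: nth_append)

section \<open>Truth of translated formulas\<close>

context
  fixes \<Delta> :: interp_code and A :: "'a struct" and q :: "'a list" and B :: "'b struct" and \<mu>
  assumes \<mu>: "coord_map \<Delta> A q B \<mu>" and B: "is_struct B"
begin

lemma \<mu>_in_universe: "c \<in> code_dom \<Delta> A q \<Longrightarrow> \<mu> c \<in> universe B"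
  using coord_mapD(3)[OF \<mu>] by blast

lemma sat_eq_at_blocks:
  assumes cs: "cs \<in> tuples k (code_dom \<Delta> A q)" and "i < k" "j < k"
  shows "sat A (concat cs @ q) (at_blocks \<Delta> k [i, j] (eq_fm \<Delta>)) \<longleftrightarrow> \<mu> (cs ! i) = \<mu> (cs ! j)"
  using sat_at_blocks[of _ "[i, j]" \<Delta> _ _ cs, OF _ tuples_code_dom[OF cs]] is_codeD(2)[OF coord_mapD(1)[OF \<mu>]]
    coord_mapD(4)[OF \<mu>] assms tuples_nth[OF cs]
  by (simp add: mult_2)

lemma sat_fun_at_blocks:
  assumes f: "f < length (funs (lang B))" and bs: "bs \<in> tuples (funs (lang B) ! f) (code_dom \<Delta> A q)"
    and cs: "cs \<in> tuples k (code_dom \<Delta> A q)" and s: "s < k"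
  shows "sat A (concat (bs @ cs) @ q)
      (at_blocks \<Delta> (k + length bs) ([0..<length bs] @ [s + length bs]) (fun_fm \<Delta> f)) \<longleftrightarrow>
    fn B f (map \<mu> bs) = \<mu> (cs ! s)"
proof -
  have len: "length bs = funs (lang B) ! f" "length cs = k" using bs cs by (auto dest: tuplesD)
  have "bs @ cs \<in> tuples (k + length bs) (code_dom \<Delta> A q)"
    using tuples_append[OF bs cs] len by (simp add: add.commute)
  then have "sat A (concat (bs @ cs) @ q)
      (at_blocks \<Delta> (k + length bs) ([0..<length bs] @ [s + length bs]) (fun_fm \<Delta> f)) \<longleftrightarrow>
    sat A (concat (map ((!) (bs @ cs)) ([0..<length bs] @ [s + length bs])) @ q) (fun_fm \<Delta> f)"
    using is_codeD(3)[OF coord_mapD(1)[OF \<mu>] f] len s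
    by (intro sat_at_blocks[where L = "lang A" and m = "npars \<Delta>" and X = "universe A"])
      (auto dest: tuples_code_dom)
  also have "map ((!) (bs @ cs)) ([0..<length bs] @ [s + length bs]) = bs @ [cs ! s]"
    by (simp add: map_nth_append_upt nth_append)
  finally show ?thesis
    using coord_mapD(5)[OF \<mu> f bs tuples_nth[OF cs s]] by simp
qed

lemma sat_rel_at_blocks:
  assumes r: "r < length (rels (lang B))" and bs: "bs \<in> tuples (rels (lang B) ! r) (code_dom \<Delta> A q)"
    and cs: "cs \<in> tuples k (code_dom \<Delta> A q)"
  shows "sat A (concat (bs @ cs) @ q) (at_blocks \<Delta> (k + length bs) [0..<length bs] (rel_fm \<Delta> r)) \<longleftrightarrow>
    rel B r (map \<mu> bs)"
proof -
  have len: "length bs = rels (lang B) ! r" using bs by (auto dest: tuplesD)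
  have "bs @ cs \<in> tuples (k + length bs) (code_dom \<Delta> A q)"
    using tuples_append[OF bs cs] len by (simp add: add.commute)
  then have "sat A (concat (bs @ cs) @ q)
      (at_blocks \<Delta> (k + length bs) [0..<length bs] (rel_fm \<Delta> r)) \<longleftrightarrow>
    sat A (concat (map ((!) (bs @ cs)) [0..<length bs]) @ q) (rel_fm \<Delta> r)"
    using is_codeD(4)[OF coord_mapD(1)[OF \<mu>] r] len
    by (intro sat_at_blocks[where L = "lang A" and m = "npars \<Delta>" and X = "universe A"])
      (auto dest: tuples_code_dom)
  then show ?thesis
    using coord_mapD(6)[OF \<mu> r bs] by (simp add: map_nth_append_upt)
qed

text \<open>The new blocks introduced for the subterms exist because the values of the terms lie in
  the universe, onto which the coordinate map is surjective.\<close>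

lemma ex_blocks_values:
  assumes "map (eval_tm B e) ts \<in> tuples m (universe B)"
  shows "(\<exists>bs \<in> tuples m (code_dom \<Delta> A q). (\<forall>j < m. \<mu> (bs ! j) = eval_tm B e (ts ! j)) \<and> P (map \<mu> bs)) \<longleftrightarrow>
    P (map (eval_tm B e) ts)"
proof -
  have m: "length ts = m" using tuplesD[OF assms] by simp
  have eq: "(\<forall>j < m. \<mu> (bs ! j) = eval_tm B e (ts ! j)) \<longleftrightarrow> map \<mu> bs = map (eval_tm B e) ts"
    if "bs \<in> tuples m (code_dom \<Delta> A q)" for bs
    using tuplesD[OF that] m by (auto simp: list_eq_iff_nth_eq)
  obtain bs where "bs \<in> tuples m (code_dom \<Delta> A q)" "map \<mu> bs = map (eval_tm B e) ts"
    using assms unfolding coord_mapD(3)[OF \<mu>, symmetric] by (rule tuples_image_liftE)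
  then show ?thesis using eq by metis
qed

text \<open>Shared by function terms and atomic formulas. Correctness for single terms is a premise,
  so that it can be the induction hypothesis inside \<open>sat_tr_tm\<close> and the finished lemma
  in \<open>sat_tr_tms\<close>; \<open>P\<close> stands for the final conjunct.\<close>

lemma sat_ex_blocks_tr_tms:
  assumes wf: "\<forall>t \<in> set ts. wf_tm (lang B) n t" and dn: "d + n \<le> k" and cs: "cs \<in> tuples k (code_dom \<Delta> A q)"
    and IH: "\<And>t k d s cs. t \<in> set ts \<Longrightarrow> d + n \<le> k \<Longrightarrow> s < k \<Longrightarrow> cs \<in> tuples k (code_dom \<Delta> A q) \<Longrightarrow>
      sat A (concat cs @ q) (tr_tm \<Delta> k d s t) \<longleftrightarrow> eval_tm B (map \<mu> (drop d cs)) t = \<mu> (cs ! s)"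
    and P: "\<And>bs. bs \<in> tuples (length ts) (code_dom \<Delta> A q) \<Longrightarrow>
      sat A (concat (bs @ cs) @ q) \<psi> \<longleftrightarrow> P (map \<mu> bs)"
  shows "sat A (concat cs @ q) (ex_blocks \<Delta> k (length ts)
      (foldr Conj (tr_tms \<Delta> (k + length ts) (d + length ts) 0 ts) \<psi>)) \<longleftrightarrow>
    P (map (eval_tm B (map \<mu> (drop d cs))) ts)"
proof -
  let ?m = "length ts" and ?D = "code_dom \<Delta> A q" and ?e = "map \<mu> (drop d cs)"
  have code: "is_code (lang B) (lang A) \<Delta>" by (rule coord_mapD(1)[OF \<mu>])
  have "?e \<in> tuples (k - d) (universe B)"
    using cs \<mu>_in_universe by (auto simp: tuples_def dest: in_set_dropD)
  \<comment> \<open>The terms use only \<open>n\<close> variables, whereas \<open>k - d\<close> may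
    be larger.\<close>
  then have e: "take n ?e \<in> tuples n (universe B)"
    using dn set_take_subset[of n ?e] by (auto simp: tuples_def)
  have "eval_tm B ?e t \<in> universe B" if t: "t \<in> set ts" for t
  proof -
    have "eval_tm B ?e t = eval_tm B (take n ?e) t"
      by (rule eval_tm_cong[OF bspec[OF wf t]]) simp
    then show ?thesis using eval_tm_in_universe[OF B bspec[OF wf t] e] by (simp only:)
  qed
  then have vals: "map (eval_tm B ?e) ts \<in> tuples ?m (universe B)"
    by (auto simp: tuples_def)
  have "sat A (concat cs @ q) (ex_blocks \<Delta> k ?m (foldr Conj (tr_tms \<Delta> (k + ?m) (d + ?m) 0 ts) \<psi>)) \<longleftrightarrow>
    (\<exists>bs \<in> tuples ?m ?D. (\<forall>\<phi> \<in> set (tr_tms \<Delta> (k + ?m) (d + ?m) 0 ts). sat A (concat (bs @ cs) @ q) \<phi>) \<and>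
       sat A (concat (bs @ cs) @ q) \<psi>)"
    using tuples_code_dom[OF cs] by (simp add: sat_ex_blocks[OF code] sat_foldr_Conj)
  also have "\<dots> \<longleftrightarrow> (\<exists>bs \<in> tuples ?m ?D. (\<forall>j < ?m. \<mu> (bs ! j) = eval_tm B ?e (ts ! j)) \<and> P (map \<mu> bs))"
  proof (rule bex_cong[OF refl], rule conj_cong)
    fix bs assume bs: "bs \<in> tuples ?m ?D"
    have bcs: "bs @ cs \<in> tuples (k + ?m) ?D"
      using tuples_append[OF bs cs] by (simp add: add.commute)
    have "sat A (concat (bs @ cs) @ q) (tr_tm \<Delta> (k + ?m) (d + ?m) j (ts ! j)) \<longleftrightarrow>
        \<mu> (bs ! j) = eval_tm B ?e (ts ! j)" if "j < ?m" for j
      using IH[OF nth_mem[OF that], of "d + ?m" "k + ?m" j "bs @ cs"] bcs that dn tuplesD[OF bs]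
      by (auto simp: nth_append)
    then show "(\<forall>\<phi> \<in> set (tr_tms \<Delta> (k + ?m) (d + ?m) 0 ts). sat A (concat (bs @ cs) @ q) \<phi>) \<longleftrightarrow>
        (\<forall>j < ?m. \<mu> (bs ! j) = eval_tm B ?e (ts ! j))"
      by (auto simp: all_set_conv_all_nth nth_tr_tms)
  qed (rule P)
  also have "\<dots> \<longleftrightarrow> P (map (eval_tm B ?e) ts)"
    by (rule ex_blocks_values[OF vals])
  finally show ?thesis .
qed

lemma sat_tr_tm:
  "wf_tm (lang B) n t \<Longrightarrow> d + n \<le> k \<Longrightarrow> s < k \<Longrightarrow> cs \<in> tuples k (code_dom \<Delta> A q) \<Longrightarrow>
    sat A (concat cs @ q) (tr_tm \<Delta> k d s t) \<longleftrightarrow> eval_tm B (map \<mu> (drop d cs)) t = \<mu> (cs ! s)"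
proof (induction t arbitrary: k d s cs)
  case (Var i)
  then have "d + i < k" "length cs = k" by (auto simp: tuples_def)
  then show ?case using sat_eq_at_blocks[OF Var.prems(4,3), of "d + i"] by auto
next
  case (Fn f ts)
  let ?m = "length ts"
  have wf: "\<forall>t \<in> set ts. wf_tm (lang B) n t" using Fn.prems(1) by auto
  have "sat A (concat (bs @ cs) @ q) (at_blocks \<Delta> (k + ?m) ([0..<?m] @ [s + ?m]) (fun_fm \<Delta> f)) \<longleftrightarrow>
      fn B f (map \<mu> bs) = \<mu> (cs ! s)" if bs: "bs \<in> tuples ?m (code_dom \<Delta> A q)" for bs
    using sat_fun_at_blocks[OF _ _ Fn.prems(4,3), of f bs] bs Fn.prems(1) tuplesD[OF bs] by simp
  from sat_ex_blocks_tr_tms[OF wf Fn.prems(2,4) Fn.IH[OF _ bspec[OF wf]] this]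
  show ?case by (simp add: Let_def)
qed

lemma sat_tr_tms:
  assumes wf: "\<forall>t \<in> set ts. wf_tm (lang B) k t" and cs: "cs \<in> tuples k (code_dom \<Delta> A q)"
    and P: "\<And>bs. bs \<in> tuples (length ts) (code_dom \<Delta> A q) \<Longrightarrow>
      sat A (concat (bs @ cs) @ q) \<psi> \<longleftrightarrow> P (map \<mu> bs)"
  shows "sat A (concat cs @ q) (ex_blocks \<Delta> k (length ts)
      (foldr Conj (tr_tms \<Delta> (k + length ts) (length ts) 0 ts) \<psi>)) \<longleftrightarrow>
    P (map (eval_tm B (map \<mu> cs)) ts)"
  using sat_ex_blocks_tr_tms[OF wf _ cs sat_tr_tm[OF bspec[OF wf]] P, of 0] by simp

text \<open>In the quantifier case surjectivity of the coordinate map enters: representatives from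
  the domain reach all of \<open>universe B\<close>. In the atomic cases it is hidden in
  \<open>ex_blocks_values\<close>.\<close>

theorem sat_tr_fm:
  "wf_fm (lang B) k \<phi> \<Longrightarrow> cs \<in> tuples k (code_dom \<Delta> A q) \<Longrightarrow>
    sat A (concat cs @ q) (tr_fm \<Delta> k \<phi>) \<longleftrightarrow> sat B (map \<mu> cs) \<phi>"
proof (induction \<phi> arbitrary: k cs)
  case (Eq s t)
  have "sat A (concat (bs @ cs) @ q) (at_blocks \<Delta> (k + 2) [0, 1] (eq_fm \<Delta>)) \<longleftrightarrow>
      map \<mu> bs ! 0 = map \<mu> bs ! 1" if bs: "bs \<in> tuples 2 (code_dom \<Delta> A q)" for bs
    using sat_eq_at_blocks[of "bs @ cs" "k + 2" 0 1] tuples_append[OF bs Eq.prems(2)] tuplesD[OF bs]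
    by (simp add: nth_append add.commute)
  then show ?case
    using sat_tr_tms[of "[s, t]" k cs "at_blocks \<Delta> (k + 2) [0, 1] (eq_fm \<Delta>)" "\<lambda>xs. xs ! 0 = xs ! 1"] Eq.prems
    by (simp add: numeral_2_eq_2)
next
  case (Rel r ts)
  have "sat A (concat (bs @ cs) @ q) (at_blocks \<Delta> (k + length ts) [0..<length ts] (rel_fm \<Delta> r)) \<longleftrightarrow>
      rel B r (map \<mu> bs)" if bs: "bs \<in> tuples (length ts) (code_dom \<Delta> A q)" for bs
    using sat_rel_at_blocks[of r bs cs k] Rel.prems bs tuplesD[OF bs] by simp
  then show ?case
    using sat_tr_tms[of ts k cs "at_blocks \<Delta> (k + length ts) [0..<length ts] (rel_fm \<Delta> r)" "rel B r"] Rel.prems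
    by (simp add: Let_def)
next
  case (Neg \<phi>)
  from Neg.IH[of k cs] Neg.prems show ?case by simp
next
  case (Conj \<phi> \<psi>)
  from Conj.IH[of k cs] Conj.prems show ?case by simp
next
  case (Ex \<phi>)
  have "sat A (concat cs @ q) (tr_fm \<Delta> k (Ex \<phi>)) \<longleftrightarrow>
      (\<exists>bs \<in> tuples 1 (code_dom \<Delta> A q). sat A (concat (bs @ cs) @ q) (tr_fm \<Delta> (Suc k) \<phi>))"
    using sat_ex_blocks[OF coord_mapD(1)[OF \<mu>] tuples_code_dom[OF Ex.prems(2)]] by simp
  also have "\<dots> \<longleftrightarrow> (\<exists>b \<in> code_dom \<Delta> A q. sat A (concat ([b] @ cs) @ q) (tr_fm \<Delta> (Suc k) \<phi>))"
    by (auto simp: tuples_def length_Suc_conv)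
  also have "\<dots> \<longleftrightarrow> (\<exists>b \<in> code_dom \<Delta> A q. sat B (map \<mu> (b # cs)) \<phi>)"
  proof (rule bex_cong[OF refl])
    fix b assume "b \<in> code_dom \<Delta> A q"
    then show "sat A (concat ([b] @ cs) @ q) (tr_fm \<Delta> (Suc k) \<phi>) \<longleftrightarrow> sat B (map \<mu> (b # cs)) \<phi>"
      using Ex.IH[of "Suc k" "b # cs"] Ex.prems by (simp add: tuples_Cons)
  qed
  also have "\<dots> \<longleftrightarrow> (\<exists>x \<in> \<mu> ` code_dom \<Delta> A q. sat B (x # map \<mu> cs) \<phi>)"
    by simp
  finally show ?case unfolding coord_mapD(3)[OF \<mu>] by simp
qed

end

section \<open>Definable relations\<close>

text \<open>Predicates on assignments stand in for explicit formulas: a relation in ordinary logical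
  notation is proved definable by introduction rules that follow its shape.\<close>

definition definable :: "'a struct \<Rightarrow> 'a list \<Rightarrow> nat \<Rightarrow> ((nat \<Rightarrow> 'a) \<Rightarrow> bool) \<Rightarrow> bool" where
  "definable M q n R \<longleftrightarrow> (\<exists>\<phi>. wf_fm (lang M) (n + length q) \<phi> \<and>
     (\<forall>e \<in> tuples n (universe M). sat M (e @ q) \<phi> \<longleftrightarrow> R ((!) e)))"

lemma definableI:
  "wf_fm (lang M) (n + length q) \<phi> \<Longrightarrow>
    (\<And>e. e \<in> tuples n (universe M) \<Longrightarrow> sat M (e @ q) \<phi> \<longleftrightarrow> R ((!) e)) \<Longrightarrow> definable M q n R"
  unfolding definable_def by blast

lemma definableE:
  assumes "definable M q n R"
  obtains \<phi> where "wf_fm (lang M) (n + length q) \<phi>"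
    "\<And>e. e \<in> tuples n (universe M) \<Longrightarrow> sat M (e @ q) \<phi> \<longleftrightarrow> R ((!) e)"
  using assms unfolding definable_def by blast

lemma definable_cong:
  assumes "definable M q n R"
    and "\<And>e. (\<And>i. i < n \<Longrightarrow> e i \<in> universe M) \<Longrightarrow> R e \<longleftrightarrow> R' e"
  shows "definable M q n R'"
  using assms(1)
proof (rule definableE)
  fix \<phi> assume \<phi>: "wf_fm (lang M) (n + length q) \<phi>"
    "\<And>e. e \<in> tuples n (universe M) \<Longrightarrow> sat M (e @ q) \<phi> \<longleftrightarrow> R ((!) e)"
  show ?thesis
    by (rule definableI[OF \<phi>(1)]) (use \<phi>(2) assms(2) in \<open>auto simp: tuples_nth\<close>)
qed

lemma definable_not: "definable M q n R \<Longrightarrow> definable M q n (\<lambda>e. \<not> R e)"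
  by (erule definableE, rule_tac \<phi> = "Neg \<phi>" in definableI) auto

lemma definable_conj:
  assumes "definable M q n R" "definable M q n S" shows "definable M q n (\<lambda>e. R e \<and> S e)"
proof -
  obtain \<phi> \<psi> where "wf_fm (lang M) (n + length q) \<phi>" "wf_fm (lang M) (n + length q) \<psi>"
    "\<And>e. e \<in> tuples n (universe M) \<Longrightarrow> sat M (e @ q) \<phi> \<longleftrightarrow> R ((!) e)"
    "\<And>e. e \<in> tuples n (universe M) \<Longrightarrow> sat M (e @ q) \<psi> \<longleftrightarrow> S ((!) e)"
    using assms by (elim definableE) blast
  then show ?thesis by (intro definableI[of _ _ _ "Conj \<phi> \<psi>"]) simp_all
qed

lemma definable_disj:
  assumes "definable M q n R" "definable M q n S" shows "definable M q n (\<lambda>e. R e \<or> S e)"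
  using definable_not[OF definable_conj[OF definable_not[OF assms(1)] definable_not[OF assms(2)]]]
  by simp

lemma definable_imp:
  assumes "definable M q n R" "definable M q n S" shows "definable M q n (\<lambda>e. R e \<longrightarrow> S e)"
  using definable_disj[OF definable_not[OF assms(1)] assms(2)] by simp

lemma definable_iff:
  assumes "definable M q n R" "definable M q n S" shows "definable M q n (\<lambda>e. R e \<longleftrightarrow> S e)"
  using definable_conj[OF definable_imp[OF assms] definable_imp[OF assms(2,1)]]
  by (simp only: iff_conv_conj_imp)

text \<open>The shape of the premise is the de Bruijn shift; keeping the bound value apart from the
  assignment lets the rule match a lambda term.\<close>

lemma definable_ex:
  assumes "definable M q (Suc n) (\<lambda>e. R (e 0) (\<lambda>i. e (Suc i)))"
  shows "definable M q n (\<lambda>e. \<exists>a \<in> universe M. R a e)"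
  using assms
proof (rule definableE)
  fix \<phi> assume \<phi>: "wf_fm (lang M) (Suc n + length q) \<phi>"
    "\<And>e. e \<in> tuples (Suc n) (universe M) \<Longrightarrow> sat M (e @ q) \<phi> \<longleftrightarrow> R (e ! 0) (\<lambda>i. e ! Suc i)"
  show ?thesis
  proof (rule definableI[of _ _ _ "Ex \<phi>"])
    fix e assume "e \<in> tuples n (universe M)"
    then show "sat M (e @ q) (Ex \<phi>) \<longleftrightarrow> (\<exists>a \<in> universe M. R a ((!) e))"
      using \<phi>(2)[of "_ # e"] by (simp add: tuples_Cons)
  qed (use \<phi>(1) in simp)
qed

lemma definable_all:
  assumes "definable M q (Suc n) (\<lambda>e. R (e 0) (\<lambda>i. e (Suc i)))"
  shows "definable M q n (\<lambda>e. \<forall>a \<in> universe M. R a e)"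
  using definable_not[OF definable_ex[of M q n "\<lambda>a e. \<not> R a e", OF definable_not[OF assms]]] by simp

lemma definable_ex_tuples:
  assumes "definable M q (N + n) (\<lambda>e. R (map e [0..<N]) (\<lambda>i. e (N + i)))"
  shows "definable M q n (\<lambda>e. \<exists>bs \<in> tuples N (universe M). R bs e)"
  using assms
proof (rule definableE)
  fix \<phi> assume \<phi>: "wf_fm (lang M) (N + n + length q) \<phi>"
    "\<And>e. e \<in> tuples (N + n) (universe M) \<Longrightarrow>
      sat M (e @ q) \<phi> \<longleftrightarrow> R (map ((!) e) [0..<N]) (\<lambda>i. e ! (N + i))"
  show ?thesis
  proof (rule definableI[of _ _ _ "(Ex ^^ N) \<phi>"])
    fix e assume e: "e \<in> tuples n (universe M)"
    have "sat M (bs @ e @ q) \<phi> \<longleftrightarrow> R bs ((!) e)" if bs: "bs \<in> tuples N (universe M)" for bs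
    proof -
      have "(\<lambda>i. (bs @ e) ! (N + i)) = (!) e" using tuplesD[OF bs] by (auto simp: nth_append)
      then show ?thesis
        using \<phi>(2)[OF tuples_append[OF bs e]] tuplesD[OF bs] map_nth_append_upt[of bs e] by simp
    qed
    then show "sat M (e @ q) ((Ex ^^ N) \<phi>) \<longleftrightarrow> (\<exists>bs \<in> tuples N (universe M). R bs ((!) e))"
      by (simp add: sat_Ex_pow)
  qed (use \<phi>(1) in \<open>simp add: wf_Ex_pow add.assoc\<close>)
qed

lemma definable_subst:
  assumes "definable M q k (\<lambda>e. R (map e [0..<k]))" and \<rho>: "\<And>i. i < k \<Longrightarrow> \<rho> i < n"
  shows "definable M q n (\<lambda>e. R (map (\<lambda>i. e (\<rho> i)) [0..<k]))"
  using assms(1)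
proof (rule definableE)
  fix \<phi> assume \<phi>: "wf_fm (lang M) (k + length q) \<phi>"
    "\<And>e. e \<in> tuples k (universe M) \<Longrightarrow> sat M (e @ q) \<phi> \<longleftrightarrow> R (map ((!) e) [0..<k])"
  show ?thesis
  \<comment> \<open>Indices from \<open>k\<close> on denote parameters, which now start at
    \<open>n\<close>.\<close>
  proof (rule definableI[of _ _ _ "rename (\<lambda>i. if i < k then \<rho> i else n + (i - k)) \<phi>"])
    show "wf_fm (lang M) (n + length q) (rename (\<lambda>i. if i < k then \<rho> i else n + (i - k)) \<phi>)"
      by (rule wf_rename[OF \<phi>(1)]) (use \<rho> in \<open>auto intro: trans_less_add1\<close>)
    fix e assume e: "e \<in> tuples n (universe M)"
    let ?e = "map (\<lambda>i. e ! \<rho> i) [0..<k]"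
    have mem: "?e \<in> tuples k (universe M)" using \<rho> tuples_nth[OF e] by (auto simp: tuples_def)
    have "map ((!) ?e) [0..<k] = ?e" by (rule nth_equalityI) auto
    with \<phi>(2)[OF mem] have "sat M (?e @ q) \<phi> \<longleftrightarrow> R ?e"
      by (simp only:)
    moreover have "sat M (e @ q) (rename (\<lambda>i. if i < k then \<rho> i else n + (i - k)) \<phi>) \<longleftrightarrow> sat M (?e @ q) \<phi>"
      by (rule sat_rename[OF \<phi>(1)]) (use \<rho> tuplesD[OF e] in \<open>auto simp: nth_append\<close>)
    ultimately show "sat M (e @ q) (rename (\<lambda>i. if i < k then \<rho> i else n + (i - k)) \<phi>) \<longleftrightarrow> R ?e"
      by simp
  qed
qed

lemma definable_subst1:
  "definable M q 1 (\<lambda>e. P (e 0)) \<Longrightarrow> i < n \<Longrightarrow> definable M q n (\<lambda>e. P (e i))"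
  using definable_subst[of M q 1 "\<lambda>l. P (l ! 0)" "\<lambda>_. i" n] by simp

lemma upt_2: "[0..<2] = [0, Suc 0]"
  by (simp add: numeral_2_eq_2)

lemma definable_subst2:
  "definable M q 2 (\<lambda>e. P (e 0) (e 1)) \<Longrightarrow> i < n \<Longrightarrow> j < n \<Longrightarrow> definable M q n (\<lambda>e. P (e i) (e j))"
  using definable_subst[of M q 2 "\<lambda>l. P (l ! 0) (l ! 1)" "\<lambda>k. if k = 0 then i else j" n]
  by (simp add: upt_2)

lemma definable_subst_Cons:
  assumes "definable M q (Suc k) (\<lambda>e. P (e 0) (map (\<lambda>i. e (Suc i)) [0..<k]))" and "i < n"
    and "\<And>j. j < k \<Longrightarrow> \<rho> j < n"
  shows "definable M q n (\<lambda>e. P (e i) (map (\<lambda>j. e (\<rho> j)) [0..<k]))"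
proof -
  have *: "map f [0..<Suc k] = f 0 # map (\<lambda>i. f (Suc i)) [0..<k]" for f :: "nat \<Rightarrow> 'b"
    by (simp add: upt_conv_Cons map_Suc_upt[symmetric] comp_def del: upt_Suc map_Suc_upt)
  have "definable M q n (\<lambda>e. (\<lambda>l. P (hd l) (tl l)) (map (\<lambda>j. e (case j of 0 \<Rightarrow> i | Suc j \<Rightarrow> \<rho> j)) [0..<Suc k]))"
    by (rule definable_subst) (use assms in \<open>auto simp: * simp del: upt_Suc split: nat.split\<close>)
  then show ?thesis by (simp add: * del: upt_Suc)
qed

lemma definable_all_less:
  assumes "\<And>i. i < (k::nat) \<Longrightarrow> definable M q n (R i)"
  shows "definable M q n (\<lambda>e. \<forall>i < k. R i e)"
  using assms
proof (induction k)
  case 0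
  show ?case
    \<comment> \<open>The empty conjunction needs a tautology that is well-formed even without free
      variables.\<close>
    by (rule definableI[of _ _ _ "Neg (Ex (Neg (Eq (Var 0) (Var 0))))"]) auto
next
  case (Suc k)
  from definable_conj[OF Suc.prems[of k] Suc.IH] Suc.prems show ?case
    by (simp add: All_less_Suc)
qed

section \<open>Hereditarily finite sets\<close>

lemma HF_level_mono: "i \<le> j \<Longrightarrow> HF_level A i \<subseteq> HF_level A j"
  by (rule lift_Suc_mono_le) auto

lemma Ur_in_HF_set [simp]: "Ur a \<in> HF_set A \<longleftrightarrow> a \<in> A"
proof -
  have "Ur a \<in> HF_level A k \<longleftrightarrow> a \<in> A" for k by (induction k) auto
  then show ?thesis by (simp add: HF_set_def)
qed

text \<open>The levels increase, so the members of a finite set lie in a common level.\<close>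

lemma HSet_in_HF_set [simp]: "HSet X \<in> HF_set A \<longleftrightarrow> fset X \<subseteq> HF_set A"
proof
  have "HSet X \<in> HF_level A k \<Longrightarrow> fset X \<subseteq> HF_level A k" for k
  proof (induction k)
    case (Suc k)
    then show ?case using HF_level_mono[of k "Suc k" A] by auto
  qed auto
  then show "HSet X \<in> HF_set A \<Longrightarrow> fset X \<subseteq> HF_set A"
    unfolding HF_set_def by blast
next
  have "\<exists>k. fset X \<subseteq> HF_level A k" if "fset X \<subseteq> HF_set A"
    using that
  proof (induction X)
    case (insert x X)
    then obtain i j where "fset X \<subseteq> HF_level A i" "x \<in> HF_level A j"
      by (auto simp: HF_set_def)
    then have "fset (finsert x X) \<subseteq> HF_level A (max i j)"
      using HF_level_mono[of i "max i j" A] HF_level_mono[of j "max i j" A] by auto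
    then show ?case by blast
  qed auto
  then show "fset X \<subseteq> HF_set A \<Longrightarrow> HSet X \<in> HF_set A"
    unfolding HF_set_def by (metis (mono_tags, lifting) HF_level.simps(2) UN_I UNIV_I UnI2 mem_Collect_eq)
qed

lemma universe_HF [simp]: "universe (HF A) = HF_set (universe A)"
  by (simp add: HF_def Let_def)

lemma lang_HF [simp]: "lang (HF A) = HF_lang (lang A)"
  by (simp add: HF_def Let_def)

lemma funs_HF_lang [simp]: "funs (HF_lang L) = []"
  by (simp add: HF_lang_def)

lemma rels_HF_lang:
  "length (rels (HF_lang L)) = length (funs L) + length (rels L) + 2"
  "f < length (funs L) \<Longrightarrow> rels (HF_lang L) ! f = Suc (funs L ! f)"
  "r < length (rels L) \<Longrightarrow> rels (HF_lang L) ! (length (funs L) + r) = rels L ! r"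
  "rels (HF_lang L) ! (length (funs L) + length (rels L)) = 1"
  "rels (HF_lang L) ! Suc (length (funs L) + length (rels L)) = 2"
  by (auto simp: HF_lang_def nth_append)

lemma is_struct_HF: "is_struct (HF A)"
  using HSet_in_HF_set[of "{||}" "universe A"]
  by (auto simp: is_struct_def simp del: HSet_in_HF_set)

lemma rel_HF:
  "f < length (funs (lang A)) \<Longrightarrow> rel (HF A) f xs \<longleftrightarrow>
    (\<exists>as a. set (as @ [a]) \<subseteq> universe A \<and> xs = map Ur (as @ [a]) \<and> fn A f as = a)"
  "r < length (rels (lang A)) \<Longrightarrow> rel (HF A) (length (funs (lang A)) + r) xs \<longleftrightarrow>
    (\<exists>as. set as \<subseteq> universe A \<and> xs = map Ur as \<and> rel A r as)"
  "rel (HF A) (length (funs (lang A)) + length (rels (lang A))) xs \<longleftrightarrow> (\<exists>a \<in> universe A. xs = [Ur a])"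
  "rel (HF A) (Suc (length (funs (lang A)) + length (rels (lang A)))) xs \<longleftrightarrow>
    (\<exists>x s. xs = [x, HSet s] \<and> x |\<in>| s)"
  by (auto simp: HF_def Let_def)

definition elt :: "'a hf \<Rightarrow> 'a hf \<Rightarrow> bool" where
  "elt x y \<longleftrightarrow> (\<exists>s. y = HSet s \<and> x |\<in>| s)"

lemma elt_simps [simp]: "elt x (HSet s) \<longleftrightarrow> x |\<in>| s" "\<not> elt x (Ur a)"
  by (auto simp: elt_def)

definition is_ur :: "'a hf \<Rightarrow> bool" where
  "is_ur x \<longleftrightarrow> (\<exists>a. x = Ur a)"

lemma is_ur_simps [simp]: "is_ur (Ur a)" "\<not> is_ur (HSet s)"
  by (auto simp: is_ur_def)

lemma definable_eq: "i < n \<Longrightarrow> j < n \<Longrightarrow> definable M q n (\<lambda>e. e i = e j)"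
  by (rule definableI[of _ _ _ "Eq (Var i) (Var j)"]) (auto simp: tuples_def nth_append)

lemma definable_is_ur: "i < n \<Longrightarrow> definable (HF A) q n (\<lambda>e. is_ur (e i))"
proof (rule definableI)
  let ?\<phi> = "Rel (length (funs (lang A)) + length (rels (lang A))) [Var i]"
  assume i: "i < n"
  then show "wf_fm (lang (HF A)) (n + length q) ?\<phi>" by (simp add: rels_HF_lang)
  fix e assume e: "e \<in> tuples n (universe (HF A))"
  have "e ! i \<in> HF_set (universe A)" using tuples_nth[OF e i] by simp
  then show "sat (HF A) (e @ q) ?\<phi> \<longleftrightarrow> is_ur (e ! i)"
    using i tuplesD[OF e] by (auto simp: rel_HF nth_append is_ur_def)
qed

lemma definable_elt: "i < n \<Longrightarrow> j < n \<Longrightarrow> definable (HF A) q n (\<lambda>e. elt (e i) (e j))"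
  by (rule definableI[of _ _ _ "Rel (Suc (length (funs (lang A)) + length (rels (lang A)))) [Var i, Var j]"])
    (auto simp: rels_HF_lang rel_HF nth_append tuples_def elt_def)

lemma HF_set_elt: "elt x y \<Longrightarrow> y \<in> HF_set A \<Longrightarrow> x \<in> HF_set A"
  by (auto simp: elt_def)

text \<open>Unordered pairs are enough for all purposes here: tuples pair an urelement with a set,
  and the relations coded by sets of pairs are symmetric.\<close>

definition upair :: "'a hf \<Rightarrow> 'a hf \<Rightarrow> 'a hf" where
  "upair x y = HSet {|x, y|}"

lemma upair_in_HF_set [simp]: "upair x y \<in> HF_set A \<longleftrightarrow> x \<in> HF_set A \<and> y \<in> HF_set A"
  by (simp add: upair_def)

lemma upair_commute: "upair x y = upair y x"
  by (auto simp: upair_def)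

lemma upair_eq_iff: "upair x y = upair u v \<longleftrightarrow> x = u \<and> y = v \<or> x = v \<and> y = u"
  unfolding upair_def hf.inject fset_inject[symmetric] by (simp add: doubleton_eq_iff)

lemmas definable_intros = definable_not definable_conj definable_disj definable_imp definable_iff
  definable_ex definable_all definable_eq definable_is_ur definable_elt

lemma definable_upair:
  assumes "i < n" "j < n" "k < n"
  shows "definable (HF A) q n (\<lambda>e. e i = upair (e j) (e k))"
proof (rule definable_cong)
  show "definable (HF A) q n (\<lambda>e. \<not> is_ur (e i) \<and>
      (\<forall>z \<in> universe (HF A). elt z (e i) \<longleftrightarrow> z = e j \<or> z = e k))"
    using assms by (intro definable_intros) auto
  fix e assume "\<And>i. i < n \<Longrightarrow> e i \<in> universe (HF A)"
  then have e: "e i \<in> HF_set (universe A)" "e j \<in> HF_set (universe A)" "e k \<in> HF_set (universe A)"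
    using assms by auto
  show "\<not> is_ur (e i) \<and> (\<forall>z \<in> universe (HF A). elt z (e i) \<longleftrightarrow> z = e j \<or> z = e k) \<longleftrightarrow>
      e i = upair (e j) (e k)"
  proof (cases "e i")
    case (HSet s)
    then show ?thesis using e by (auto simp: upair_def fset_eq_iff)
  qed (simp add: upair_def)
qed

section \<open>First-order formulas over the urelements\<close>

definition ur_code :: "language \<Rightarrow> interp_code" where
  "ur_code L = \<lparr>dim = 1, npars = 0,
     dom_fm = Rel (length (funs L) + length (rels L)) [Var 0],
     eq_fm = Eq (Var 0) (Var 1),
     fun_fm = (\<lambda>f. Rel f (map Var [0..<Suc (funs L ! f)])),
     rel_fm = (\<lambda>r. Rel (length (funs L) + r) (map Var [0..<rels L ! r]))\<rparr>"

definition un_ur :: "'a hf \<Rightarrow> 'a" where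
  "un_ur x = (case x of Ur a \<Rightarrow> a | HSet _ \<Rightarrow> undefined)"

lemma un_ur_Ur [simp]: "un_ur (Ur a) = a"
  by (simp add: un_ur_def)

lemma code_dom_ur_code:
  "code_dom (ur_code (lang B)) (HF B) [] = (\<lambda>b. [Ur b]) ` universe B"
  by (auto simp: code_dom_def ur_code_def rel_HF tuples_def length_Suc_conv)

lemma eval_vars: "n \<le> length e \<Longrightarrow> map (eval_tm A e) (map Var [0..<n]) = take n e"
  by (rule nth_equalityI) auto

lemma coord_map_ur_code:
  assumes "is_struct B"
  shows "coord_map (ur_code (lang B)) (HF B) [] B (\<lambda>c. un_ur (hd c))"
proof -
  let ?\<Theta> = "ur_code (lang B)"
  have params: "npars ?\<Theta> = 0" "dim ?\<Theta> = 1" by (simp_all add: ur_code_def)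
  have code: "is_code (lang B) (HF_lang (lang B)) ?\<Theta>"
    by (auto simp: is_code_def ur_code_def rels_HF_lang)
  have tup: "\<exists>as. set as \<subseteq> universe B \<and> bs = map (\<lambda>b. [Ur b]) as"
    if "bs \<in> tuples n ((\<lambda>b. [Ur b]) ` universe B)" for bs n
    using that by (elim tuples_image_liftE) (auto simp: tuples_def)
  have concat: "concat (map (\<lambda>b. [Ur b]) as) = map Ur as" for as :: "'a list"
    by (induction as) auto
  have funs: "sat (HF B) (concat bs @ b) (fun_fm ?\<Theta> f) \<longleftrightarrow> fn B f (map (\<lambda>c. un_ur (hd c)) bs) = un_ur (hd b)"
    if f: "f < length (funs (lang B))" and bs: "bs \<in> tuples (funs (lang B) ! f) ((\<lambda>b. [Ur b]) ` universe B)"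
      and b: "b \<in> (\<lambda>b. [Ur b]) ` universe B" for f bs b
  proof -
    obtain as where as: "set as \<subseteq> universe B" "bs = map (\<lambda>b. [Ur b]) as" using tup[OF bs] by blast
    obtain a where a: "a \<in> universe B" "b = [Ur a]" using b by blast
    have len: "length as = funs (lang B) ! f" using tuplesD[OF bs] as by simp
    have "sat (HF B) (concat bs @ b) (fun_fm ?\<Theta> f) \<longleftrightarrow> rel (HF B) f (map Ur (as @ [a]))"
      using eval_vars[of "Suc (length as)" "map Ur (as @ [a])" "HF B"] len
      by (simp add: ur_code_def as a concat del: upt_Suc map_map)
    also have "\<dots> \<longleftrightarrow> fn B f as = a"
      using f as a inj_map_eq_map[of Ur] by (auto simp: rel_HF inj_def map_eq_append_conv)
    finally show ?thesis by (simp add: as a comp_def)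
  qed
  have rels: "sat (HF B) (concat bs) (rel_fm ?\<Theta> r) \<longleftrightarrow> rel B r (map (\<lambda>c. un_ur (hd c)) bs)"
    if r: "r < length (rels (lang B))" and bs: "bs \<in> tuples (rels (lang B) ! r) ((\<lambda>b. [Ur b]) ` universe B)"
    for r bs
  proof -
    obtain as where as: "set as \<subseteq> universe B" "bs = map (\<lambda>b. [Ur b]) as" using tup[OF bs] by blast
    have len: "length as = rels (lang B) ! r" using tuplesD[OF bs] as by simp
    have "sat (HF B) (concat bs) (rel_fm ?\<Theta> r) \<longleftrightarrow> rel (HF B) (length (funs (lang B)) + r) (map Ur as)"
      using eval_vars[of "length as" "map Ur as" "HF B"] len
      by (simp add: ur_code_def as concat del: map_map)
    also have "\<dots> \<longleftrightarrow> rel B r as"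
      using r as inj_map_eq_map[of Ur] by (auto simp: rel_HF inj_def)
    finally show ?thesis by (simp add: as comp_def)
  qed
  have eqs: "sat (HF B) (b @ c) (eq_fm ?\<Theta>) \<longleftrightarrow> un_ur (hd b) = un_ur (hd c)"
    if "b \<in> (\<lambda>b. [Ur b]) ` universe B" "c \<in> (\<lambda>b. [Ur b]) ` universe B" for b c
    using that by (auto simp: ur_code_def)
  show ?thesis
    unfolding coord_map_def code_dom_ur_code lang_HF params
    by (intro conjI ballI allI impI) (simp_all add: code eqs funs rels image_image)
qed

text \<open>B is interpreted in HF(B) on the urelements. Translation along this interpretation
  restricts quantifiers to urelements and replaces functions by their graphs, so
  \<open>sat_tr_fm\<close> does the work of a relativisation lemma.\<close>

lemma ur_formula:
  assumes B: "is_struct B" and \<psi>: "wf_fm (lang B) k \<psi>"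
  shows "\<exists>\<psi>'. wf_fm (HF_lang (lang B)) k \<psi>' \<and>
    (\<forall>bs \<in> tuples k (universe B). sat (HF B) (map Ur bs) \<psi>' \<longleftrightarrow> sat B bs \<psi>)"
proof (intro exI conjI ballI)
  let ?\<Theta> = "ur_code (lang B)"
  have params: "npars ?\<Theta> = 0" "dim ?\<Theta> = 1" by (simp_all add: ur_code_def)
  note \<Theta> = coord_map_ur_code[OF B]
  show "wf_fm (HF_lang (lang B)) k (tr_fm ?\<Theta> k \<psi>)"
    using wf_tr_fm[OF coord_mapD(1)[OF \<Theta>] \<psi>] by (simp add: params)
  fix bs assume bs: "bs \<in> tuples k (universe B)"
  have "map (\<lambda>b. [Ur b]) bs \<in> tuples k (code_dom ?\<Theta> (HF B) [])"
    unfolding code_dom_ur_code by (rule map_image_tuples[OF bs]) auto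
  from sat_tr_fm[OF \<Theta> B \<psi> this]
  have "sat (HF B) (concat (map (\<lambda>b. [Ur b]) bs)) (tr_fm ?\<Theta> k \<psi>) \<longleftrightarrow> sat B bs \<psi>"
    by (simp add: comp_def)
  moreover have "concat (map (\<lambda>b. [Ur b]) bs) = map Ur bs"
    by (induction bs) auto
  ultimately show "sat (HF B) (map Ur bs) (tr_fm ?\<Theta> k \<psi>) \<longleftrightarrow> sat B bs \<psi>" by simp
qed

lemma all_ur_iff:
  assumes "length l = k" "set l \<subseteq> HF_set U"
  shows "(\<forall>i < k. is_ur (l ! i)) \<longleftrightarrow> (\<exists>bs \<in> tuples k U. l = map Ur bs)"
proof
  assume "\<forall>i < k. is_ur (l ! i)"
  then have l: "l ! i = Ur (un_ur (l ! i))" if "i < k" for i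
    using that by (auto simp: is_ur_def)
  then have "l = map Ur (map un_ur l)"
    using assms(1) by (intro nth_equalityI) auto
  moreover from l have "un_ur (l ! i) \<in> U" if "i < k" for i
    using that assms by (metis Ur_in_HF_set nth_mem subsetD)
  then have "map un_ur l \<in> tuples k U"
    using assms(1) by (auto simp: tuples_def in_set_conv_nth)
  ultimately show "\<exists>bs \<in> tuples k U. l = map Ur bs" by blast
qed (auto simp: tuples_def)

lemma definable_formula:
  assumes B: "is_struct B" and \<psi>: "wf_fm (lang B) (k + length p) \<psi>" and p: "set p \<subseteq> universe B"
  shows "definable (HF B) (map Ur p) k
    (\<lambda>e. \<exists>bs \<in> tuples k (universe B). map e [0..<k] = map Ur bs \<and> sat B (bs @ p) \<psi>)"
proof -
  obtain \<psi>' where \<psi>': "wf_fm (HF_lang (lang B)) (k + length p) \<psi>'"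
    "\<And>bs. bs \<in> tuples (k + length p) (universe B) \<Longrightarrow> sat (HF B) (map Ur bs) \<psi>' \<longleftrightarrow> sat B bs \<psi>"
    using ur_formula[OF B \<psi>] by blast
  let ?q = "map Ur p"
  have 1: "definable (HF B) ?q k (\<lambda>e. sat (HF B) (map e [0..<k] @ ?q) \<psi>')"
  proof (rule definableI[of _ _ _ \<psi>'])
    fix e assume "e \<in> tuples k (universe (HF B))"
    then have "map ((!) e) [0..<k] = e" using map_nth[of e] tuplesD by metis
    then show "sat (HF B) (e @ ?q) \<psi>' \<longleftrightarrow> sat (HF B) (map ((!) e) [0..<k] @ ?q) \<psi>'" by simp
  qed (use \<psi>' in simp)
  have 2: "definable (HF B) ?q k (\<lambda>e. \<forall>i < k. is_ur (e i))"
    by (intro definable_all_less definable_is_ur)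
  show ?thesis
  proof (rule definable_cong[OF definable_conj[OF 2 1]])
    fix e :: "nat \<Rightarrow> 'a hf" assume e: "\<And>i. i < k \<Longrightarrow> e i \<in> universe (HF B)"
    have "set (map e [0..<k]) \<subseteq> HF_set (universe B)" using e by auto
    then have "(\<forall>i < k. is_ur (map e [0..<k] ! i)) \<longleftrightarrow>
        (\<exists>bs \<in> tuples k (universe B). map e [0..<k] = map Ur bs)"
      by (intro all_ur_iff) auto
    then have "(\<forall>i < k. is_ur (e i)) \<longleftrightarrow> (\<exists>bs \<in> tuples k (universe B). map e [0..<k] = map Ur bs)"
      by simp
    moreover have "sat (HF B) (map Ur bs @ ?q) \<psi>' \<longleftrightarrow> sat B (bs @ p) \<psi>" if "bs \<in> tuples k (universe B)" for bs
      using \<psi>'(2)[of "bs @ p"] that p by (auto simp: tuples_def)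
    ultimately show "(\<forall>i < k. is_ur (e i)) \<and> sat (HF B) (map e [0..<k] @ ?q) \<psi>' \<longleftrightarrow>
        (\<exists>bs \<in> tuples k (universe B). map e [0..<k] = map Ur bs \<and> sat B (bs @ p) \<psi>)"
      by (metis (no_types, lifting))
  qed
qed

section \<open>Coding tuples\<close>

fun tup :: "'a list \<Rightarrow> 'a hf" where
  "tup [] = HSet {||}"
| "tup (b # bs) = upair (Ur b) (tup bs)"

lemma tup_neq_Ur [simp]: "tup bs \<noteq> Ur b" "Ur b \<noteq> tup bs"
  by (cases bs; simp add: upair_def)+

text \<open>A tuple is always coded by a set, never by an urelement. Hence the two members of
  \<open>upair (Ur b) (tup bs)\<close> cannot be confused, although the pair is unordered.\<close>

lemma tup_inj [simp]: "tup bs = tup cs \<longleftrightarrow> bs = cs"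
proof (induction bs arbitrary: cs)
  case Nil
  show ?case by (cases cs) (simp_all add: upair_def flip: fset_inject)
next
  case (Cons b bs)
  show ?case
  proof (cases cs)
    case Nil
    then show ?thesis by (simp add: upair_def flip: fset_inject)
  next
    case (Cons c cs')
    then show ?thesis using Cons.IH by (simp add: upair_eq_iff)
  qed
qed

lemma tup_in_HF_set [simp]: "tup bs \<in> HF_set U \<longleftrightarrow> set bs \<subseteq> U"
  by (induction bs) auto

definition is_tup :: "'a set \<Rightarrow> nat \<Rightarrow> 'a hf \<Rightarrow> 'a hf list \<Rightarrow> bool" where
  "is_tup U n x l \<longleftrightarrow> (\<exists>bs \<in> tuples n U. x = tup bs \<and> l = map Ur bs)"

lemma is_tup_Suc:
  "is_tup U (Suc n) x (y # l) \<longleftrightarrow>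
    (\<exists>b \<in> U. y = Ur b) \<and> (\<exists>t \<in> HF_set U. is_tup U n t l \<and> x = upair y t)"
proof
  assume "is_tup U (Suc n) x (y # l)"
  then obtain bs where "bs \<in> tuples (Suc n) U" "x = tup bs" "y # l = map Ur bs"
    by (auto simp: is_tup_def)
  then show "(\<exists>b \<in> U. y = Ur b) \<and> (\<exists>t \<in> HF_set U. is_tup U n t l \<and> x = upair y t)"
    by (cases bs) (auto simp: is_tup_def tuples_def)
next
  assume "(\<exists>b \<in> U. y = Ur b) \<and> (\<exists>t \<in> HF_set U. is_tup U n t l \<and> x = upair y t)"
  then obtain b bs where "b \<in> U" "y = Ur b" "bs \<in> tuples n U" "x = upair y (tup bs)" "l = map Ur bs"
    by (auto simp: is_tup_def)
  then show "is_tup U (Suc n) x (y # l)"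
    unfolding is_tup_def by (intro bexI[of _ "b # bs"]) (auto simp: tuples_Cons)
qed

lemma map_upt_Suc: "map f [0..<Suc k] = f 0 # map (\<lambda>i. f (Suc i)) [0..<k]"
  by (simp add: upt_conv_Cons map_Suc_upt[symmetric] comp_def del: upt_Suc map_Suc_upt)

text \<open>The length is fixed outside the logic, so each \<open>n\<close> gets its own
  formula.\<close>

lemma definable_is_tup:
  "definable (HF B) q (Suc n) (\<lambda>e. is_tup (universe B) n (e 0) (map (\<lambda>i. e (Suc i)) [0..<n]))"
proof (induction n)
  case 0
  show ?case
  proof (rule definable_cong)
    show "definable (HF B) q (Suc 0) (\<lambda>e. \<not> is_ur (e 0) \<and> (\<forall>z \<in> universe (HF B). \<not> elt z (e 0)))"
      by (intro definable_intros) auto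
    fix e :: "nat \<Rightarrow> 'a hf" assume "\<And>i. i < Suc 0 \<Longrightarrow> e i \<in> universe (HF B)"
    then have "e 0 \<in> HF_set (universe B)" by simp
    then show "(\<not> is_ur (e 0) \<and> (\<forall>z \<in> universe (HF B). \<not> elt z (e 0))) \<longleftrightarrow>
        is_tup (universe B) 0 (e 0) (map (\<lambda>i. e (Suc i)) [0..<0])"
      by (cases "e 0") (auto simp: is_tup_def)
  qed
next
  case (Suc n)
  show ?case
  proof (rule definable_cong)
    show "definable (HF B) q (Suc (Suc n)) (\<lambda>e. is_ur (e 1) \<and>
        (\<exists>t \<in> universe (HF B). is_tup (universe B) n t (map (\<lambda>i. e (Suc (Suc i))) [0..<n]) \<and> e 0 = upair (e 1) t))"
      \<comment> \<open>Under the quantifier over \<open>t\<close> all variables move up by one, so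
        the tail of the list begins at index 3.\<close>
      by (intro definable_intros definable_upair
          definable_subst_Cons[OF Suc, where i = 0 and \<rho> = "\<lambda>i. Suc (Suc (Suc i))"]) auto
    fix e :: "nat \<Rightarrow> 'a hf" assume "\<And>i. i < Suc (Suc n) \<Longrightarrow> e i \<in> universe (HF B)"
    then have "e 1 \<in> HF_set (universe B)" by simp
    then show "(is_ur (e 1) \<and> (\<exists>t \<in> universe (HF B).
          is_tup (universe B) n t (map (\<lambda>i. e (Suc (Suc i))) [0..<n]) \<and> e 0 = upair (e 1) t)) \<longleftrightarrow>
        is_tup (universe B) (Suc n) (e 0) (map (\<lambda>i. e (Suc i)) [0..<Suc n])"
      by (cases "e 1") (auto simp: map_upt_Suc is_tup_Suc simp del: upt_Suc)
  qed
qed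

text \<open>An element of the interpreted structure represented by the tuple \<open>b\<close> is encoded by
  \<open>tup (c # b)\<close> with an arbitrary \<open>c\<close>, so that codes of elements contain an urelement
  even when the dimension is zero, whereas codes of sets do not.\<close>

definition is_atom :: "'a set \<Rightarrow> nat \<Rightarrow> 'a hf \<Rightarrow> 'a hf list \<Rightarrow> bool" where
  "is_atom U n x l \<longleftrightarrow> (\<exists>b \<in> tuples n U. \<exists>c \<in> U. x = tup (c # b) \<and> l = map Ur b)"

lemma is_atom_iff: "is_atom U n x l \<longleftrightarrow> (\<exists>y \<in> HF_set U. is_tup U (Suc n) x (y # l))"
proof
  assume "is_atom U n x l"
  then obtain b c where "b \<in> tuples n U" "c \<in> U" "x = tup (c # b)" "l = map Ur b"
    by (auto simp: is_atom_def)
  then show "\<exists>y \<in> HF_set U. is_tup U (Suc n) x (y # l)"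
    by (intro bexI[of _ "Ur c"]) (auto simp: is_tup_def tuples_Cons intro!: bexI[of _ "c # b"])
next
  assume "\<exists>y \<in> HF_set U. is_tup U (Suc n) x (y # l)"
  then obtain y bs where "bs \<in> tuples (Suc n) U" "x = tup bs" "y # l = map Ur bs"
    by (auto simp: is_tup_def)
  then show "is_atom U n x l"
    by (cases bs) (auto simp: is_atom_def tuples_Cons)
qed

lemma definable_is_atom:
  "definable (HF B) q (Suc n) (\<lambda>e. is_atom (universe B) n (e 0) (map (\<lambda>i. e (Suc i)) [0..<n]))"
proof -
  \<comment> \<open>Under the quantifier, variable 0 is the spare entry \<open>y\<close>, variable 1
    the code, and the entries of the list begin at variable 2.\<close>
  have "definable (HF B) q (Suc (Suc n)) (\<lambda>e. is_tup (universe B) (Suc n) (e 1)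
      (map (\<lambda>i. e (if i = 0 then 0 else Suc i)) [0..<Suc n]))"
    by (rule definable_subst_Cons[OF definable_is_tup]) auto
  then have "definable (HF B) q (Suc n) (\<lambda>e. \<exists>y \<in> universe (HF B). is_tup (universe B) (Suc n) (e 0)
      (y # map (\<lambda>i. e (Suc i)) [0..<n]))"
    by (intro definable_ex) (simp add: map_upt_Suc del: upt_Suc)
  then show ?thesis by (simp add: is_atom_iff)
qed

lemma bex_map_iff:
  assumes "\<And>b. b \<in> S \<Longrightarrow> f b \<in> T"
  shows "(\<exists>y \<in> T. P y \<and> (\<exists>b \<in> S. y = f b \<and> Q b)) \<longleftrightarrow> (\<exists>b \<in> S. P (f b) \<and> Q b)"
  using assms by blast

text \<open>This turns a formula of an interpretation into a relation between codes of atoms: the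
  entries of the tuples are quantified as one flat list of urelements and then regrouped. It serves
  for the domain, for equality and for the symbols.\<close>

lemma definable_atoms:
  assumes B: "is_struct B" and \<psi>: "wf_fm (lang B) (k * n + length p) \<psi>" and p: "set p \<subseteq> universe B"
  shows "definable (HF B) (map Ur p) k (\<lambda>e. \<exists>bs \<in> tuples k (tuples n (universe B)).
    (\<forall>i < k. \<exists>c \<in> universe B. e i = tup (c # bs ! i)) \<and> sat B (concat bs @ p) \<psi>)"
proof (rule definable_cong)
  let ?q = "map Ur p" and ?U = "universe B"
  let ?R = "\<lambda>ys. \<exists>bs \<in> tuples (k * n) ?U. ys = map Ur bs \<and> sat B (bs @ p) \<psi>"
  have "definable (HF B) ?q (k * n + k)
      (\<lambda>e. (\<forall>i < k. is_atom ?U n (e (k * n + i)) (map (\<lambda>j. e (i * n + j)) [0..<n])) \<and> ?R (map e [0..<k * n]))"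
  proof (intro definable_conj definable_all_less)
    fix i assume "i < k"
    then show "definable (HF B) ?q (k * n + k) (\<lambda>e. is_atom ?U n (e (k * n + i)) (map (\<lambda>j. e (i * n + j)) [0..<n]))"
      by (intro definable_subst_Cons[OF definable_is_atom]) (auto intro: trans_less_add1 block_index_less)
  next
    show "definable (HF B) ?q (k * n + k) (\<lambda>e. ?R (map e [0..<k * n]))"
      using definable_subst[OF definable_formula[OF B \<psi> p], of "\<lambda>i. i" "k * n + k"] by simp
  qed
  moreover have idx: "map (\<lambda>j. map e [0..<k * n] ! (i * n + j)) [0..<n] = map (\<lambda>j. e (i * n + j)) [0..<n]"
    if "i < k" for i and e :: "nat \<Rightarrow> 'a hf"
    using block_index_less[OF that] by simp
  ultimately show "definable (HF B) ?q k (\<lambda>e. \<exists>ys \<in> tuples (k * n) (universe (HF B)).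
      (\<forall>i < k. is_atom ?U n (e i) (map (\<lambda>j. ys ! (i * n + j)) [0..<n])) \<and> ?R ys)"
    by (intro definable_ex_tuples) (simp only: idx cong: imp_cong)
  fix e :: "nat \<Rightarrow> 'a hf"
  show "(\<exists>ys \<in> tuples (k * n) (universe (HF B)).
      (\<forall>i < k. is_atom ?U n (e i) (map (\<lambda>j. ys ! (i * n + j)) [0..<n])) \<and> ?R ys) \<longleftrightarrow>
    (\<exists>bs \<in> tuples k (tuples n ?U). (\<forall>i < k. \<exists>c \<in> ?U. e i = tup (c # bs ! i)) \<and> sat B (concat bs @ p) \<psi>)"
    (is "?l \<longleftrightarrow> ?r")
  proof -
    have blk: "map (\<lambda>j. map Ur (concat bs) ! (i * n + j)) [0..<n] = map Ur (bs ! i)"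
      if bs: "bs \<in> tuples k (tuples n ?U)" and i: "i < k" for bs :: "'a list list" and i
      using nth_concat_blocks[OF bs i] block_index_less[OF i] length_concat_tuples[OF bs]
        tuplesD[OF tuples_nth[OF bs i]]
      by (intro nth_equalityI) auto
    have at: "is_atom ?U n x (map Ur b) \<longleftrightarrow> (\<exists>c \<in> ?U. x = tup (c # b))" if "b \<in> tuples n ?U" for x b
      using that by (auto simp: is_atom_def inj_map_eq_map inj_def)
    have main: "(\<forall>i < k. is_atom ?U n (e i) (map (\<lambda>j. map Ur (concat bs) ! (i * n + j)) [0..<n])) \<longleftrightarrow>
        (\<forall>i < k. \<exists>c \<in> ?U. e i = tup (c # bs ! i))" if bs: "bs \<in> tuples k (tuples n ?U)" for bs
      using blk[OF bs] at tuples_nth[OF bs] by auto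
    have mem: "map Ur b \<in> tuples (k * n) (universe (HF B))" if "b \<in> tuples (k * n) ?U" for b
      using that by (auto simp: tuples_def)
    have "?l \<longleftrightarrow> (\<exists>b \<in> tuples (k * n) ?U.
        (\<forall>i < k. is_atom ?U n (e i) (map (\<lambda>j. map Ur b ! (i * n + j)) [0..<n])) \<and> sat B (b @ p) \<psi>)"
      by (rule bex_map_iff[OF mem])
    also have "\<dots> \<longleftrightarrow> ?r"
    proof
      assume "\<exists>b \<in> tuples (k * n) ?U.
        (\<forall>i < k. is_atom ?U n (e i) (map (\<lambda>j. map Ur b ! (i * n + j)) [0..<n])) \<and> sat B (b @ p) \<psi>"
      then obtain b where b: "b \<in> tuples (k * n) ?U" "sat B (b @ p) \<psi>"
        "\<forall>i < k. is_atom ?U n (e i) (map (\<lambda>j. map Ur b ! (i * n + j)) [0..<n])"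
        by blast
      then obtain bs where bs: "bs \<in> tuples k (tuples n ?U)" "concat bs = b" by (elim concat_tuplesE)
      show ?r by (rule bexI[OF _ bs(1)]) (use main[OF bs(1)] bs(2) b in simp)
    next
      assume ?r
      then obtain bs where bs: "bs \<in> tuples k (tuples n ?U)" "sat B (concat bs @ p) \<psi>"
        "\<forall>i < k. \<exists>c \<in> ?U. e i = tup (c # bs ! i)"
        by blast
      show "\<exists>b \<in> tuples (k * n) ?U.
        (\<forall>i < k. is_atom ?U n (e i) (map (\<lambda>j. map Ur b ! (i * n + j)) [0..<n])) \<and> sat B (b @ p) \<psi>"
        by (rule bexI[OF _ concat_tuples[OF bs(1)]]) (use main[OF bs(1)] bs in blast)
    qed
    finally show ?thesis .
  qed
qed

lemma bex_tuples_Suc: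
  "(\<exists>xs \<in> tuples (Suc k) X. P xs) \<longleftrightarrow> (\<exists>x \<in> X. \<exists>xs \<in> tuples k X. P (x # xs))"
proof -
  have "tuples (Suc k) X = (\<lambda>(x, xs). x # xs) ` (X \<times> tuples k X)"
    by (auto simp: tuples_def length_Suc_conv)
  then show ?thesis by auto
qed

lemma bex_tuples_0: "(\<exists>xs \<in> tuples 0 X. P xs) \<longleftrightarrow> P []"
  by (simp add: Bex_def)

lemma bex_tuples_1: "(\<exists>xs \<in> tuples 1 X. P xs) \<longleftrightarrow> (\<exists>x \<in> X. P [x])"
  by (simp add: bex_tuples_Suc bex_tuples_0)

lemma bex_tuples_2: "(\<exists>xs \<in> tuples 2 X. P xs) \<longleftrightarrow> (\<exists>x \<in> X. \<exists>y \<in> X. P [x, y])"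
  by (simp add: bex_tuples_Suc bex_tuples_0 numeral_2_eq_2)

declare tup.simps [simp del]

section \<open>Interpreting hereditarily finite sets\<close>

locale hf_coding =
  fixes \<Gamma> :: interp_code and B :: "'b struct" and p :: "'b list" and A :: "'a struct" and \<mu>
  assumes \<mu>: "coord_map \<Gamma> B p A \<mu>" and B: "is_struct B"
begin

abbreviation "U \<equiv> universe B"
abbreviation "D \<equiv> code_dom \<Gamma> B p"
abbreviation "n \<equiv> dim \<Gamma>"
abbreviation "q \<equiv> map Ur p"

lemma D_tuples: "b \<in> D \<Longrightarrow> b \<in> tuples n U"
  using code_dom_tuples by blast

lemma p_in_U: "set p \<subseteq> U" and length_p: "length p = npars \<Gamma>"
  using coord_mapD(2)[OF \<mu>] by (auto simp: tuples_def)

lemma U_nonempty: obtains c where "c \<in> U"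
  using B by (auto simp: is_struct_def)

text \<open>The coding is redundant: an element has a code for each representing tuple and each
  spare entry \<open>c\<close>, and sets inherit the ambiguity. Equality of codes therefore needs a
  definition of its own.\<close>

inductive_set codes :: "'b hf set" where
  atom: "b \<in> D \<Longrightarrow> c \<in> U \<Longrightarrow> tup (c # b) \<in> codes"
| set: "(\<And>x. x |\<in>| X \<Longrightarrow> x \<in> codes) \<Longrightarrow> HSet X \<in> codes"

lemma Ur_notin_codes [simp]: "Ur a \<notin> codes"
  by (auto elim: codes.cases)

text \<open>The code of an atom has the urelement \<open>c\<close> as a member, whereas no urelement
  is a code. This keeps atoms and sets apart.\<close>

lemma tup_Cons_neq_code_set: "fset X \<subseteq> codes \<Longrightarrow> HSet X \<noteq> tup (c # b)"
proof
  assume X: "fset X \<subseteq> codes" "HSet X = tup (c # b)"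
  then have "Ur c |\<in>| X" by (simp add: upair_def tup.simps)
  then show False using X by auto
qed

lemma tup_Cons_in_codes: "tup (c # b) \<in> codes \<longleftrightarrow> b \<in> D \<and> c \<in> U"
proof
  assume "tup (c # b) \<in> codes"
  then show "b \<in> D \<and> c \<in> U"
  proof cases
    case (set X)
    then show ?thesis using tup_Cons_neq_code_set[of X c b] by auto
  qed auto
qed (auto intro: codes.atom)

lemma codes_in_HF_set: "x \<in> codes \<Longrightarrow> x \<in> HF_set U"
proof (induction rule: codes.induct)
  case (atom b c)
  then show ?case using D_tuples by (auto simp: tuples_def)
qed auto

lemma codes_cases [consumes 1, case_names atom set]:
  assumes "x \<in> codes"
  obtains b c where "b \<in> D" "c \<in> U" "x = tup (c # b)"
  | X where "x = HSet X" "fset X \<subseteq> codes"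
  using assms by cases blast+

text \<open>The two kinds of codes are told apart by shape, as \<open>tup_Cons_neq_code_set\<close>
  permits, and injectivity of \<open>tup\<close> makes the choice of \<open>b\<close> unique. Values
  outside \<open>codes\<close> are arbitrary.\<close>

primrec decode :: "'b hf \<Rightarrow> 'a hf" where
  "decode (Ur a) = Ur undefined"
| "decode (HSet X) = (if \<exists>c b. HSet X = tup (c # b) then Ur (\<mu> (SOME b. \<exists>c. HSet X = tup (c # b)))
     else HSet (decode |`| X))"

lemma decode_atom: "decode (tup (c # b)) = Ur (\<mu> b)"
proof -
  obtain X where X: "tup (c # b) = HSet X" by (simp add: upair_def tup.simps)
  have "(SOME b'. \<exists>c. HSet X = tup (c # b')) = b"
    unfolding X[symmetric] tup_inj by blast
  moreover have "\<exists>c b. HSet X = tup (c # b)" using X by metis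
  ultimately show ?thesis unfolding X by (simp)
qed

lemma decode_set: "fset X \<subseteq> codes \<Longrightarrow> decode (HSet X) = HSet (decode |`| X)"
  using tup_Cons_neq_code_set by simp

declare decode.simps [simp del]

text \<open>For surjectivity, a finite set is decoded from the set of chosen codes of its members,
  and an urelement from a representative with any spare entry.\<close>

lemma decode_image: "decode ` codes = HF_set (universe A)"
proof (intro equalityI subsetI)
  fix y assume "y \<in> decode ` codes"
  then obtain x where "x \<in> codes" "y = decode x" by blast
  moreover have "decode x \<in> HF_set (universe A)" if "x \<in> codes" for x
    using that
  proof (induction rule: codes.induct)
    case (atom b c)
    then show ?case using coord_mapD(3)[OF \<mu>] by (auto simp: decode_atom)
  next
    case (set X)
    then have "fset X \<subseteq> codes" by auto
    with set show ?case by (auto simp: decode_set)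
  qed
  ultimately show "y \<in> HF_set (universe A)" by simp
next
  fix y :: "'a hf" assume "y \<in> HF_set (universe A)"
  then show "y \<in> decode ` codes"
  proof (induction y)
    case (Ur a)
    then obtain b where b: "b \<in> D" "a = \<mu> b" using coord_mapD(3)[OF \<mu>] by auto
    obtain c where c: "c \<in> U" by (rule U_nonempty)
    show ?case by (rule image_eqI[of _ _ "tup (c # b)"]) (use b c in \<open>simp_all only: decode_atom codes.atom\<close>)
  next
    case (HSet Y)
    then have "\<forall>y. y |\<in>| Y \<longrightarrow> (\<exists>x. x \<in> codes \<and> decode x = y)" by fastforce
    then obtain g where g: "\<And>y. y |\<in>| Y \<Longrightarrow> g y \<in> codes" "\<And>y. y |\<in>| Y \<Longrightarrow> decode (g y) = y"
      by metis
    have sub: "fset (g |`| Y) \<subseteq> codes" using g(1) by auto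
    have "decode |`| (g |`| Y) = Y"
      unfolding fset_inject[symmetric] using g(2) by (force simp: image_iff)
    then show ?case
      using decode_set[OF sub] sub by (intro image_eqI[of _ _ "HSet (g |`| Y)"]) (auto intro: codes.set)
  qed
qed

section \<open>Definability of the set of codes\<close>

definition is_atom_code :: "'b hf \<Rightarrow> bool" where
  "is_atom_code x \<longleftrightarrow> (\<exists>b \<in> D. \<exists>c \<in> U. x = tup (c # b))"

lemma is_atom_code_iff: "x \<in> codes \<Longrightarrow> is_atom_code x \<longleftrightarrow> (\<exists>a. decode x = Ur a)"
  by (cases rule: codes_cases)
    (auto simp: is_atom_code_def decode_atom decode_set tup_Cons_neq_code_set)

lemma definable_is_atom_code: "i < k \<Longrightarrow> definable (HF B) q k (\<lambda>e. is_atom_code (e i))"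
proof (rule definable_subst1)
  have \<psi>: "wf_fm (lang B) (1 * n + length p) (dom_fm \<Gamma>)"
    using is_codeD(1)[OF coord_mapD(1)[OF \<mu>]] by (simp add: length_p)
  have "(\<exists>bs \<in> tuples 1 (tuples n U). (\<forall>i < 1. \<exists>c \<in> U. x i = tup (c # bs ! i)) \<and> sat B (concat bs @ p) (dom_fm \<Gamma>))
      \<longleftrightarrow> is_atom_code (x 0)" for x :: "nat \<Rightarrow> 'b hf"
    unfolding bex_tuples_1 by (auto simp: is_atom_code_def code_dom_def)
  then show "definable (HF B) q 1 (\<lambda>e. is_atom_code (e 0))"
    using definable_atoms[OF B \<psi> p_in_U] by (simp only:)
qed

text \<open>A closed set certifies that its members are codes: each of them is an atom or a set of
  further members, and membership is well-founded.\<close>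

definition closed :: "'b hf fset \<Rightarrow> bool" where
  "closed T \<longleftrightarrow> (\<forall>t. t |\<in>| T \<longrightarrow> is_atom_code t \<or> (\<exists>X. t = HSet X \<and> X |\<subseteq>| T))"

lemma closedD:
  assumes "closed T" "t |\<in>| T" "\<not> is_atom_code t"
  shows "\<exists>X. t = HSet X \<and> fset X \<subseteq> fset T"
  using assms unfolding closed_def less_eq_fset.rep_eq by blast

lemma closed_subset_codes:
  assumes T: "closed T"
  shows "t |\<in>| T \<Longrightarrow> t \<in> codes"
proof (induction t)
  case (Ur a)
  then show ?case using T by (auto simp: closed_def is_atom_code_def)
next
  case (HSet X)
  from T HSet.prems have "is_atom_code (HSet X) \<or> X |\<subseteq>| T"
    by (auto simp: closed_def)
  then show ?case
  proof
    assume "is_atom_code (HSet X)"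
    then show ?thesis by (auto simp: is_atom_code_def intro: codes.atom)
  next
    assume "X |\<subseteq>| T"
    then show ?thesis using HSet.IH by (intro codes.set) blast
  qed
qed

lemma closed_union: "closed S \<Longrightarrow> closed T \<Longrightarrow> closed (S |\<union>| T)"
  unfolding closed_def by blast

text \<open>The certificates of the members are united and the set itself is added; as
  \<open>X\<close> is finite, the union is again a finite set.\<close>

lemma codes_closed:
  "x \<in> codes \<Longrightarrow> \<exists>T. x |\<in>| T \<and> closed T"
proof (induction rule: codes.induct)
  case (atom b c)
  then show ?case
    by (intro exI[of _ "{|tup (c # b)|}"]) (auto simp: closed_def is_atom_code_def)
next
  case (set X)
  then obtain g where g: "\<And>x. x |\<in>| X \<Longrightarrow> x |\<in>| g x \<and> closed (g x)" by metis
  let ?T = "ffUnion (g |`| X)"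
  have T: "t |\<in>| ?T \<longleftrightarrow> (\<exists>x. x |\<in>| X \<and> t |\<in>| g x)" for t
    by (auto simp: ffUnion.rep_eq)
  have gT: "g x |\<subseteq>| ?T" if "x |\<in>| X" for x
    using that by (intro fsubsetI) (auto simp only: T)
  have "closed (finsert (HSet X) ?T)"
    unfolding closed_def
  proof (intro allI impI)
    fix t assume "t |\<in>| finsert (HSet X) ?T"
    then consider "t = HSet X" | x where "x |\<in>| X" "t |\<in>| g x"
      by (auto simp only: finsert_iff T)
    then show "is_atom_code t \<or> (\<exists>Y. t = HSet Y \<and> Y |\<subseteq>| finsert (HSet X) ?T)"
    proof cases
      case 1
      have "X |\<subseteq>| ?T" using g by (intro fsubsetI) (auto simp only: T)
      then show ?thesis using 1 by auto
    next
      case 2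
      then have "is_atom_code t \<or> (\<exists>Y. t = HSet Y \<and> Y |\<subseteq>| g x)"
        using g unfolding closed_def by blast
      then show ?thesis using gT[OF 2(1)] by blast
    qed
  qed
  then show ?case by (intro exI[of _ "finsert (HSet X) ?T"]) simp
qed

lemma closed_in_HF_set: "closed T \<Longrightarrow> HSet T \<in> HF_set U"
  using closed_subset_codes codes_in_HF_set by auto

lemma codes_iff:
  assumes x: "x \<in> HF_set U"
  shows "x \<in> codes \<longleftrightarrow> (\<exists>T \<in> HF_set U. elt x T \<and> (\<forall>t \<in> HF_set U. elt t T \<longrightarrow>
    is_atom_code t \<or> \<not> is_ur t \<and> (\<forall>u \<in> HF_set U. elt u t \<longrightarrow> elt u T)))"
proof
  assume "x \<in> codes"
  then obtain T where T: "x |\<in>| T" "closed T" using codes_closed by blast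
  show "\<exists>T \<in> HF_set U. elt x T \<and> (\<forall>t \<in> HF_set U. elt t T \<longrightarrow>
      is_atom_code t \<or> \<not> is_ur t \<and> (\<forall>u \<in> HF_set U. elt u t \<longrightarrow> elt u T))"
    by (rule bexI[OF _ closed_in_HF_set[OF T(2)]]) (use T(1) closedD[OF T(2)] in fastforce)
next
  assume "\<exists>T \<in> HF_set U. elt x T \<and> (\<forall>t \<in> HF_set U. elt t T \<longrightarrow>
      is_atom_code t \<or> \<not> is_ur t \<and> (\<forall>u \<in> HF_set U. elt u t \<longrightarrow> elt u T))"
  then obtain T' where T': "T' \<in> HF_set U" "elt x T'"
    and cl: "\<And>t. t \<in> HF_set U \<Longrightarrow> elt t T' \<Longrightarrow>
      is_atom_code t \<or> \<not> is_ur t \<and> (\<forall>u \<in> HF_set U. elt u t \<longrightarrow> elt u T')"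
    by blast
  obtain T where T: "T' = HSet T" using T'(2) by (auto simp: elt_def)
  have "closed T"
    unfolding closed_def
  proof (intro allI impI)
    fix t assume t: "t |\<in>| T"
    then have tH: "t \<in> HF_set U" using T' T by auto
    show "is_atom_code t \<or> (\<exists>X. t = HSet X \<and> X |\<subseteq>| T)"
    proof (cases t)
      case (Ur a)
      then show ?thesis using cl[OF tH] t T by simp
    next
      case (HSet X)
      then have "fset X \<subseteq> HF_set U" using tH by simp
      then show ?thesis using cl[OF tH] t T HSet by (auto simp: subset_iff)
    qed
  qed
  then show "x \<in> codes" using T T' closed_subset_codes by auto
qed

lemma definable_codes: "i < k \<Longrightarrow> definable (HF B) q k (\<lambda>e. e i \<in> codes)"
proof (rule definable_subst1)
  have 1: "definable (HF B) q 1 (\<lambda>e. \<exists>T \<in> universe (HF B). elt (e 0) T \<and> (\<forall>t \<in> universe (HF B). elt t T \<longrightarrow>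
      is_atom_code t \<or> \<not> is_ur t \<and> (\<forall>u \<in> universe (HF B). elt u t \<longrightarrow> elt u T)))"
    by (intro definable_intros definable_is_atom_code) auto
  show "definable (HF B) q 1 (\<lambda>e. e 0 \<in> codes)"
    by (rule definable_cong[OF 1]) (simp add: codes_iff)
qed

section \<open>Equality of codes by bisimulation\<close>

definition atom_eq :: "'b hf \<Rightarrow> 'b hf \<Rightarrow> bool" where
  "atom_eq x y \<longleftrightarrow> (\<exists>b \<in> tuples n U. \<exists>b' \<in> tuples n U.
     (\<exists>c \<in> U. x = tup (c # b)) \<and> (\<exists>c \<in> U. y = tup (c # b')) \<and> sat B (b @ b' @ p) (eq_fm \<Gamma>))"

lemma atom_eq_iff:
  assumes "b \<in> D" "b' \<in> D" "c \<in> U" "c' \<in> U"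
  shows "atom_eq (tup (c # b)) (tup (c' # b')) \<longleftrightarrow> \<mu> b = \<mu> b'"
  using assms coord_mapD(4)[OF \<mu> assms(1,2)] D_tuples by (auto simp: atom_eq_def)

text \<open>\<open>atom_eq\<close> ranges over all tuples and not just over the domain, so that
  \<open>definable_atoms\<close> yields it directly; for atoms that are codes the tuples lie in the
  domain anyway.\<close>

lemma definable_atom_eq: "i < k \<Longrightarrow> j < k \<Longrightarrow> definable (HF B) q k (\<lambda>e. atom_eq (e i) (e j))"
proof (rule definable_subst2)
  have \<psi>: "wf_fm (lang B) (2 * n + length p) (eq_fm \<Gamma>)"
    using is_codeD(2)[OF coord_mapD(1)[OF \<mu>]] by (simp add: length_p)
  have "(\<exists>bs \<in> tuples 2 (tuples n U). (\<forall>i < 2. \<exists>c \<in> U. x i = tup (c # bs ! i)) \<and> sat B (concat bs @ p) (eq_fm \<Gamma>))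
      \<longleftrightarrow> atom_eq (x 0) (x 1)" for x :: "nat \<Rightarrow> 'b hf"
  proof -
    show ?thesis
      unfolding bex_tuples_2 by (auto simp: atom_eq_def numeral_2_eq_2 All_less_Suc)
  qed
  then show "definable (HF B) q 2 (\<lambda>e. atom_eq (e 0) (e 1))"
    using definable_atoms[OF B \<psi> p_in_U] by (simp only:)
qed

text \<open>Only one half of the back-and-forth condition is stated. The pairs are unordered, so the
  clause for \<open>v\<close> and \<open>u\<close> supplies the other half.\<close>

definition bisim :: "'b hf \<Rightarrow> bool" where
  "bisim R \<longleftrightarrow> (\<forall>u \<in> HF_set U. \<forall>v \<in> HF_set U. elt (upair u v) R \<longrightarrow>
     atom_eq u v \<or> \<not> is_ur u \<and> \<not> is_ur v \<and>
       (\<forall>u' \<in> HF_set U. elt u' u \<longrightarrow> (\<exists>v' \<in> HF_set U. elt v' v \<and> elt (upair u' v') R)))"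

text \<open>If the code of an atom were compared as a set, its member \<open>Ur c\<close> would need
  a partner in \<open>R\<close>. No pair with an urelement can be in a bisimulation, since
  urelements are neither codes of atoms nor sets.\<close>

lemma bisim_atom:
  assumes R: "bisim R" and uv: "u \<in> codes" "v \<in> codes" "elt (upair u v) R" and u: "u = tup (c # b)"
  shows "atom_eq u v"
proof (rule ccontr)
  assume neg: "\<not> atom_eq u v"
  have H: "u \<in> HF_set U" "v \<in> HF_set U" using uv codes_in_HF_set by auto
  then have "c \<in> U" by (simp add: u)
  moreover have "elt (Ur c) u" by (simp add: u upair_def tup.simps)
  ultimately obtain v' where v': "v' \<in> HF_set U" "elt (upair (Ur c) v') R"
    using R H uv(3) neg unfolding bisim_def by (metis Ur_in_HF_set)
  then have "atom_eq (Ur c) v' \<or> \<not> is_ur (Ur c)"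
    using R \<open>c \<in> U\<close> unfolding bisim_def by (metis Ur_in_HF_set)
  then show False by (auto simp: atom_eq_def)
qed

text \<open>Induction on codes: an atom is never related to a set, by \<open>bisim_atom\<close>, and
  two related sets have members with pairwise equal decodings.\<close>

lemma bisim_sound:
  assumes R: "bisim R"
  shows "u \<in> codes \<Longrightarrow> v \<in> codes \<Longrightarrow> elt (upair u v) R \<Longrightarrow> decode u = decode v"
proof (induction u arbitrary: v rule: codes.induct)
  case (atom b c)
  have "tup (c # b) \<in> codes" using atom by (simp only: tup_Cons_in_codes)
  from bisim_atom[OF R this atom.prems refl] obtain c' b' where
    v: "v = tup (c' # b')" by (auto simp: atom_eq_def)
  have "b' \<in> D" "c' \<in> U" using atom.prems(1) unfolding v tup_Cons_in_codes by auto
  then have "\<mu> b = \<mu> b'"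
    using bisim_atom[OF R \<open>tup (c # b) \<in> codes\<close> atom.prems refl] atom.hyps
    by (simp add: v atom_eq_iff)
  then show ?case by (simp only: v decode_atom)
next
  case (set X)
  have X: "fset X \<subseteq> codes" using set.hyps by auto
  then have u: "HSet X \<in> codes" by (auto intro: codes.set)
  have not_atom: "\<not> atom_eq (HSet X) v" "\<not> atom_eq v (HSet X)"
    using tup_Cons_neq_code_set[OF X] by (auto simp: atom_eq_def)
  \<comment> \<open>The same unordered pair read backwards, needed for the other half of the
    comparison.\<close>
  have sym: "elt (upair v (HSet X)) R" using set.prems(2) by (simp only: upair_commute)
  from set.prems(1) show ?case
  proof (cases rule: codes_cases)
    case (atom b c)
    then show ?thesis using bisim_atom[OF R set.prems(1) u sym atom(3)] not_atom by simp
  next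
    case (set Y)
    have H: "HSet X \<in> HF_set U" "HSet Y \<in> HF_set U"
      using codes_in_HF_set[OF u] codes_in_HF_set[OF set.prems(1)] by (simp_all only: set(1))
    have fwd: "\<exists>v'. v' |\<in>| Y \<and> elt (upair u' v') R" if "u' |\<in>| X" for u'
    proof -
      have "u' \<in> HF_set U" using that H by auto
      then show ?thesis
        using R H set.prems(2) not_atom that unfolding bisim_def set(1) by (metis elt_simps(1))
    qed
    have bwd: "\<exists>u'. u' |\<in>| X \<and> elt (upair u' v') R" if "v' |\<in>| Y" for v'
    proof -
      have "v' \<in> HF_set U" using that H by auto
      then show ?thesis
        using R H sym not_atom that upair_commute unfolding bisim_def set(1) by (metis elt_simps(1))
    qed
    have "decode |`| X = decode |`| Y"
      unfolding fset_inject[symmetric]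
    proof (intro equalityI subsetI)
      fix z assume "z \<in> fset (decode |`| X)"
      then obtain u' where u': "u' |\<in>| X" "z = decode u'" by auto
      then obtain v' where "v' |\<in>| Y" "elt (upair u' v') R" using fwd by blast
      then show "z \<in> fset (decode |`| Y)" using set.IH[OF u'(1), of v'] u' set(2) by auto
    next
      fix z assume "z \<in> fset (decode |`| Y)"
      then obtain v' where v': "v' |\<in>| Y" "z = decode v'" by auto
      then obtain u' where u': "u' |\<in>| X" "elt (upair u' v') R" using bwd by blast
      then have "decode u' = z" using set.IH[of u' v'] v' set(2) by auto
      then show "z \<in> fset (decode |`| X)" using u'(1) by auto
    qed
    then show ?thesis by (simp only: set(1) decode_set[OF X] decode_set[OF set(2)])
  qed
qed

text \<open>The bisimulation consists of all pairs with equal decoding from a finite closed set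
  \<open>T\<close> around \<open>x\<close> and \<open>y\<close>. Closedness keeps the members to be
  matched inside \<open>T\<close>, and finiteness makes the relation an element of HF(B).\<close>

lemma bisim_complete:
  assumes x: "x \<in> codes" and y: "y \<in> codes" and xy: "decode x = decode y"
  shows "\<exists>R \<in> HF_set U. elt (upair x y) R \<and> bisim R"
proof -
  obtain S S' where S: "x |\<in>| S" "closed S" "y |\<in>| S'" "closed S'"
    using codes_closed x y by metis
  define T where "T = S |\<union>| S'"
  have T: "closed T" "x |\<in>| T" "y |\<in>| T" using S closed_union by (auto simp: T_def)
  note TC = closed_subset_codes[OF T(1)]
  define R where "R = Abs_fset ((\<lambda>(u, v). upair u v) ` {(u, v) \<in> fset T \<times> fset T. decode u = decode v})"
  have "finite {(u, v) \<in> fset T \<times> fset T. decode u = decode v}"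
    by (rule finite_subset[of _ "fset T \<times> fset T"]) auto
  then have R: "fset R = (\<lambda>(u, v). upair u v) ` {(u, v) \<in> fset T \<times> fset T. decode u = decode v}"
    unfolding R_def by (intro Abs_fset_inverse) simp
  have elt_R: "elt (upair u v) (HSet R) \<longleftrightarrow> u |\<in>| T \<and> v |\<in>| T \<and> decode u = decode v" for u v
  proof
    assume "elt (upair u v) (HSet R)"
    then obtain u' v' where "upair u v = upair u' v'" "u' |\<in>| T" "v' |\<in>| T" "decode u' = decode v'"
      by (auto simp: R)
    then show "u |\<in>| T \<and> v |\<in>| T \<and> decode u = decode v" by (auto simp: upair_eq_iff)
  qed (auto simp: R)
  have "HSet R \<in> HF_set U"
    using TC codes_in_HF_set by (auto simp: R)
  moreover have "bisim (HSet R)"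
    unfolding bisim_def elt_R
  proof (intro ballI impI, elim conjE)
    fix u v assume u: "u |\<in>| T" and v: "v |\<in>| T" and uv: "decode u = decode v"
    show "atom_eq u v \<or> \<not> is_ur u \<and> \<not> is_ur v \<and>
       (\<forall>u' \<in> HF_set U. elt u' u \<longrightarrow> (\<exists>v' \<in> HF_set U. elt v' v \<and> u' |\<in>| T \<and> v' |\<in>| T \<and> decode u' = decode v'))"
    proof (cases "is_atom_code u")
      case True
      then have "is_atom_code v" using is_atom_code_iff TC u v uv by metis
      then obtain b c b' c' where *: "b \<in> D" "c \<in> U" "u = tup (c # b)" "b' \<in> D" "c' \<in> U" "v = tup (c' # b')"
        using True by (auto simp: is_atom_code_def)
      then have "\<mu> b = \<mu> b'" using uv by (simp add: decode_atom)
      then show ?thesis using * by (simp add: atom_eq_iff)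
    next
      case False
      then have "\<not> is_atom_code v" using is_atom_code_iff TC u v uv by metis
      with False obtain X Y where X: "u = HSet X" "X |\<subseteq>| T" and Y: "v = HSet Y" "Y |\<subseteq>| T"
        using T(1) u v unfolding closed_def by metis
      have sub: "fset X \<subseteq> codes" "fset Y \<subseteq> codes" using X Y TC by auto
      have "decode |`| X = decode |`| Y"
        using uv by (simp only: X Y decode_set[OF sub(1)] decode_set[OF sub(2)] hf.inject)
      then have "\<exists>v'. v' |\<in>| Y \<and> decode u' = decode v'" if "u' |\<in>| X" for u'
        using that by (metis fimageE fimage_eqI)
      then have "\<exists>v' \<in> HF_set U. v' |\<in>| Y \<and> u' |\<in>| T \<and> v' |\<in>| T \<and> decode u' = decode v'"
        if u': "u' |\<in>| X" for u'
      proof -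
        obtain v' where v': "v' |\<in>| Y" "decode u' = decode v'"
          using \<open>\<And>u'. u' |\<in>| X \<Longrightarrow> \<exists>v'. v' |\<in>| Y \<and> decode u' = decode v'\<close>[OF u'] by blast
        then have "v' \<in> HF_set U" using sub codes_in_HF_set by blast
        then show ?thesis using v' u' X Y by (auto simp: less_eq_fset.rep_eq)
      qed
      then show ?thesis by (simp add: X Y)
    qed
  qed
  moreover have "elt (upair x y) (HSet R)" unfolding elt_R using T xy by simp
  ultimately show ?thesis by blast
qed

lemma decode_eq_iff:
  assumes "x \<in> codes" "y \<in> codes"
  shows "decode x = decode y \<longleftrightarrow> (\<exists>R \<in> HF_set U. elt (upair x y) R \<and> bisim R)"
  using assms bisim_sound bisim_complete by metis

text \<open>The pair is introduced by a quantifier; this loses nothing, since members of elements of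
  the universe are in the universe.\<close>

lemma definable_elt_upair:
  assumes "i < k" "j < k" "l < k"
  shows "definable (HF B) q k (\<lambda>e. elt (upair (e i) (e j)) (e l))"
proof (rule definable_cong)
  show "definable (HF B) q k (\<lambda>e. \<exists>z \<in> universe (HF B). z = upair (e i) (e j) \<and> elt z (e l))"
    using assms by (intro definable_intros definable_upair) auto
  fix e :: "nat \<Rightarrow> 'b hf" assume e: "\<And>i. i < k \<Longrightarrow> e i \<in> universe (HF B)"
  show "(\<exists>z \<in> universe (HF B). z = upair (e i) (e j) \<and> elt z (e l)) \<longleftrightarrow> elt (upair (e i) (e j)) (e l)"
    using e[OF assms(3)] HF_set_elt[of "upair (e i) (e j)" "e l" U] by auto
qed

definition code_eq :: "'b hf \<Rightarrow> 'b hf \<Rightarrow> bool" where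
  "code_eq x y \<longleftrightarrow> (\<exists>R \<in> HF_set U. elt (upair x y) R \<and> bisim R)"

lemma definable_bisim: "i < k \<Longrightarrow> definable (HF B) q k (\<lambda>e. bisim (e i))"
  unfolding bisim_def universe_HF[symmetric]
  by (intro definable_all definable_imp definable_disj definable_conj definable_ex definable_not
      definable_elt definable_is_ur definable_elt_upair definable_atom_eq) simp_all

lemma definable_code_eq: "i < k \<Longrightarrow> j < k \<Longrightarrow> definable (HF B) q k (\<lambda>e. code_eq (e i) (e j))"
  unfolding code_eq_def universe_HF[symmetric]
  by (intro definable_ex definable_conj definable_elt_upair definable_bisim) simp_all

end

section \<open>The interpretation of HF(A) in HF(B)\<close>

context hf_coding
begin

text \<open>A tuple of codes decodes to urelements just if all its entries are atoms. The left-hand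
  side has the shape of the clauses of \<open>rel_HF\<close>.\<close>

lemma decode_atoms_iff:
  assumes xs: "xs \<in> tuples k codes"
  shows "(\<exists>zs. set zs \<subseteq> universe A \<and> map decode xs = map Ur zs \<and> P zs) \<longleftrightarrow>
    (\<exists>bs \<in> tuples k D. (\<forall>i < k. \<exists>c \<in> U. xs ! i = tup (c # bs ! i)) \<and> P (map \<mu> bs))"
proof
  assume "\<exists>zs. set zs \<subseteq> universe A \<and> map decode xs = map Ur zs \<and> P zs"
  then obtain zs where zs: "map decode xs = map Ur zs" "P zs" by blast
  have len: "length xs = k" "length zs = k"
    using tuplesD[OF xs] map_eq_imp_length_eq[OF zs(1)] by simp_all
  have "\<exists>b. b \<in> D \<and> (\<exists>c \<in> U. xs ! i = tup (c # b)) \<and> \<mu> b = zs ! i" if i: "i < k" for i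
  proof -
    have dec: "decode (xs ! i) = Ur (zs ! i)" using zs(1) i len by (metis nth_map)
    then have "is_atom_code (xs ! i)" using is_atom_code_iff[OF tuples_nth[OF xs i]] by blast
    then show ?thesis using dec by (auto simp: is_atom_code_def decode_atom)
  qed
  then obtain g where g: "\<And>i. i < k \<Longrightarrow> g i \<in> D \<and> (\<exists>c \<in> U. xs ! i = tup (c # g i)) \<and> \<mu> (g i) = zs ! i"
    by metis
  have "map \<mu> (map g [0..<k]) = zs"
    using g len by (intro nth_equalityI) auto
  then show "\<exists>bs \<in> tuples k D. (\<forall>i < k. \<exists>c \<in> U. xs ! i = tup (c # bs ! i)) \<and> P (map \<mu> bs)"
    using g zs(2) by (intro bexI[of _ "map g [0..<k]"]) (auto simp: tuples_def)
next
  assume "\<exists>bs \<in> tuples k D. (\<forall>i < k. \<exists>c \<in> U. xs ! i = tup (c # bs ! i)) \<and> P (map \<mu> bs)"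
  then obtain bs where bs: "bs \<in> tuples k D" "\<forall>i < k. \<exists>c \<in> U. xs ! i = tup (c # bs ! i)" "P (map \<mu> bs)"
    by blast
  have "map decode xs = map Ur (map \<mu> bs)"
    using tuplesD[OF xs] tuplesD[OF bs(1)] bs(2) by (intro nth_equalityI) (auto simp: decode_atom)
  moreover have "set (map \<mu> bs) \<subseteq> universe A"
    using bs(1) coord_mapD(3)[OF \<mu>] by (auto simp: tuples_def)
  ultimately show "\<exists>zs. set zs \<subseteq> universe A \<and> map decode xs = map Ur zs \<and> P zs"
    using bs(3) by blast
qed

text \<open>Atoms that are codes carry tuples from the domain, so the wider range of quantification
  in \<open>definable_atoms\<close> does no harm.\<close>

lemma atoms_in_D:
  assumes xs: "xs \<in> tuples k codes"
  shows "(\<exists>bs \<in> tuples k (tuples n U). (\<forall>i < k. \<exists>c \<in> U. xs ! i = tup (c # bs ! i)) \<and> P bs) \<longleftrightarrow>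
    (\<exists>bs \<in> tuples k D. (\<forall>i < k. \<exists>c \<in> U. xs ! i = tup (c # bs ! i)) \<and> P bs)"
proof -
  have "bs \<in> tuples k D" if bs: "bs \<in> tuples k (tuples n U)" "\<forall>i < k. \<exists>c \<in> U. xs ! i = tup (c # bs ! i)" for bs
  proof -
    have "bs ! i \<in> D" if "i < k" for i
      using tuples_nth[OF xs that] bs(2) that tup_Cons_in_codes by metis
    then show ?thesis using tuplesD[OF bs(1)] by (auto simp: tuples_def in_set_conv_nth)
  qed
  then show ?thesis using tuples_code_dom by blast
qed

lemma definable_rel:
  assumes r: "r < length (rels (HF_lang (lang A)))"
  shows "\<exists>\<phi>. wf_fm (HF_lang (lang B)) (rels (HF_lang (lang A)) ! r + npars \<Gamma>) \<phi> \<and>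
    (\<forall>xs \<in> tuples (rels (HF_lang (lang A)) ! r) codes.
       sat (HF B) (xs @ q) \<phi> \<longleftrightarrow> rel (HF A) r (map decode xs))"
proof -
  let ?k = "rels (HF_lang (lang A)) ! r" and ?nf = "length (funs (lang A))" and ?nr = "length (rels (lang A))"
  let ?R = "\<lambda>k \<psi> e. \<exists>bs \<in> tuples k (tuples n U). (\<forall>i < k. \<exists>c \<in> U. e i = tup (c # bs ! i)) \<and> sat B (concat bs @ p) \<psi>"
  have "\<exists>R. definable (HF B) q ?k R \<and> (\<forall>xs \<in> tuples ?k codes. R ((!) xs) \<longleftrightarrow> rel (HF A) r (map decode xs))"
  proof -
    \<comment> \<open>The cases follow the order of the symbols in \<open>HF_lang\<close>: graphs of
      functions, relations, the base set, membership.\<close>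
    consider "r < ?nf" | r' where "r' < ?nr" "r = ?nf + r'" | "r = ?nf + ?nr" | "r = Suc (?nf + ?nr)"
      using r unfolding rels_HF_lang by (metis add_2_eq_Suc' add_less_cancel_left le_iff_add less_SucE not_less)
    then show ?thesis
    proof cases
      case 1
      have k: "?k = Suc (funs (lang A) ! r)" using 1 by (simp add: rels_HF_lang)
      have wf: "wf_fm (lang B) (?k * n + length p) (fun_fm \<Gamma> r)"
        using is_codeD(3)[OF coord_mapD(1)[OF \<mu>] 1] by (simp add: k length_p)
      have "?R ?k (fun_fm \<Gamma> r) ((!) xs) \<longleftrightarrow> rel (HF A) r (map decode xs)" if xs: "xs \<in> tuples ?k codes" for xs
      proof -
        have split: "sat B (concat bs @ p) (fun_fm \<Gamma> r) \<longleftrightarrow>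
            (\<exists>as a. map \<mu> bs = as @ [a] \<and> fn A r as = a)" if bs: "bs \<in> tuples ?k D" for bs
        proof -
          obtain cs c where cs: "bs = cs @ [c]" "cs \<in> tuples (funs (lang A) ! r) D" "c \<in> D"
            using bs unfolding k
            by (cases bs rule: rev_cases) (auto simp: tuples_def)
          then show ?thesis using coord_mapD(5)[OF \<mu> 1 cs(2,3)] by auto
        qed
        have "?R ?k (fun_fm \<Gamma> r) ((!) xs) \<longleftrightarrow> (\<exists>bs \<in> tuples ?k D.
            (\<forall>i < ?k. \<exists>c \<in> U. xs ! i = tup (c # bs ! i)) \<and> (\<exists>as a. map \<mu> bs = as @ [a] \<and> fn A r as = a))"
          unfolding atoms_in_D[OF xs] by (rule bex_cong[OF refl]) (simp add: split)
        also have "\<dots> \<longleftrightarrow> (\<exists>zs. set zs \<subseteq> universe A \<and> map decode xs = map Ur zs \<and>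
            (\<exists>as a. zs = as @ [a] \<and> fn A r as = a))"
          by (rule decode_atoms_iff[OF xs, symmetric])
        also have "\<dots> \<longleftrightarrow> (\<exists>as a. set (as @ [a]) \<subseteq> universe A \<and> map decode xs = map Ur (as @ [a]) \<and> fn A r as = a)"
          by blast
        finally show ?thesis by (simp only: rel_HF(1)[OF 1])
      qed
      then show ?thesis using definable_atoms[OF B wf p_in_U] by blast
    next
      case (2 r')
      have k: "?k = rels (lang A) ! r'" using 2 by (simp add: rels_HF_lang)
      have wf: "wf_fm (lang B) (?k * n + length p) (rel_fm \<Gamma> r')"
        using is_codeD(4)[OF coord_mapD(1)[OF \<mu>] 2(1)] by (simp add: k length_p)
      have "?R ?k (rel_fm \<Gamma> r') ((!) xs) \<longleftrightarrow> rel (HF A) r (map decode xs)" if xs: "xs \<in> tuples ?k codes" for xs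
      proof -
        have "?R ?k (rel_fm \<Gamma> r') ((!) xs) \<longleftrightarrow> (\<exists>bs \<in> tuples ?k D.
            (\<forall>i < ?k. \<exists>c \<in> U. xs ! i = tup (c # bs ! i)) \<and> rel A r' (map \<mu> bs))"
          unfolding atoms_in_D[OF xs]
          by (rule bex_cong[OF refl]) (simp add: coord_mapD(6)[OF \<mu> 2(1)] k)
        also have "\<dots> \<longleftrightarrow> (\<exists>zs. set zs \<subseteq> universe A \<and> map decode xs = map Ur zs \<and> rel A r' zs)"
          by (rule decode_atoms_iff[OF xs, symmetric])
        finally show ?thesis by (simp only: rel_HF(2)[OF 2(1)] 2(2))
      qed
      then show ?thesis using definable_atoms[OF B wf p_in_U] by blast
    next
      case 3
      have k: "?k = 1" using 3 by (simp add: rels_HF_lang)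
      have "is_atom_code (xs ! 0) \<longleftrightarrow> rel (HF A) r (map decode xs)" if xs: "xs \<in> tuples 1 codes" for xs
      proof -
        obtain x where x: "xs = [x]" "x \<in> codes" using xs by (auto simp: tuples_def length_Suc_conv)
        then have "decode x \<in> HF_set (universe A)" using decode_image by blast
        then show ?thesis using is_atom_code_iff[OF x(2)] by (auto simp: x(1) 3 rel_HF)
      qed
      then show ?thesis
        using definable_is_atom_code[of 0 1] unfolding k by (intro exI[of _ "\<lambda>e. is_atom_code (e 0)"]) simp
    next
      case 4
      have k: "?k = 2" using 4 by (simp add: rels_HF_lang)
      \<comment> \<open>Codes are not unique, so some member of the set has to equal the given code
        in the sense of \<open>code_eq\<close>. Codes of atoms are sets too and must be excluded
        first.\<close>
      let ?S = "\<lambda>e. \<not> is_atom_code (e 1) \<and> (\<exists>x \<in> universe (HF B). elt x (e 1) \<and> code_eq x (e 0))"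
      have "?S ((!) xs) \<longleftrightarrow> rel (HF A) r (map decode xs)" if xs: "xs \<in> tuples 2 codes" for xs
      proof -
        obtain x y where x: "xs = [x, y]" "x \<in> codes" "y \<in> codes"
          using xs by (auto simp: tuples_def length_Suc_conv numeral_2_eq_2)
        have "?S ((!) xs) \<longleftrightarrow> (\<exists>s. decode y = HSet s \<and> decode x |\<in>| s)"
          using x(3)
        proof (cases rule: codes_cases)
          case (atom b c)
          then show ?thesis by (auto simp: x(1) is_atom_code_def decode_atom)
        next
          case (set X)
          have "x' \<in> HF_set U" if "x' |\<in>| X" for x' using that set(2) codes_in_HF_set by blast
          then have "?S ((!) xs) \<longleftrightarrow> (\<exists>x'. x' |\<in>| X \<and> code_eq x' x)"
            using tup_Cons_neq_code_set[OF set(2)] by (auto simp: x(1) set(1) is_atom_code_def)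
          also have "\<dots> \<longleftrightarrow> (\<exists>x'. x' |\<in>| X \<and> decode x' = decode x)"
            unfolding code_eq_def using decode_eq_iff set(2) x(2) by blast
          also have "\<dots> \<longleftrightarrow> decode x |\<in>| decode |`| X"
            by (metis fimageE fimage_eqI)
          also have "\<dots> \<longleftrightarrow> (\<exists>s. decode y = HSet s \<and> decode x |\<in>| s)"
            by (simp add: set(1) decode_set[OF set(2)])
          finally show ?thesis .
        qed
        also have "\<dots> \<longleftrightarrow> rel (HF A) r (map decode xs)" by (simp add: 4 rel_HF x(1))
        finally show ?thesis .
      qed
      moreover have "definable (HF B) q 2 ?S"
        by (intro definable_conj definable_not definable_ex definable_is_atom_code definable_elt
            definable_code_eq) simp_all
      ultimately show ?thesis unfolding k by blast
    qed
  qed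
  then obtain R where R: "definable (HF B) q ?k R" "\<forall>xs \<in> tuples ?k codes. R ((!) xs) \<longleftrightarrow> rel (HF A) r (map decode xs)"
    by blast
  have "xs \<in> tuples ?k (universe (HF B))" if "xs \<in> tuples ?k codes" for xs
    using that codes_in_HF_set by (auto simp: tuples_def)
  then show ?thesis
    using R unfolding definable_def lang_HF length_map length_p by metis
qed

lemma definable_formulaE:
  assumes "definable (HF B) q k R"
  obtains \<phi> where "wf_fm (HF_lang (lang B)) (k + npars \<Gamma>) \<phi>"
    "\<And>e. e \<in> tuples k (HF_set U) \<Longrightarrow> sat (HF B) (e @ q) \<phi> \<longleftrightarrow> R ((!) e)"
  using assms unfolding definable_def lang_HF length_map length_p universe_HF by blast

theorem ex_coord_map_HF:
  "\<exists>\<Omega>. dim \<Omega> = 1 \<and> npars \<Omega> = npars \<Gamma> \<and> code_dom \<Omega> (HF B) q = (\<lambda>x. [x]) ` codes \<and>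
    coord_map \<Omega> (HF B) q (HF A) (\<lambda>c. decode (hd c))"
proof -
  obtain \<delta> where \<delta>: "wf_fm (HF_lang (lang B)) (1 + npars \<Gamma>) \<delta>"
    "\<And>e. e \<in> tuples 1 (HF_set U) \<Longrightarrow> sat (HF B) (e @ q) \<delta> \<longleftrightarrow> e ! 0 \<in> codes"
    by (rule definable_formulaE[OF definable_codes[of 0 1]]) simp_all
  obtain \<epsilon> where \<epsilon>: "wf_fm (HF_lang (lang B)) (2 + npars \<Gamma>) \<epsilon>"
    "\<And>e. e \<in> tuples 2 (HF_set U) \<Longrightarrow> sat (HF B) (e @ q) \<epsilon> \<longleftrightarrow> code_eq (e ! 0) (e ! 1)"
    by (rule definable_formulaE[OF definable_code_eq[of 0 2 1]]) simp_all
  obtain \<rho> where \<rho>: "\<And>r. r < length (rels (HF_lang (lang A))) \<Longrightarrow>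
      wf_fm (HF_lang (lang B)) (rels (HF_lang (lang A)) ! r + npars \<Gamma>) (\<rho> r)"
    "\<And>r xs. r < length (rels (HF_lang (lang A))) \<Longrightarrow> xs \<in> tuples (rels (HF_lang (lang A)) ! r) codes \<Longrightarrow>
       sat (HF B) (xs @ q) (\<rho> r) \<longleftrightarrow> rel (HF A) r (map decode xs)"
    using definable_rel by metis
  define \<Omega> where "\<Omega> = \<lparr>dim = 1, npars = npars \<Gamma>, dom_fm = \<delta>, eq_fm = \<epsilon>, fun_fm = (\<lambda>_. \<delta>), rel_fm = \<rho>\<rparr>"
  have \<Omega>: "dim \<Omega> = 1" "npars \<Omega> = npars \<Gamma>" "dom_fm \<Omega> = \<delta>" "eq_fm \<Omega> = \<epsilon>" "rel_fm \<Omega> = \<rho>"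
    by (simp_all add: \<Omega>_def)
  have dom: "code_dom \<Omega> (HF B) q = (\<lambda>x. [x]) ` codes"
  proof (intro equalityI subsetI)
    fix l assume "l \<in> code_dom \<Omega> (HF B) q"
    then have l: "l \<in> tuples 1 (HF_set U)" "sat (HF B) (l @ q) \<delta>" by (auto simp: code_dom_def \<Omega>)
    then obtain x where "l = [x]" by (auto simp: tuples_def length_Suc_conv)
    then show "l \<in> (\<lambda>x. [x]) ` codes" using \<delta>(2)[OF l(1)] l(2) by simp
  next
    fix l assume "l \<in> (\<lambda>x. [x]) ` codes"
    then obtain x where x: "l = [x]" "x \<in> codes" by blast
    then have "l \<in> tuples 1 (HF_set U)" using codes_in_HF_set by (simp add: tuples_def)
    then show "l \<in> code_dom \<Omega> (HF B) q" using \<delta>(2)[of l] x by (simp add: code_dom_def \<Omega>)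
  qed
  have code: "is_code (HF_lang (lang A)) (HF_lang (lang B)) \<Omega>"
    using \<delta>(1) \<epsilon>(1) \<rho>(1) by (simp add: is_code_def \<Omega>)
  have q: "q \<in> tuples (npars \<Gamma>) (HF_set U)"
    using p_in_U length_p by (auto simp: tuples_def)
  have img: "(\<lambda>c. decode (hd c)) ` (\<lambda>x. [x]) ` codes = HF_set (universe A)"
    unfolding decode_image[symmetric] image_image by simp
  have eq: "sat (HF B) (b @ c @ q) \<epsilon> \<longleftrightarrow> decode (hd b) = decode (hd c)"
    if bc: "b \<in> (\<lambda>x. [x]) ` codes" "c \<in> (\<lambda>x. [x]) ` codes" for b c
  proof -
    obtain x y where x: "b = [x]" "c = [y]" "x \<in> codes" "y \<in> codes" using bc by blast
    then have "[x, y] \<in> tuples 2 (HF_set U)" using codes_in_HF_set by (simp add: tuples_def)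
    then show ?thesis using \<epsilon>(2)[of "[x, y]"] x decode_eq_iff[OF x(3,4)] by (simp add: code_eq_def)
  qed
  have rel: "sat (HF B) (concat bs @ q) (\<rho> r) \<longleftrightarrow> rel (HF A) r (map (\<lambda>c. decode (hd c)) bs)"
    if r: "r < length (rels (HF_lang (lang A)))" and bs: "bs \<in> tuples (rels (HF_lang (lang A)) ! r) ((\<lambda>x. [x]) ` codes)"
    for r bs
  proof -
    obtain xs where xs: "xs \<in> tuples (rels (HF_lang (lang A)) ! r) codes" "map (\<lambda>x. [x]) xs = bs"
      by (rule tuples_image_liftE[OF bs])
    have "concat (map (\<lambda>x. [x]) xs) = xs" by (induction xs) auto
    then show ?thesis using \<rho>(2)[OF r xs(1)] by (simp add: xs(2)[symmetric] comp_def)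
  qed
  have "coord_map \<Omega> (HF B) q (HF A) (\<lambda>c. decode (hd c))"
    unfolding coord_map_def dom lang_HF universe_HF \<Omega> funs_HF_lang
    using code q img eq rel by simp
  then show ?thesis using dom \<Omega> by blast
qed

end

section \<open>Passing from one structure to the other\<close>

text \<open>Recursion on the number of conjuncts, unlike a fold over a list of formulas, matches
  \<open>rec_nat\<close>; the code of the result is then computable with this number as an
  input.\<close>

primrec conjs :: "(nat \<Rightarrow> fm) \<Rightarrow> nat \<Rightarrow> fm \<Rightarrow> fm" where
  "conjs P 0 \<phi> = \<phi>"
| "conjs P (Suc i) \<phi> = Conj (P i) (conjs P i \<phi>)"

lemma sat_conjs: "sat A e (conjs P k \<phi>) \<longleftrightarrow> (\<forall>i < k. sat A e (P i)) \<and> sat A e \<phi>"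
  by (induction k) (auto simp: less_Suc_eq)

lemma wf_conjs: "wf_fm L n (conjs P k \<phi>) \<longleftrightarrow> (\<forall>i < k. wf_fm L n (P i)) \<and> wf_fm L n \<phi>"
  by (induction k) (auto simp: less_Suc_eq)

lemma wf_tm_mono: "wf_tm L n t \<Longrightarrow> n \<le> m \<Longrightarrow> wf_tm L m t"
  by (induction t) auto

lemma wf_mono: "wf_fm L n \<phi> \<Longrightarrow> n \<le> m \<Longrightarrow> wf_fm L m \<phi>"
  by (induction \<phi> arbitrary: n m) (auto intro: wf_tm_mono)

text \<open>\<open>cover d l c r \<chi> n M \<psi>\<close> has as free variables \<open>n\<close> blocks of length \<open>l\<close> and \<open>M\<close> parameters.
  It asserts that there are \<open>n\<close> blocks of length \<open>d\<close> which are related by \<open>\<chi>\<close> to the given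
  ones and satisfy \<open>\<psi>\<close>. Of the parameters, \<open>\<chi>\<close> sees only the first \<open>c\<close> and the last \<open>r - c\<close>.
  The parameters are copied by a quantifier so that \<open>\<psi>\<close> need not be renamed.\<close>

definition cover_index :: "nat \<Rightarrow> nat \<Rightarrow> nat \<Rightarrow> nat \<Rightarrow> nat \<Rightarrow> nat \<Rightarrow> nat \<Rightarrow> nat \<Rightarrow> nat" where
  "cover_index d l c r n M i j =
    (if j < d then i * d + j
     else if j < d + l then n * d + M + (i * l + (j - d))
     else if j < d + l + c then n * d + (j - (d + l))
     else n * d + (M - r + (j - (d + l))))"

definition cover :: "nat \<Rightarrow> nat \<Rightarrow> nat \<Rightarrow> nat \<Rightarrow> fm \<Rightarrow> nat \<Rightarrow> nat \<Rightarrow> fm \<Rightarrow> fm" where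
  "cover d l c r \<chi> n M \<psi> = (Ex ^^ (n * d + M))
    (conjs (\<lambda>i. Eq (Var (n * d + i)) (Var (n * d + M + (n * l + i)))) M
      (conjs (\<lambda>i. rename (cover_index d l c r n M i) \<chi>) n \<psi>))"

lemma wf_cover:
  assumes \<chi>: "wf_fm L (d + l + r) \<chi>" and \<psi>: "wf_fm L (n * d + M) \<psi>" and le: "c \<le> r" "r \<le> M"
  shows "wf_fm L (n * l + M) (cover d l c r \<chi> n M \<psi>)"
proof -
  let ?N = "n * d + M + (n * l + M)"
  have "wf_fm L ?N (rename (cover_index d l c r n M i) \<chi>)" if i: "i < n" for i
  proof (rule wf_rename[OF \<chi>])
    fix j assume j: "j < d + l + r"
    consider "j < d" | "d \<le> j" "j < d + l" | "d + l \<le> j" by linarith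
    then show "cover_index d l c r n M i j < ?N"
    proof cases
      case 1
      then show ?thesis using block_index_less[OF i 1] by (simp add: cover_index_def)
    next
      case 2
      then have "j - d < l" by linarith
      then show ?thesis using block_index_less[OF i, of "j - d" l] 2 by (simp add: cover_index_def)
    next
      case 3
      then obtain j' M' where "j = d + l + j'" "M = r + M'" using le by (metis le_iff_add)
      then show ?thesis using j le by (simp add: cover_index_def)
    qed
  qed
  moreover have "wf_fm L ?N \<psi>" by (rule wf_mono[OF \<psi>]) simp
  ultimately show ?thesis by (simp add: cover_def wf_Ex_pow wf_conjs)
qed

lemma sat_cover:
  assumes \<chi>: "wf_fm L (d + l + r) \<chi>" and \<psi>: "wf_fm L (n * d + M) \<psi>" and le: "c \<le> r" "r \<le> M"
    and as: "as \<in> tuples n (tuples l X)" and P: "P \<in> tuples M (universe S)"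
  shows "sat S (concat as @ P) (cover d l c r \<chi> n M \<psi>) \<longleftrightarrow>
    (\<exists>us \<in> tuples n (tuples d (universe S)).
      (\<forall>i < n. sat S (us ! i @ as ! i @ take c P @ drop (M - (r - c)) P) \<chi>) \<and> sat S (concat us @ P) \<psi>)"
proof -
  let ?U = "universe S"
  let ?body = "conjs (\<lambda>i. Eq (Var (n * d + i)) (Var (n * d + M + (n * l + i)))) M
      (conjs (\<lambda>i. rename (cover_index d l c r n M i) \<chi>) n \<psi>)"
  have lP: "length P = M" and la: "length (concat as) = n * l"
    using tuplesD[OF P] length_concat_tuples[OF as] by simp_all
  \<comment> \<open>The \<open>M\<close> equations force the quantified copy \<open>P'\<close> to be
    \<open>P\<close>, so that \<open>\<psi>\<close> finds the parameters directly behind its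
    blocks.\<close>
  have body: "sat S ((concat us @ P') @ concat as @ P) ?body \<longleftrightarrow> P' = P \<and>
      (\<forall>i < n. sat S (us ! i @ as ! i @ take c P @ drop (M - (r - c)) P) \<chi>) \<and> sat S (concat us @ P) \<psi>"
    if us: "us \<in> tuples n (tuples d ?U)" and P': "P' \<in> tuples M ?U" for us P'
  proof -
    have lu: "length (concat us) = n * d" and lP': "length P' = M"
      using length_concat_tuples[OF us] tuplesD[OF P'] by simp_all
    let ?e = "(concat us @ P') @ concat as @ P"
    have 1: "(\<forall>i < M. sat S ?e (Eq (Var (n * d + i)) (Var (n * d + M + (n * l + i))))) \<longleftrightarrow> P' = P"
      by (auto simp: lu lP' la lP nth_append list_eq_iff_nth_eq)
    have 2: "sat S ?e (rename (cover_index d l c r n M i) \<chi>) \<longleftrightarrow>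
        sat S (us ! i @ as ! i @ take c P @ drop (M - (r - c)) P) \<chi>" if eq: "P' = P" and i: "i < n" for i
    proof (rule sat_rename[OF \<chi>])
      fix j assume j: "j < d + l + r"
      have lb: "length (us ! i) = d" "length (as ! i) = l"
        using tuplesD[OF tuples_nth[OF us i]] tuplesD[OF tuples_nth[OF as i]] by simp_all
      \<comment> \<open>A variable of \<open>\<chi>\<close> belongs to the new block, to the given
        block, or to one of the two visible stretches of parameters.\<close>
      consider "j < d" | j' where "j = d + j'" "j' < l" | j' where "j = d + l + j'" "j' < c"
        | j' where "j = d + l + c + j'"
        by (metis le_iff_add add_less_cancel_left not_less)
      then show "(us ! i @ as ! i @ take c P @ drop (M - (r - c)) P) ! j =
          ?e ! cover_index d l c r n M i j"
      proof cases
        case 1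
        then show ?thesis
          using block_index_less[OF i 1] nth_concat_blocks[OF us i 1] lb lu
          by (simp add: cover_index_def nth_append)
      next
        case (2 j')
        then show ?thesis
          using block_index_less[OF i 2(2)] nth_concat_blocks[OF as i 2(2)] lb lu la lP' lP
          by (simp add: cover_index_def nth_append)
      next
        case (3 j')
        then show ?thesis using lb lu la lP le eq by (simp add: cover_index_def nth_append)
      next
        case (4 j')
        obtain r' M' where "r = c + r'" "M = c + r' + M'" using le by (metis le_iff_add)
        moreover from this have "j' < r'" using j 4 by linarith
        ultimately show ?thesis using 4 lb lu la lP eq
          by (simp add: cover_index_def nth_append add.assoc add.left_commute[of M' c])
      qed
    qed
    have 3: "sat S ?e \<psi> \<longleftrightarrow> sat S (concat us @ P') \<psi>"
      by (rule sat_append[OF \<psi>]) (simp add: lu lP')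
    show ?thesis unfolding sat_conjs 1 3 using 2 by auto
  qed
  show ?thesis
  proof
    assume "sat S (concat as @ P) (cover d l c r \<chi> n M \<psi>)"
    then obtain bs where bs: "bs \<in> tuples (n * d + M) ?U" "sat S (bs @ concat as @ P) ?body"
      unfolding cover_def sat_Ex_pow by blast
    obtain u P' where u: "bs = u @ P'" "u \<in> tuples (n * d) ?U" "P' \<in> tuples M ?U"
      by (rule tuples_splitE[OF bs(1)])
    obtain us where us: "us \<in> tuples n (tuples d ?U)" "concat us = u"
      by (rule concat_tuplesE[OF u(2)])
    show "\<exists>us \<in> tuples n (tuples d ?U).
        (\<forall>i < n. sat S (us ! i @ as ! i @ take c P @ drop (M - (r - c)) P) \<chi>) \<and> sat S (concat us @ P) \<psi>"
      by (rule bexI[OF _ us(1)]) (use body[OF us(1) u(3)] bs(2) u(1) us(2) in simp)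
  next
    assume "\<exists>us \<in> tuples n (tuples d ?U).
        (\<forall>i < n. sat S (us ! i @ as ! i @ take c P @ drop (M - (r - c)) P) \<chi>) \<and> sat S (concat us @ P) \<psi>"
    then obtain us where us: "us \<in> tuples n (tuples d ?U)"
      and *: "(\<forall>i < n. sat S (us ! i @ as ! i @ take c P @ drop (M - (r - c)) P) \<chi>) \<and> sat S (concat us @ P) \<psi>"
      by blast
    show "sat S (concat as @ P) (cover d l c r \<chi> n M \<psi>)"
      unfolding cover_def sat_Ex_pow
      by (rule bexI[OF _ tuples_append[OF concat_tuples[OF us] P]]) (use body[OF us P] * in simp)
  qed
qed

lemma concat_concat: "concat (concat xss) = concat (map concat xss)"
  by (induction xss) auto

section \<open>The composed interpretation\<close>

lemma compose_simps:
  "dim (compose L \<Gamma> \<Delta>) = dim \<Gamma> * dim \<Delta>"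
  "npars (compose L \<Gamma> \<Delta>) = npars \<Gamma> * dim \<Delta> + npars \<Delta>"
  "dom_fm (compose L \<Gamma> \<Delta>) =
    in_dom \<Delta> (dim \<Gamma> + npars \<Gamma>) (dim \<Gamma>) (tr_fm \<Delta> (dim \<Gamma> + npars \<Gamma>) (dom_fm \<Gamma>))"
  "eq_fm (compose L \<Gamma> \<Delta>) = tr_fm \<Delta> (2 * dim \<Gamma> + npars \<Gamma>) (eq_fm \<Gamma>)"
  "fun_fm (compose L \<Gamma> \<Delta>) f = tr_fm \<Delta> (Suc (funs L ! f) * dim \<Gamma> + npars \<Gamma>) (fun_fm \<Gamma> f)"
  "rel_fm (compose L \<Gamma> \<Delta>) r = tr_fm \<Delta> (rels L ! r * dim \<Gamma> + npars \<Gamma>) (rel_fm \<Gamma> r)"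
  by (simp_all add: compose_def Let_def)

locale composed =
  fixes \<Gamma> \<Delta> :: interp_code and A :: "'a struct" and q :: "'a list" and B :: "'b struct" and p :: "'b list"
    and \<gamma> :: "'b list \<Rightarrow> 'a" and \<delta> :: "'a list \<Rightarrow> 'b" and ps :: "'a list list" and \<mu> :: "'a list \<Rightarrow> 'a"
  assumes \<gamma>: "coord_map \<Gamma> B p A \<gamma>" and \<delta>: "coord_map \<Delta> A q B \<delta>"
    and ps: "set ps \<subseteq> code_dom \<Delta> A q" "map \<delta> ps = p"
    and \<mu>: "coord_map (compose (lang A) \<Gamma> \<Delta>) A (concat ps @ q) A \<mu>"
    and A: "is_struct A" and B: "is_struct B"
begin

abbreviation "C \<equiv> compose (lang A) \<Gamma> \<Delta>"
abbreviation "P \<equiv> concat ps @ q"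
abbreviation "D \<equiv> code_dom \<Delta> A q"
abbreviation "E \<equiv> code_dom \<Gamma> B p"

lemma ps_tuples: "ps \<in> tuples (npars \<Gamma>) D"
  using ps coord_mapD(2)[OF \<gamma>] by (auto simp: tuples_def)

lemma sat_translated:
  assumes "wf_fm (lang B) (k + npars \<Gamma>) \<phi>" "cs \<in> tuples k D"
  shows "sat A (concat cs @ P) (tr_fm \<Delta> (k + npars \<Gamma>) \<phi>) \<longleftrightarrow> sat B (map \<delta> cs @ p) \<phi>"
  using sat_tr_fm[OF \<delta> B assms(1) tuples_append[OF assms(2) ps_tuples]] ps(2) by simp

text \<open>The translated domain formula is meaningful only for blocks in the domain of
  \<open>\<Delta>\<close>; the \<open>in_dom\<close> in \<open>compose\<close> supplies this
  condition.\<close>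

lemma code_dom_compose:
  assumes cs: "cs \<in> tuples (dim \<Gamma>) (tuples (dim \<Delta>) (universe A))"
  shows "concat cs \<in> code_dom C A P \<longleftrightarrow> cs \<in> tuples (dim \<Gamma>) D \<and> map \<delta> cs \<in> E"
proof -
  have code: "is_code (lang B) (lang A) \<Delta>" by (rule coord_mapD(1)[OF \<delta>])
  have "cs @ ps \<in> tuples (dim \<Gamma> + npars \<Gamma>) (tuples (dim \<Delta>) (universe A))"
    by (rule tuples_append[OF cs tuples_code_dom[OF ps_tuples]])
  from sat_in_dom[OF code this, of "dim \<Gamma>" q]
  have "sat A (concat cs @ P) (dom_fm C) \<longleftrightarrow> cs \<in> tuples (dim \<Gamma>) D \<and>
      sat A (concat cs @ P) (tr_fm \<Delta> (dim \<Gamma> + npars \<Gamma>) (dom_fm \<Gamma>))"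
    using tuplesD[OF cs] by (auto simp: compose_simps nth_append tuples_def in_set_conv_nth subset_iff)
  also have "\<dots> \<longleftrightarrow> cs \<in> tuples (dim \<Gamma>) D \<and> sat B (map \<delta> cs @ p) (dom_fm \<Gamma>)"
    using sat_translated[of "dim \<Gamma>" "dom_fm \<Gamma>" cs] is_codeD(1)[OF coord_mapD(1)[OF \<gamma>]] by auto
  finally have "sat A (concat cs @ P) (dom_fm C) \<longleftrightarrow> cs \<in> tuples (dim \<Gamma>) D \<and> sat B (map \<delta> cs @ p) (dom_fm \<Gamma>)" .
  moreover have "map \<delta> cs \<in> tuples (dim \<Gamma>) (universe B)" if "cs \<in> tuples (dim \<Gamma>) D"
    by (rule map_image_tuples[OF that \<mu>_in_universe[OF \<delta> B]])
  ultimately show ?thesis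
    using concat_tuples[OF cs] by (auto simp: code_dom_def compose_simps)
qed

lemma code_dom_composeE:
  assumes "u \<in> code_dom C A P"
  obtains cs where "cs \<in> tuples (dim \<Gamma>) D" "map \<delta> cs \<in> E" "u = concat cs"
proof -
  have "u \<in> tuples (dim \<Gamma> * dim \<Delta>) (universe A)" using assms by (simp add: code_dom_def compose_simps)
  then obtain cs where cs: "cs \<in> tuples (dim \<Gamma>) (tuples (dim \<Delta>) (universe A))" "concat cs = u"
    by (rule concat_tuplesE)
  then show ?thesis using code_dom_compose[OF cs(1)] assms that[of cs] by auto
qed

lemma E_lift:
  assumes "b \<in> E"
  obtains cs where "cs \<in> tuples (dim \<Gamma>) D" "map \<delta> cs = b" "concat cs \<in> code_dom C A P"
proof -
  have "b \<in> tuples (dim \<Gamma>) (\<delta> ` D)"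
    using assms code_dom_tuples[of \<Gamma> B p] unfolding coord_mapD(3)[OF \<delta>] by blast
  then obtain cs where cs: "cs \<in> tuples (dim \<Gamma>) D" "map \<delta> cs = b" by (rule tuples_image_liftE)
  then show ?thesis using code_dom_compose[OF tuples_code_dom[OF cs(1)]] assms that[of cs] by simp
qed

text \<open>The coordinate map \<open>\<mu>\<close> of the composition need not be \<open>\<gamma>\<close> after \<open>\<delta>\<close>, but it factors through
  \<open>\<delta>\<close>, and its other factor \<open>\<nu>\<close> is as good a coordinate map as \<open>\<gamma>\<close>.\<close>

definition \<nu> :: "'b list \<Rightarrow> 'a" where
  "\<nu> b = \<mu> (concat (SOME cs. cs \<in> tuples (dim \<Gamma>) D \<and> map \<delta> cs = b))"

text \<open>The equality formula of the composition is the translation of that of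
  \<open>\<Gamma>\<close>, so \<open>\<mu>\<close> and \<open>\<gamma>\<close> after
  \<open>\<delta>\<close> identify the same representatives.\<close>

lemma \<mu>_eq_iff:
  assumes "cs \<in> tuples (dim \<Gamma>) D" "map \<delta> cs \<in> E" "cs' \<in> tuples (dim \<Gamma>) D" "map \<delta> cs' \<in> E"
  shows "\<mu> (concat cs) = \<mu> (concat cs') \<longleftrightarrow> \<gamma> (map \<delta> cs) = \<gamma> (map \<delta> cs')"
proof -
  have dom: "concat cs \<in> code_dom C A P" "concat cs' \<in> code_dom C A P"
    using assms code_dom_compose tuples_code_dom by blast+
  have "cs @ cs' \<in> tuples (2 * dim \<Gamma>) D" using tuples_append[OF assms(1,3)] by (simp add: mult_2)
  then have "sat A (concat cs @ concat cs' @ P) (eq_fm C) \<longleftrightarrow> sat B (map \<delta> cs @ map \<delta> cs' @ p) (eq_fm \<Gamma>)"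
    using sat_translated[of "2 * dim \<Gamma>" "eq_fm \<Gamma>" "cs @ cs'"] is_codeD(2)[OF coord_mapD(1)[OF \<gamma>]]
    by (simp add: compose_simps)
  then show ?thesis using coord_mapD(4)[OF \<mu> dom] coord_mapD(4)[OF \<gamma> assms(2,4)] by simp
qed

text \<open>By \<open>\<mu>_eq_iff\<close> the value does not depend on the preimage chosen in the
  definition of \<open>\<nu>\<close>.\<close>

lemma \<nu>_map:
  assumes cs: "cs \<in> tuples (dim \<Gamma>) D" "map \<delta> cs \<in> E"
  shows "\<nu> (map \<delta> cs) = \<mu> (concat cs)"
proof -
  let ?cs = "SOME cs'. cs' \<in> tuples (dim \<Gamma>) D \<and> map \<delta> cs' = map \<delta> cs"
  have "?cs \<in> tuples (dim \<Gamma>) D \<and> map \<delta> ?cs = map \<delta> cs"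
    by (rule someI[of _ cs]) (use cs in simp)
  then show ?thesis unfolding \<nu>_def using \<mu>_eq_iff[of ?cs cs] cs by simp
qed

lemma E_lifts:
  assumes "bs \<in> tuples k E"
  obtains css where "css \<in> tuples k (tuples (dim \<Gamma>) D)" "map (map \<delta>) css = bs"
    "map concat css \<in> tuples k (code_dom C A P)" "map (\<lambda>cs. \<mu> (concat cs)) css = map \<nu> bs"
proof -
  let ?S = "{cs \<in> tuples (dim \<Gamma>) D. map \<delta> cs \<in> E}"
  have "E \<subseteq> map \<delta> ` ?S" by (auto elim: E_lift)
  then have "bs \<in> tuples k (map \<delta> ` ?S)" using assms by (auto simp: tuples_def)
  then obtain css where css: "css \<in> tuples k ?S" "map (map \<delta>) css = bs" by (rule tuples_image_liftE)
  have 1: "css \<in> tuples k (tuples (dim \<Gamma>) D)" using css(1) by (auto simp: tuples_def[of k])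
  have 2: "map concat css \<in> tuples k (code_dom C A P)"
    by (rule map_image_tuples[OF css(1)]) (use code_dom_compose tuples_code_dom in blast)
  have "map (\<lambda>cs. \<mu> (concat cs)) css = map (\<lambda>cs. \<nu> (map \<delta> cs)) css"
    using css(1) by (auto simp: \<nu>_map tuples_def[of k])
  also have "\<dots> = map \<nu> bs" by (simp add: css(2)[symmetric] comp_def)
  finally show ?thesis by (rule that[OF 1 css(2) 2])
qed

text \<open>For each clause the tuples of B are lifted to tuples of A, where the formula of
  \<open>\<Gamma>\<close> becomes one of the composed code and the clause for \<open>\<mu>\<close>
  applies.\<close>

lemma coord_map_\<nu>: "coord_map \<Gamma> B p A \<nu>"
  unfolding coord_map_def
proof (intro conjI ballI allI impI)
  show "is_code (lang A) (lang B) \<Gamma>" "p \<in> tuples (npars \<Gamma>) (universe B)"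
    by (fact coord_mapD[OF \<gamma>])+
  have "\<nu> ` E = \<mu> ` code_dom C A P"
  proof (intro equalityI subsetI)
    fix x assume "x \<in> \<nu> ` E"
    then obtain b where b: "b \<in> E" "x = \<nu> b" by blast
    from E_lift[OF b(1)] obtain cs where
      "cs \<in> tuples (dim \<Gamma>) D" "map \<delta> cs = b" "concat cs \<in> code_dom C A P" by metis
    then show "x \<in> \<mu> ` code_dom C A P" using \<nu>_map[of cs] b by (intro rev_image_eqI) auto
  next
    fix x assume "x \<in> \<mu> ` code_dom C A P"
    then obtain u where u: "u \<in> code_dom C A P" "x = \<mu> u" by blast
    from code_dom_composeE[OF u(1)] obtain cs where
      "cs \<in> tuples (dim \<Gamma>) D" "map \<delta> cs \<in> E" "u = concat cs" by metis
    then show "x \<in> \<nu> ` E" using \<nu>_map[of cs] u by (intro rev_image_eqI[of "map \<delta> cs"]) auto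
  qed
  then show "\<nu> ` E = universe A" using coord_mapD(3)[OF \<mu>] by simp
next
  fix b b' assume b: "b \<in> E" "b' \<in> E"
  then obtain cs cs' where "cs \<in> tuples (dim \<Gamma>) D" "map \<delta> cs = b" "cs' \<in> tuples (dim \<Gamma>) D" "map \<delta> cs' = b'"
    by (metis E_lift)
  then show "sat B (b @ b' @ p) (eq_fm \<Gamma>) \<longleftrightarrow> \<nu> b = \<nu> b'"
    using \<mu>_eq_iff[of cs cs'] \<nu>_map[of cs] \<nu>_map[of cs'] coord_mapD(4)[OF \<gamma> b] b by simp
next
  fix f bs b assume f: "f < length (funs (lang A))" and bs: "bs \<in> tuples (funs (lang A) ! f) E" and b: "b \<in> E"
  let ?k = "funs (lang A) ! f"
  obtain css where css: "css \<in> tuples ?k (tuples (dim \<Gamma>) D)" "map (map \<delta>) css = bs"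
    "map concat css \<in> tuples ?k (code_dom C A P)" "map (\<lambda>cs. \<mu> (concat cs)) css = map \<nu> bs"
    by (rule E_lifts[OF bs])
  obtain c where c: "c \<in> tuples (dim \<Gamma>) D" "map \<delta> c = b" "concat c \<in> code_dom C A P"
    by (rule E_lift[OF b])
  have "concat css @ c \<in> tuples (Suc ?k * dim \<Gamma>) D"
    using tuples_append[OF concat_tuples[OF css(1)] c(1)] by (simp add: add.commute)
  then have "sat A (concat (map concat css) @ concat c @ P) (fun_fm C f) \<longleftrightarrow> sat B (concat bs @ b @ p) (fun_fm \<Gamma> f)"
    using sat_translated[of "Suc ?k * dim \<Gamma>" "fun_fm \<Gamma> f" "concat css @ c"] is_codeD(3)[OF coord_mapD(1)[OF \<gamma>] f]
      css(2) c(2)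
    by (simp add: compose_simps concat_concat map_concat)
  moreover have "\<mu> (concat c) = \<nu> b" using \<nu>_map[of c] c b by simp
  ultimately show "sat B (concat bs @ b @ p) (fun_fm \<Gamma> f) \<longleftrightarrow> fn A f (map \<nu> bs) = \<nu> b"
    using coord_mapD(5)[OF \<mu> f css(3) c(3)] css(4) by (simp add: comp_def)
next
  fix r bs assume r: "r < length (rels (lang A))" and bs: "bs \<in> tuples (rels (lang A) ! r) E"
  let ?k = "rels (lang A) ! r"
  obtain css where css: "css \<in> tuples ?k (tuples (dim \<Gamma>) D)" "map (map \<delta>) css = bs"
    "map concat css \<in> tuples ?k (code_dom C A P)" "map (\<lambda>cs. \<mu> (concat cs)) css = map \<nu> bs"
    by (rule E_lifts[OF bs])
  have "sat A (concat (map concat css) @ P) (rel_fm C r) \<longleftrightarrow> sat B (concat bs @ p) (rel_fm \<Gamma> r)"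
    using sat_translated[of "?k * dim \<Gamma>" "rel_fm \<Gamma> r" "concat css"] is_codeD(4)[OF coord_mapD(1)[OF \<gamma>] r]
      concat_tuples[OF css(1)] css(2)
    by (simp add: compose_simps concat_concat map_concat)
  then show "sat B (concat bs @ p) (rel_fm \<Gamma> r) \<longleftrightarrow> rel A r (map \<nu> bs)"
    using coord_mapD(6)[OF \<mu> r css(3)] css(4) by (simp add: comp_def)
qed

end

section \<open>Translating WSOL formulas and returning to A\<close>

lemma tuples_iff_nth: "xs \<in> tuples k X \<longleftrightarrow> length xs = k \<and> (\<forall>i < k. xs ! i \<in> X)"
  using nth_mem[of _ xs] by (auto simp: tuples_def in_set_conv_nth)

text \<open>The free variables of a translated formula should be tuples over B, whereas the
  interpretation of HF(A) expects codes of atoms. The formula \<open>\<tau>\<close> links the two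
  and has no parameters.\<close>

lemma (in hf_coding) ex_atom_formula:
  "\<exists>\<tau>. wf_fm (HF_lang (lang B)) (1 + n + 0) \<tau> \<and>
    (\<forall>x \<in> HF_set U. \<forall>b \<in> tuples n U. sat (HF B) (x # map Ur b) \<tau> \<longleftrightarrow> (\<exists>c \<in> U. x = tup (c # b)))"
proof -
  have "definable (HF B) [] (Suc n) (\<lambda>e. is_atom U n (e 0) (map (\<lambda>i. e (Suc i)) [0..<n]))"
    by (rule definable_is_atom)
  then obtain \<tau> where \<tau>: "wf_fm (HF_lang (lang B)) (Suc n) \<tau>"
    "\<And>e. e \<in> tuples (Suc n) (HF_set U) \<Longrightarrow>
      sat (HF B) e \<tau> \<longleftrightarrow> is_atom U n (e ! 0) (map (\<lambda>i. e ! Suc i) [0..<n])"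
    unfolding definable_def by auto
  have "sat (HF B) (x # map Ur b) \<tau> \<longleftrightarrow> (\<exists>c \<in> U. x = tup (c # b))"
    if x: "x \<in> HF_set U" and b: "b \<in> tuples n U" for x b
  proof -
    have "x # map Ur b \<in> tuples (Suc n) (HF_set U)"
      using x b by (auto simp: tuples_def)
    moreover have "map (\<lambda>i. (x # map Ur b) ! Suc i) [0..<n] = map Ur b"
      using tuplesD[OF b] by (intro nth_equalityI) auto
    ultimately have "sat (HF B) (x # map Ur b) \<tau> \<longleftrightarrow> is_atom U n x (map Ur b)"
      using \<tau>(2)[of "x # map Ur b"] by simp
    also have "\<dots> \<longleftrightarrow> (\<exists>c \<in> U. x = tup (c # b))"
      using b inj_map_eq_map[of Ur] by (auto simp: is_atom_def inj_def)
    finally show ?thesis .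
  qed
  then show ?thesis using \<tau>(1) by auto
qed

text \<open>\<open>cover\<close> replaces each tuple of length \<open>dim \<Gamma>\<close> by a
  single code, hence the block lengths; the zeros say that \<open>\<tau>\<close> sees no parameters.
  \<open>\<Omega>\<close> and \<open>\<tau>\<close> do not depend on the formula, which
  effectiveness requires.\<close>

theorem (in hf_coding) ex_HF_translation:
  "\<exists>\<Omega> \<tau>. is_code (HF_lang (lang A)) (HF_lang (lang B)) \<Omega> \<and> dim \<Omega> = 1 \<and>
     (\<forall>k \<phi>. wf_fm (HF_lang (lang A)) k \<phi> \<longrightarrow>
        (let \<phi>' = cover 1 (dim \<Gamma>) 0 0 \<tau> k (npars \<Gamma>) (tr_fm \<Omega> k \<phi>) in
         wf_fm (HF_lang (lang B)) (k * dim \<Gamma> + npars \<Gamma>) \<phi>' \<and>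
         (\<forall>bs \<in> tuples k D. sat (HF B) (map Ur (concat bs @ p)) \<phi>' \<longleftrightarrow> sat (HF A) (map Ur (map \<mu> bs)) \<phi>)))"
proof -
  obtain \<Omega> where \<Omega>: "dim \<Omega> = 1" "npars \<Omega> = npars \<Gamma>" "code_dom \<Omega> (HF B) q = (\<lambda>x. [x]) ` codes"
    "coord_map \<Omega> (HF B) q (HF A) (\<lambda>c. decode (hd c))"
    using ex_coord_map_HF by blast
  obtain \<tau> where \<tau>: "wf_fm (HF_lang (lang B)) (1 + n + 0) \<tau>"
    "\<And>x b. x \<in> HF_set U \<Longrightarrow> b \<in> tuples n U \<Longrightarrow>
      sat (HF B) (x # map Ur b) \<tau> \<longleftrightarrow> (\<exists>c \<in> U. x = tup (c # b))"
    using ex_atom_formula by blast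
  note code = coord_mapD(1)[OF \<Omega>(4), unfolded lang_HF]
  let ?T = "\<lambda>k \<phi>. cover 1 n 0 0 \<tau> k (npars \<Gamma>) (tr_fm \<Omega> k \<phi>)"
  have "wf_fm (HF_lang (lang B)) (k * n + npars \<Gamma>) (?T k \<phi>) \<and>
    (\<forall>bs \<in> tuples k D. sat (HF B) (map Ur (concat bs @ p)) (?T k \<phi>) \<longleftrightarrow>
      sat (HF A) (map Ur (map \<mu> bs)) \<phi>)" if \<phi>: "wf_fm (HF_lang (lang A)) k \<phi>" for k \<phi>
  proof (intro conjI ballI)
    let ?\<psi> = "tr_fm \<Omega> k \<phi>"
    have \<psi>: "wf_fm (HF_lang (lang B)) (k * 1 + npars \<Gamma>) ?\<psi>"
      using wf_tr_fm[OF code \<phi>] by (simp only: \<Omega>)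
    show "wf_fm (HF_lang (lang B)) (k * n + npars \<Gamma>) (?T k \<phi>)"
      by (rule wf_cover[OF \<tau>(1) \<psi>]) simp_all
    fix bs assume bs: "bs \<in> tuples k D"
    have as: "map (map Ur) bs \<in> tuples k (tuples n (HF_set U))"
      by (rule map_image_tuples[OF tuples_code_dom[OF bs]]) (auto simp: tuples_def)
    have q: "q \<in> tuples (npars \<Gamma>) (universe (HF B))"
      using p_in_U length_p by (auto simp: tuples_def)
    \<comment> \<open>The spare entry may differ from atom to atom; the decoded values do not depend
      on it.\<close>
    have dom: "us \<in> tuples k (code_dom \<Omega> (HF B) q) \<and> map (\<lambda>c. decode (hd c)) us = map Ur (map \<mu> bs)"
      if us: "length us = k" "\<And>i. i < k \<Longrightarrow> \<exists>c \<in> U. us ! i = [tup (c # bs ! i)]" for us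
    proof
      have "us ! i \<in> (\<lambda>x. [x]) ` codes" if "i < k" for i
        using us(2)[OF that] tuples_nth[OF bs that] codes.atom by blast
      then show "us \<in> tuples k (code_dom \<Omega> (HF B) q)"
        unfolding \<Omega>(3) using us(1) by (auto simp: tuples_def in_set_conv_nth)
      show "map (\<lambda>c. decode (hd c)) us = map Ur (map \<mu> bs)"
      proof (rule nth_equalityI)
        fix i assume "i < length (map (\<lambda>c. decode (hd c)) us)"
        then have i: "i < k" using us(1) by simp
        then show "map (\<lambda>c. decode (hd c)) us ! i = map Ur (map \<mu> bs) ! i"
          using us(1) us(2)[OF i] tuplesD[OF bs] by (auto simp: decode_atom)
      qed (use us(1) tuplesD[OF bs] in simp)
    qed
    have tr: "sat (HF B) (concat us @ q) ?\<psi> \<longleftrightarrow> sat (HF A) (map Ur (map \<mu> bs)) \<phi>"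
      if us: "length us = k" "\<And>i. i < k \<Longrightarrow> \<exists>c \<in> U. us ! i = [tup (c # bs ! i)]" for us
      using sat_tr_fm[OF \<Omega>(4) is_struct_HF, of k \<phi> us] \<phi> dom[OF us] by (simp only: lang_HF)
    have \<tau>': "sat (HF B) (us ! i @ map (map Ur) bs ! i @ take 0 q @ drop (npars \<Gamma> - (0 - 0)) q) \<tau> \<longleftrightarrow>
        (\<exists>c \<in> U. us ! i = [tup (c # bs ! i)])"
      if us: "us \<in> tuples k (tuples 1 (HF_set U))" and i: "i < k" for us i
    proof -
      obtain x where x: "us ! i = [x]" "x \<in> HF_set U"
        using tuples_nth[OF us i] by (auto simp: tuples_def length_Suc_conv)
      then show ?thesis
        using \<tau>(2)[OF x(2) D_tuples[OF tuples_nth[OF bs i]]] i tuplesD[OF bs] by (simp add: length_p)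
    qed
    have "sat (HF B) (map Ur (concat bs @ p)) (?T k \<phi>) \<longleftrightarrow>
      (\<exists>us \<in> tuples k (tuples 1 (HF_set U)). (\<forall>i < k. \<exists>c \<in> U. us ! i = [tup (c # bs ! i)]) \<and> sat (HF B) (concat us @ q) ?\<psi>)"
      using sat_cover[OF \<tau>(1) \<psi> _ _ as q, of 0] \<tau>' by (simp add: map_concat cong: conj_cong)
    also have "\<dots> \<longleftrightarrow> sat (HF A) (map Ur (map \<mu> bs)) \<phi>"
    proof
      assume "sat (HF A) (map Ur (map \<mu> bs)) \<phi>"
      obtain c where c: "c \<in> U" by (rule U_nonempty)
      let ?us = "map (\<lambda>b. [tup (c # b)]) bs"
      have us: "?us \<in> tuples k (tuples 1 (HF_set U))"
        by (rule map_image_tuples[OF tuples_code_dom[OF bs]]) (use c in \<open>auto simp: tuples_def\<close>)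
      have nth: "?us ! i = [tup (c # bs ! i)]" if "i < k" for i using that tuplesD[OF bs] by simp
      show "\<exists>us \<in> tuples k (tuples 1 (HF_set U)). (\<forall>i < k. \<exists>c \<in> U. us ! i = [tup (c # bs ! i)]) \<and> sat (HF B) (concat us @ q) ?\<psi>"
        by (rule bexI[OF _ us], intro conjI allI impI)
          (use nth c tr[OF tuplesD[OF us]] \<open>sat (HF A) (map Ur (map \<mu> bs)) \<phi>\<close> in blast)+
    qed (use tr tuplesD in blast)
    finally show "sat (HF B) (map Ur (concat bs @ p)) (?T k \<phi>) \<longleftrightarrow>
      sat (HF A) (map Ur (map \<mu> bs)) \<phi>" .
  qed
  then show ?thesis using \<Omega>(1) code \<tau>(1) unfolding Let_def by blast
qed

text \<open>The parameters are representatives of those of \<open>\<Gamma>\<close>, then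
  \<open>m\<close> blocks for those supplied by richness of B, then those of
  \<open>\<Delta>\<close>. The formula \<open>\<chi>\<close> defines the coordinate map of the
  composition and sees only the outer two groups. Each element of A is thus replaced by a
  representing tuple of length \<open>dim \<Gamma> * dim \<Delta>\<close>.\<close>

definition first_order_translation ::
  "interp_code \<Rightarrow> interp_code \<Rightarrow> fm \<Rightarrow> nat \<Rightarrow> nat \<Rightarrow> fm \<Rightarrow> fm" where
  "first_order_translation \<Gamma> \<Delta> \<chi> k m \<psi> =
     cover (dim \<Gamma> * dim \<Delta>) 1 (npars \<Gamma> * dim \<Delta>) (npars \<Gamma> * dim \<Delta> + npars \<Delta>) \<chi> k
       ((npars \<Gamma> + m) * dim \<Delta> + npars \<Delta>) (tr_fm \<Delta> (k * dim \<Gamma> + npars \<Gamma> + m) \<psi>)"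

lemma (in composed) fo_equiv_translation:
  assumes \<chi>: "wf_fm (lang A) (dim \<Gamma> * dim \<Delta> + 1 + (npars \<Gamma> * dim \<Delta> + npars \<Delta>)) \<chi>"
    "\<And>u x. u \<in> tuples (dim \<Gamma> * dim \<Delta>) (universe A) \<Longrightarrow> x \<in> universe A \<Longrightarrow>
      sat A (u @ [x] @ P) \<chi> \<longleftrightarrow> u \<in> code_dom C A P \<and> \<mu> u = x"
    and \<phi>: "\<And>bs. bs \<in> tuples k E \<Longrightarrow>
      sat (HF B) (map Ur (concat bs @ p)) \<phi>' \<longleftrightarrow> sat (HF A) (map Ur (map \<nu> bs)) \<phi>"
    and \<psi>: "fo_equiv B (k * dim \<Gamma> + npars \<Gamma>) \<phi>' m \<psi> r"
  shows "\<exists>r'. fo_equiv A k \<phi> ((npars \<Gamma> + m) * dim \<Delta> + npars \<Delta>) (first_order_translation \<Gamma> \<Delta> \<chi> k m \<psi>) r'"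
proof -
  let ?d = "dim \<Gamma> * dim \<Delta>" and ?K = "k * dim \<Gamma> + npars \<Gamma> + m" and ?U = "universe A"
    and ?M = "(npars \<Gamma> + m) * dim \<Delta> + npars \<Delta>" and ?c = "npars \<Gamma> * dim \<Delta>"
  let ?r = "?c + npars \<Delta>" and ?\<psi> = "tr_fm \<Delta> ?K \<psi>"
  have wf: "wf_fm (lang B) ?K \<psi>" and r: "r \<in> tuples m (universe B)"
    and eq: "\<And>b. b \<in> tuples (k * dim \<Gamma> + npars \<Gamma>) (universe B) \<Longrightarrow>
      sat (HF B) (map Ur b) \<phi>' \<longleftrightarrow> sat B (b @ r) \<psi>"
    using \<psi> by (auto simp: fo_equiv_def)
  obtain rs where rs: "rs \<in> tuples m D" "map \<delta> rs = r"
    by (rule tuples_image_liftE[OF r[folded coord_mapD(3)[OF \<delta>]]])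
  \<comment> \<open>The representatives \<open>rs\<close> of the new parameters go between the two
    groups that \<open>\<chi>\<close> needs.\<close>
  let ?P = "concat ps @ concat rs @ q"
  have q: "q \<in> tuples (npars \<Delta>) ?U" by (rule coord_mapD(2)[OF \<delta>])
  have lps: "length (concat ps) = ?c" by (rule length_concat_tuples[OF tuples_code_dom[OF ps_tuples]])
  have P: "?P \<in> tuples ?M ?U"
    using tuples_append[OF concat_tuples[OF tuples_code_dom[OF ps_tuples]]
        tuples_append[OF concat_tuples[OF tuples_code_dom[OF rs(1)]] q]]
    by (simp add: algebra_simps)
  have sel: "take ?c ?P @ drop (?M - (?r - ?c)) ?P = P"
    using lps length_concat_tuples[OF tuples_code_dom[OF rs(1)]] by (simp add: algebra_simps)
  have wf\<psi>: "wf_fm (lang A) (k * ?d + ?M) ?\<psi>"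
    using wf_tr_fm[OF coord_mapD(1)[OF \<delta>] wf] by (simp add: algebra_simps)
  have le: "?c \<le> ?r" "?r \<le> ?M" by simp_all
  have "wf_fm (lang A) (k + ?M) (first_order_translation \<Gamma> \<Delta> \<chi> k m \<psi>)"
    using wf_cover[OF \<chi>(1) wf\<psi> le] by (simp add: first_order_translation_def)
  moreover have "sat (HF A) (map Ur a) \<phi> \<longleftrightarrow> sat A (a @ ?P) (first_order_translation \<Gamma> \<Delta> \<chi> k m \<psi>)"
    if a: "a \<in> tuples k ?U" for a
  proof -
    have as: "map (\<lambda>x. [x]) a \<in> tuples k (tuples 1 ?U)"
      by (rule map_image_tuples[OF a]) (simp add: tuples_def)
    have concat_a: "concat (map (\<lambda>x. [x]) a) = a" by (induction a) auto
    have \<chi>': "sat A (us ! i @ map (\<lambda>x. [x]) a ! i @ take ?c ?P @ drop (?M - (?r - ?c)) ?P) \<chi> \<longleftrightarrow>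
        us ! i \<in> code_dom C A P \<and> \<mu> (us ! i) = a ! i"
      if us: "us \<in> tuples k (tuples ?d ?U)" and i: "i < k" for us i
      unfolding sel using \<chi>(2)[OF tuples_nth[OF us i] tuples_nth[OF a i]] i tuplesD[OF a] by simp
    have tr: "sat A (concat us @ ?P) ?\<psi> \<longleftrightarrow> sat (HF A) (map Ur a) \<phi>"
      if us: "us \<in> tuples k (code_dom C A P)" "map \<mu> us = a" for us
    proof -
      let ?S = "{cs \<in> tuples (dim \<Gamma>) D. map \<delta> cs \<in> E}"
      have "code_dom C A P \<subseteq> concat ` ?S" by (auto elim: code_dom_composeE)
      then have "us \<in> tuples k (concat ` ?S)" using us(1) by (auto simp: tuples_def)
      then obtain css where css: "css \<in> tuples k ?S" "map concat css = us" by (rule tuples_image_liftE)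
      have css': "css \<in> tuples k (tuples (dim \<Gamma>) D)" using css(1) by (auto simp: tuples_def[of k])
      have E: "map (map \<delta>) css \<in> tuples k E" by (rule map_image_tuples[OF css(1)]) simp
      have \<nu>: "map \<nu> (map (map \<delta>) css) = a"
        unfolding us(2)[symmetric] css(2)[symmetric] using css(1) by (auto simp: \<nu>_map tuples_def[of k])
      \<comment> \<open>As blocks over A, the variables of \<open>\<psi>\<close> are the arguments,
        the parameters of \<open>\<Gamma>\<close> and the parameters from richness, in this
        order.\<close>
      have "concat css @ ps @ rs \<in> tuples ?K D"
        using tuples_append[OF concat_tuples[OF css'] tuples_append[OF ps_tuples rs(1)]] by (simp add: add.assoc)
      from sat_tr_fm[OF \<delta> B wf this]
      have "sat A (concat us @ ?P) ?\<psi> \<longleftrightarrow> sat B (map \<delta> (concat css) @ p @ r) \<psi>"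
        by (simp add: css(2)[symmetric] concat_concat ps(2) rs(2))
      also have "\<dots> \<longleftrightarrow> sat (HF B) (map Ur (concat (map (map \<delta>) css) @ p)) \<phi>'"
      proof -
        have "concat (map (map \<delta>) css) @ p \<in> tuples (k * dim \<Gamma> + npars \<Gamma>) (universe B)"
          by (rule tuples_append[OF concat_tuples[OF tuples_code_dom[OF E]] coord_mapD(2)[OF \<gamma>]])
        from eq[OF this] show ?thesis by (simp add: map_concat)
      qed
      also have "\<dots> \<longleftrightarrow> sat (HF A) (map Ur a) \<phi>" unfolding \<phi>[OF E] \<nu> ..
      finally show ?thesis .
    qed
    have "sat A (a @ ?P) (first_order_translation \<Gamma> \<Delta> \<chi> k m \<psi>) \<longleftrightarrow>
      (\<exists>us \<in> tuples k (tuples ?d ?U). (\<forall>i < k. us ! i \<in> code_dom C A P \<and> \<mu> (us ! i) = a ! i) \<and> sat A (concat us @ ?P) ?\<psi>)"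
      using sat_cover[OF \<chi>(1) wf\<psi> le as P] \<chi>' unfolding concat_a first_order_translation_def
      by (simp cong: conj_cong)
    also have "\<dots> \<longleftrightarrow> (\<exists>us \<in> tuples k (code_dom C A P). map \<mu> us = a \<and> sat A (concat us @ ?P) ?\<psi>)"
    proof -
      have sub: "code_dom C A P \<subseteq> tuples ?d ?U"
        using code_dom_tuples[of C A P] by (simp only: compose_simps)
      have "us \<in> tuples k (tuples ?d ?U) \<and> (\<forall>i < k. us ! i \<in> code_dom C A P \<and> \<mu> (us ! i) = a ! i) \<longleftrightarrow>
          us \<in> tuples k (code_dom C A P) \<and> map \<mu> us = a" for us
        using sub tuplesD[OF a] by (auto simp: tuples_iff_nth list_eq_iff_nth_eq)
      then show ?thesis by (simp only: Bex_def conj_assoc[symmetric])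
    qed
    also have "\<dots> \<longleftrightarrow> sat (HF A) (map Ur a) \<phi>"
    proof -
      have "a \<in> tuples k (\<mu> ` code_dom C A P)" using a coord_mapD(3)[OF \<mu>] by simp
      then obtain us where "us \<in> tuples k (code_dom C A P)" "map \<mu> us = a" by (rule tuples_image_liftE)
      then show ?thesis using tr by metis
    qed
    finally show ?thesis by simp
  qed
  ultimately show ?thesis using P unfolding fo_equiv_def by blast
qed

text \<open>The witnesses come before \<open>\<phi>\<close>, and the first-order equivalent of
  \<open>\<phi>'\<close> in B is arbitrary. Hence this one statement serves richness with or without
  parameters, and effective or not.\<close>

theorem bi_interpretation_transfer:
  fixes A :: "'a struct" and B :: "'b struct"
  assumes A: "is_struct A" and B: "is_struct B" and bi: "bi_interpretation \<Gamma> \<Delta> A q B p"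
  shows "\<exists>\<Omega> \<tau> \<chi>. is_code (HF_lang (lang A)) (HF_lang (lang B)) \<Omega> \<and> dim \<Omega> = 1 \<and>
    (\<forall>k \<phi>. wsol A k \<phi> \<longrightarrow>
      (let \<phi>' = cover 1 (dim \<Gamma>) 0 0 \<tau> k (npars \<Gamma>) (tr_fm \<Omega> k \<phi>); k' = k * dim \<Gamma> + npars \<Gamma> in
       wsol B k' \<phi>' \<and>
       (\<forall>m \<psi> r. fo_equiv B k' \<phi>' m \<psi> r \<longrightarrow>
          (\<exists>r'. fo_equiv A k \<phi> ((npars \<Gamma> + m) * dim \<Delta> + npars \<Delta>)
             (first_order_translation \<Gamma> \<Delta> \<chi> k m \<psi>) r'))))"
proof -
  obtain \<gamma> \<delta> ps \<theta> where \<gamma>: "interpretation_via \<Gamma> B p A \<gamma>" and \<delta>: "interpretation_via \<Delta> A q B \<delta>"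
    and ps: "set ps \<subseteq> code_dom \<Delta> A q" "map \<delta> ps = p"
    and \<theta>: "defines_isomorphism \<theta> (compose (lang A) \<Gamma> \<Delta>) A (concat ps @ q)"
    using bi unfolding bi_interpretation_def by blast
  let ?C = "compose (lang A) \<Gamma> \<Delta>" and ?P = "concat ps @ q"
  obtain \<mu> where \<mu>: "interpretation_via ?C A ?P A \<mu>"
    and sat\<theta>: "\<And>u x. u \<in> code_dom ?C A ?P \<Longrightarrow> x \<in> universe A \<Longrightarrow> sat A (u @ [x] @ ?P) \<theta> \<longleftrightarrow> \<mu> u = x"
    and wf\<theta>: "wf_fm (lang A) (dim ?C + 1 + npars ?C) \<theta>"
    using \<theta> unfolding defines_isomorphism_def by blast
  interpret composed \<Gamma> \<Delta> A q B p \<gamma> \<delta> ps \<mu>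
    by unfold_locales (use \<gamma> \<delta> ps \<mu> A B interpretation_via_coord_map in blast)+
  \<comment> \<open>\<open>\<theta>\<close> is controlled only on the domain of the composed code,
    so membership in that domain is added. The renaming skips the variable for the value, which
    stands between the tuple and the parameters.\<close>
  define \<chi> where "\<chi> = Conj (rename (\<lambda>j. if j < dim ?C then j else Suc j) (dom_fm ?C)) \<theta>"
  have wf_dom: "wf_fm (lang A) (dim ?C + npars ?C) (dom_fm ?C)"
    using is_codeD(1)[OF coord_mapD(1)[OF \<mu>]] by simp
  have "wf_fm (lang A) (dim ?C + 1 + npars ?C) (rename (\<lambda>j. if j < dim ?C then j else Suc j) (dom_fm ?C))"
    by (rule wf_rename[OF wf_dom]) auto
  then have wf\<chi>: "wf_fm (lang A) (dim \<Gamma> * dim \<Delta> + 1 + (npars \<Gamma> * dim \<Delta> + npars \<Delta>)) \<chi>"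
    using wf\<theta> by (simp add: \<chi>_def compose_simps)
  have sat\<chi>: "sat A (u @ [x] @ ?P) \<chi> \<longleftrightarrow> u \<in> code_dom ?C A ?P \<and> \<mu> u = x"
    if u: "u \<in> tuples (dim \<Gamma> * dim \<Delta>) (universe A)" and x: "x \<in> universe A" for u x
  proof -
    have "sat A (u @ [x] @ ?P) (rename (\<lambda>j. if j < dim ?C then j else Suc j) (dom_fm ?C)) \<longleftrightarrow>
        sat A (u @ ?P) (dom_fm ?C)"
      by (rule sat_rename[OF wf_dom]) (use tuplesD[OF u] in \<open>auto simp: nth_append compose_simps nth_Cons'\<close>)
    also have "\<dots> \<longleftrightarrow> u \<in> code_dom ?C A ?P"
      using u by (simp add: code_dom_def compose_simps)
    finally show ?thesis using sat\<theta>[OF _ x] by (auto simp: \<chi>_def)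
  qed
  obtain \<Omega> \<tau> where \<Omega>: "is_code (HF_lang (lang A)) (HF_lang (lang B)) \<Omega>" "dim \<Omega> = 1"
    and tr: "\<And>k \<phi>. wf_fm (HF_lang (lang A)) k \<phi> \<Longrightarrow>
      wf_fm (HF_lang (lang B)) (k * dim \<Gamma> + npars \<Gamma>) (cover 1 (dim \<Gamma>) 0 0 \<tau> k (npars \<Gamma>) (tr_fm \<Omega> k \<phi>))"
    "\<And>k \<phi> bs. wf_fm (HF_lang (lang A)) k \<phi> \<Longrightarrow> bs \<in> tuples k (code_dom \<Gamma> B p) \<Longrightarrow>
       sat (HF B) (map Ur (concat bs @ p)) (cover 1 (dim \<Gamma>) 0 0 \<tau> k (npars \<Gamma>) (tr_fm \<Omega> k \<phi>)) \<longleftrightarrow>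
       sat (HF A) (map Ur (map \<nu> bs)) \<phi>"
    \<comment> \<open>The coordinate map is \<open>\<nu>\<close> and not \<open>\<gamma>\<close>,
      because \<open>\<mu>\<close>, which \<open>\<chi>\<close> defines, is \<open>\<nu>\<close>
      after \<open>\<delta>\<close>.\<close>
    using hf_coding.ex_HF_translation[OF hf_coding.intro[OF coord_map_\<nu> B]] unfolding Let_def by blast
  let ?T = "\<lambda>k \<phi>. cover 1 (dim \<Gamma>) 0 0 \<tau> k (npars \<Gamma>) (tr_fm \<Omega> k \<phi>)"
  have "wsol B (k * dim \<Gamma> + npars \<Gamma>) (?T k \<phi>) \<and>
    (\<forall>m \<psi> r. fo_equiv B (k * dim \<Gamma> + npars \<Gamma>) (?T k \<phi>) m \<psi> r \<longrightarrow>
      (\<exists>r'. fo_equiv A k \<phi> ((npars \<Gamma> + m) * dim \<Delta> + npars \<Delta>) (first_order_translation \<Gamma> \<Delta> \<chi> k m \<psi>) r'))"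
    if "wsol A k \<phi>" for k \<phi>
  proof -
    have wf: "wf_fm (HF_lang (lang A)) k \<phi>" using that by (simp add: wsol_def)
    show ?thesis
      using tr(1)[OF wf] fo_equiv_translation[OF wf\<chi> sat\<chi> tr(2)[OF wf]] by (simp add: wsol_def)
  qed
  then show ?thesis using \<Omega> unfolding Let_def by blast
qed

section \<open>Computability of the translations\<close>

text \<open>This is where finiteness of the languages enters: the formulas attached to the symbols
  form a finite table, with no assumption on how they depend on the symbol.\<close>

lemma computable_finite_case:
  assumes "\<And>i. i < N \<Longrightarrow> computable (G i)" and f: "computable f" and h: "computable h"
  shows "computable (\<lambda>x. if f x < N then G (f x) x else h x)"
  using assms(1)
proof (induction N)
  case 0
  show ?case using h by simp
next
  case (Suc N)
  have "computable (\<lambda>x. if f x = N then G N x else if f x < N then G (f x) x else h x)"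
    by (intro computable_if_eq f computable_const Suc) simp_all
  moreover have "(if f x = N then G N x else if f x < N then G (f x) x else h x) =
      (if f x < Suc N then G (f x) x else h x)" for x
    by auto
  ultimately show ?case by simp
qed

lemma computable_list_encode:
  "(\<And>g. g \<in> set gs \<Longrightarrow> computable g) \<Longrightarrow> computable (\<lambda>x. list_encode (map (\<lambda>g. g x) gs))"
  by (induction gs) (auto intro!: computable_intros)

text \<open>The term is fixed and only the renaming depends on the input, so induction on the term
  takes place outside the computation.\<close>

lemma computable_rename_tm:
  assumes \<rho>: "\<And>j. computable (\<lambda>x. \<rho> x j)"
  shows "computable (\<lambda>x. tm_code (rename_tm (\<rho> x) t))"
proof (induction t)
  case (Var i)
  show ?case using \<rho> by (auto intro!: computable_intros)
next
  case (Fn f ts)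
  have "computable (\<lambda>x. list_encode (map (\<lambda>g. g x) (map (\<lambda>t x. tm_code (rename_tm (\<rho> x) t)) ts)))"
    by (rule computable_list_encode) (use Fn in auto)
  then show ?case by (auto intro!: computable_intros simp: comp_def)
qed

lemma computable_rename:
  "(\<And>j. computable (\<lambda>x. \<rho> x j)) \<Longrightarrow> computable (\<lambda>x. fm_code (rename (\<rho> x) \<phi>))"
proof (induction \<phi> arbitrary: \<rho>)
  case (Eq s t)
  then show ?case by (auto intro!: computable_intros computable_rename_tm)
next
  case (Rel r ts)
  have "computable (\<lambda>x. list_encode (map (\<lambda>g. g x) (map (\<lambda>t x. tm_code (rename_tm (\<rho> x) t)) ts)))"
    by (rule computable_list_encode) (auto intro!: computable_rename_tm Rel)
  then show ?case by (auto intro!: computable_intros simp: comp_def)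
next
  case (Neg \<phi>)
  then show ?case by (auto intro!: computable_intros)
next
  case (Conj \<phi> \<psi>)
  then show ?case by (auto intro!: computable_intros)
next
  case (Ex \<phi>)
  have "computable (\<lambda>x. fm_code (rename (case_nat 0 (\<lambda>i. Suc (\<rho> x i))) \<phi>))"
  proof (rule Ex.IH)
    show "computable (\<lambda>x. case_nat 0 (\<lambda>i. Suc (\<rho> x i)) j)" for j
      using Ex.prems by (cases j) (auto intro!: computable_intros)
  qed
  then show ?case by (auto intro!: computable_intros)
qed

lemma computable_at_blocks:
  assumes k: "computable k" and gs: "\<And>g. g \<in> set gs \<Longrightarrow> computable g"
  shows "computable (\<lambda>x. fm_code (at_blocks \<Delta> (k x) (map (\<lambda>g. g x) gs) \<phi>))"
  unfolding at_blocks_def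
proof (rule computable_rename)
  fix j
  show "computable (\<lambda>x. if j < length (map (\<lambda>g. g x) gs) * dim \<Delta>
      then map (\<lambda>g. g x) gs ! (j div dim \<Delta>) * dim \<Delta> + j mod dim \<Delta>
      else k x * dim \<Delta> + (j - length (map (\<lambda>g. g x) gs) * dim \<Delta>))"
  proof (cases "j < length gs * dim \<Delta>")
    case True
    then have "j div dim \<Delta> < length gs" by (simp add: less_mult_imp_div_less)
    then show ?thesis using True gs by (auto intro!: computable_intros)
  next
    case False
    then show ?thesis using k by (auto intro!: computable_intros)
  qed
qed

lemma computable_at_blocks_1:
  assumes "computable k" "computable f"
  shows "computable (\<lambda>x. fm_code (at_blocks \<Delta> (k x) [f x] \<phi>))"
  using computable_at_blocks[of k "[f]" \<Delta> \<phi>] assms by simp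

lemma computable_at_blocks_2:
  assumes "computable k" "computable f" "computable g"
  shows "computable (\<lambda>x. fm_code (at_blocks \<Delta> (k x) [f x, g x] \<phi>))"
  using computable_at_blocks[of k "[f, g]" \<Delta> \<phi>] assms by auto

section \<open>Building formulas on codes\<close>

definition conj_code :: "nat \<Rightarrow> nat \<Rightarrow> nat" where
  "conj_code a b = prod_encode (3, prod_encode (a, b))"

definition ex_code :: "nat \<Rightarrow> nat" where
  "ex_code a = prod_encode (4, a)"

lemma fm_code_Ex_pow: "fm_code ((Ex ^^ n) \<phi>) = (ex_code ^^ n) (fm_code \<phi>)"
  by (induction n) (simp_all add: ex_code_def)

lemma computable_conj_code: "computable f \<Longrightarrow> computable g \<Longrightarrow> computable (\<lambda>x. conj_code (f x) (g x))"
  unfolding conj_code_def by (intro computable_intros)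

lemma computable_ex_code: "computable ex_code"
  unfolding ex_code_def[abs_def] by (intro computable_intros)

definition ex_blocks_code :: "interp_code \<Rightarrow> nat \<Rightarrow> nat \<Rightarrow> nat \<Rightarrow> nat" where
  "ex_blocks_code \<Delta> m k v = (ex_code ^^ (m * dim \<Delta>))
     (foldr conj_code (map (\<lambda>i. fm_code (at_blocks \<Delta> (k + m) [i] (dom_fm \<Delta>))) [0..<m]) v)"

lemma fm_code_ex_blocks: "fm_code (ex_blocks \<Delta> k m \<phi>) = ex_blocks_code \<Delta> m k (fm_code \<phi>)"
proof -
  have "fm_code (foldr Conj \<phi>s \<psi>) = foldr conj_code (map fm_code \<phi>s) (fm_code \<psi>)" for \<phi>s \<psi>
    by (induction \<phi>s) (simp_all add: conj_code_def)
  then show ?thesis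
    by (simp add: ex_blocks_def in_dom_def ex_blocks_code_def fm_code_Ex_pow comp_def)
qed

lemma computable_ex_blocks_code:
  assumes k: "computable k" and v: "computable v"
  shows "computable (\<lambda>x. ex_blocks_code \<Delta> m (k x) (v x))"
proof -
  have at: "computable (\<lambda>x. fm_code (at_blocks \<Delta> (k x + m) [i] (dom_fm \<Delta>)))" for i
    by (intro computable_at_blocks_1 computable_intros k)
  have "computable (\<lambda>x. foldr conj_code (map (\<lambda>i. fm_code (at_blocks \<Delta> (k x + m) [i] (dom_fm \<Delta>))) is) (v x))" for "is"
    by (induction "is") (auto intro!: v computable_conj_code at)
  then show ?thesis
    unfolding ex_blocks_code_def by (intro computable_funpow computable_ex_code computable_const)
qed

section \<open>Translation as a recursion on Goedel numbers\<close>

text \<open>A variant of \<open>tr_fm\<close> in which the numbers of blocks are determined by the symbols and not by the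
  lengths of the argument lists; the two agree on well-formed formulas.\<close>

context
  fixes L :: language and \<Delta> :: interp_code
begin

fun trt_tm :: "nat \<Rightarrow> nat \<Rightarrow> nat \<Rightarrow> tm \<Rightarrow> fm"
  and trt_tms :: "nat \<Rightarrow> nat \<Rightarrow> nat \<Rightarrow> tm list \<Rightarrow> fm \<Rightarrow> fm" where
  "trt_tm k d s (Var i) = at_blocks \<Delta> k [s, d + i] (eq_fm \<Delta>)"
| "trt_tm k d s (Fn f ts) = (if f < length (funs L) then
     (let m = funs L ! f in
      ex_blocks \<Delta> k m (trt_tms (k + m) (d + m) 0 ts
        (at_blocks \<Delta> (k + m) ([0..<m] @ [s + m]) (fun_fm \<Delta> f))))
     else Eq (Var 0) (Var 0))"
| "trt_tms k d s [] \<phi> = \<phi>"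
| "trt_tms k d s (t # ts) \<phi> = Conj (trt_tm k d s t) (trt_tms k d (Suc s) ts \<phi>)"

primrec trt_fm :: "nat \<Rightarrow> fm \<Rightarrow> fm" where
  "trt_fm k (Eq s t) = ex_blocks \<Delta> k 2 (Conj (trt_tm (k + 2) 2 0 s)
     (Conj (trt_tm (k + 2) 2 1 t) (at_blocks \<Delta> (k + 2) [0, 1] (eq_fm \<Delta>))))"
| "trt_fm k (Rel r ts) = (if r < length (rels L) then
     (let m = rels L ! r in
      ex_blocks \<Delta> k m (trt_tms (k + m) m 0 ts (at_blocks \<Delta> (k + m) [0..<m] (rel_fm \<Delta> r))))
     else Eq (Var 0) (Var 0))"
| "trt_fm k (Neg \<phi>) = Neg (trt_fm k \<phi>)"
| "trt_fm k (Conj \<phi> \<psi>) = Conj (trt_fm k \<phi>) (trt_fm k \<psi>)"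
| "trt_fm k (Ex \<phi>) = ex_blocks \<Delta> k 1 (trt_fm (Suc k) \<phi>)"

lemma trt_tm_eq: "wf_tm L n t \<Longrightarrow> trt_tm k d s t = tr_tm \<Delta> k d s t"
proof (induction t arbitrary: k d s)
  case (Fn f ts)
  have "\<forall>t \<in> set ts. wf_tm L n t" using Fn.prems by simp
  then have "trt_tms k d s ts \<phi> = foldr Conj (tr_tms \<Delta> k d s ts) \<phi>" for k d s \<phi>
    using Fn.IH by (induction ts arbitrary: s) auto
  then show ?case using Fn.prems by (simp add: Let_def)
qed simp

lemma trt_tms_eq:
  "\<forall>t \<in> set ts. wf_tm L n t \<Longrightarrow> trt_tms k d s ts \<phi> = foldr Conj (tr_tms \<Delta> k d s ts) \<phi>"
  by (induction ts arbitrary: s) (auto simp: trt_tm_eq)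

text \<open>Well-formedness makes the lengths of argument lists equal to the arities. Reading
  arities off the finite language leaves only finitely many block numbers, to which
  \<open>computable_finite_case\<close> applies.\<close>

lemma trt_fm_eq: "wf_fm L n \<phi> \<Longrightarrow> trt_fm k \<phi> = tr_fm \<Delta> k \<phi>"
  by (induction \<phi> arbitrary: n k) (auto simp: trt_tm_eq trt_tms_eq Let_def)

text \<open>\<open>computable_tree_recursion\<close> treats one unary function, so the arguments of
  the three mutually dependent translations are packed together with a mode.\<close>

definition job :: "nat \<Rightarrow> nat \<Rightarrow> nat \<Rightarrow> nat \<Rightarrow> nat \<Rightarrow> nat \<Rightarrow> nat" where
  "job mode k d s b x = prod_encode (mode, prod_encode (k, prod_encode (d, prod_encode (s, prod_encode (b, x)))))"

definition job_mode :: "nat \<Rightarrow> nat" where "job_mode y = lft y"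
definition job_k :: "nat \<Rightarrow> nat" where "job_k y = lft (rgt y)"
definition job_d :: "nat \<Rightarrow> nat" where "job_d y = lft (rgt (rgt y))"
definition job_s :: "nat \<Rightarrow> nat" where "job_s y = lft (rgt (rgt (rgt y)))"
definition job_b :: "nat \<Rightarrow> nat" where "job_b y = lft (rgt (rgt (rgt (rgt y))))"
definition job_x :: "nat \<Rightarrow> nat" where "job_x y = rgt (rgt (rgt (rgt (rgt y))))"

lemma job_simps [simp]:
  "job_mode (job mode k d s b x) = mode" "job_k (job mode k d s b x) = k" "job_d (job mode k d s b x) = d"
  "job_s (job mode k d s b x) = s" "job_b (job mode k d s b x) = b" "job_x (job mode k d s b x) = x"
  by (simp_all add: job_def job_mode_def job_k_def job_d_def job_s_def job_b_def job_x_def)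

lemma computable_job:
  assumes "computable a1" "computable a2" "computable a3" "computable a4" "computable a5" "computable a6"
  shows "computable (\<lambda>y. job (a1 y) (a2 y) (a3 y) (a4 y) (a5 y) (a6 y))"
  unfolding job_def by (intro computable_intros assms)

lemma computable_job_fields:
  assumes "computable f"
  shows "computable (\<lambda>y. job_mode (f y))" "computable (\<lambda>y. job_k (f y))" "computable (\<lambda>y. job_d (f y))"
    "computable (\<lambda>y. job_s (f y))" "computable (\<lambda>y. job_b (f y))" "computable (\<lambda>y. job_x (f y))"
  unfolding job_mode_def job_k_def job_d_def job_s_def job_b_def job_x_def
  by (intro computable_intros assms)+

text \<open>This last conjunct refers to the block \<open>s\<close> of the enclosing call, which the
  job for the argument list no longer knows; it is computed beforehand and passed along.\<close>

definition fun_base :: "nat \<Rightarrow> nat \<Rightarrow> nat \<Rightarrow> nat" where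
  "fun_base f k s = (let m = funs L ! f in
     fm_code (at_blocks \<Delta> (k + m) ([0..<m] @ [s + m]) (fun_fm \<Delta> f)))"

definition rel_base :: "nat \<Rightarrow> nat \<Rightarrow> nat" where
  "rel_base r k = (let m = rels L ! r in fm_code (at_blocks \<Delta> (k + m) [0..<m] (rel_fm \<Delta> r)))"

lemma computable_fun_base:
  assumes "computable k" "computable s"
  shows "computable (\<lambda>x. fun_base f (k x) (s x))"
proof -
  let ?m = "funs L ! f"
  have "computable (\<lambda>x. fm_code (at_blocks \<Delta> (k x + ?m)
      (map (\<lambda>g. g x) (map (\<lambda>i x. i) [0..<?m] @ [\<lambda>x. s x + ?m])) (fun_fm \<Delta> f)))"
    by (rule computable_at_blocks) (auto intro!: computable_intros assms)
  then show ?thesis by (simp add: fun_base_def Let_def comp_def)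
qed

lemma computable_rel_base:
  assumes "computable k"
  shows "computable (\<lambda>x. rel_base r (k x))"
proof -
  let ?m = "rels L ! r"
  have "computable (\<lambda>x. fm_code (at_blocks \<Delta> (k x + ?m) (map (\<lambda>g. g x) (map (\<lambda>i x. i) [0..<?m])) (rel_fm \<Delta> r)))"
    by (rule computable_at_blocks) (auto intro!: computable_intros assms)
  then show ?thesis by (simp add: rel_base_def Let_def comp_def)
qed

text \<open>A job asks for the code of the translation of a term (mode 0), of a list of terms (mode 1) or of
  a formula (mode 2) with the code \<open>job_x\<close>; in mode 1, \<open>job_b\<close> is the code of the last conjunct.\<close>

definition subjobs :: "nat \<Rightarrow> nat list" where
  "subjobs y =
    (let k = job_k y; d = job_d y; s = job_s y; x = job_x y; tag = lft x; z = rgt x; f = lft z in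
     if job_mode y = 0 then
       (if tag = 1 then
          (if f < length (funs L) then [job 1 (k + funs L ! f) (d + funs L ! f) 0 (fun_base f k s) (rgt z)] else [])
        else [])
     else if job_mode y = 1 then
       (if x = 0 then [] else [job 0 k d s 0 (lft (x - 1)), job 1 k d (Suc s) (job_b y) (rgt (x - 1))])
     else if tag = 0 then [job 0 (k + 2) 2 0 0 f, job 0 (k + 2) 2 1 0 (rgt z)]
     else if tag = 1 then
       (if f < length (rels L) then [job 1 (k + rels L ! f) (rels L ! f) 0 (rel_base f k) (rgt z)] else [])
     else if tag = 2 then [job 2 k 0 0 0 z]
     else if tag = 3 then [job 2 k 0 0 0 f, job 2 k 0 0 0 (rgt z)]
     else if tag = 4 then [job 2 (Suc k) 0 0 0 z]
     else [])"

text \<open>\<open>v\<close> is the result of the last subjob and \<open>w\<close> that of the one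
  before it; this is why \<open>w\<close> comes first in conjunctions.\<close>

definition job_value :: "nat \<Rightarrow> nat \<Rightarrow> nat \<Rightarrow> nat" where
  "job_value y v w =
    (let k = job_k y; d = job_d y; s = job_s y; x = job_x y; tag = lft x; z = rgt x; f = lft z;
         triv = fm_code (Eq (Var 0) (Var 0)) in
     if job_mode y = 0 then
       (if tag = 0 then fm_code (at_blocks \<Delta> k [s, d + z] (eq_fm \<Delta>))
        else if f < length (funs L) then ex_blocks_code \<Delta> (funs L ! f) k v else triv)
     else if job_mode y = 1 then (if x = 0 then job_b y else conj_code w v)
     else if tag = 0 then
       ex_blocks_code \<Delta> 2 k (conj_code w (conj_code v (fm_code (at_blocks \<Delta> (k + 2) [0, 1] (eq_fm \<Delta>)))))
     else if tag = 1 then (if f < length (rels L) then ex_blocks_code \<Delta> (rels L ! f) k v else triv)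
     else if tag = 2 then prod_encode (2, v)
     else if tag = 3 then conj_code w v
     else ex_blocks_code \<Delta> 1 k v)"

text \<open>\<open>computable_tree_recursion\<close> supplies the results in reverse order, so the last one comes first.\<close>

definition combine :: "nat \<Rightarrow> nat" where
  "combine u = job_value (lft u) (lft (rgt u - 1)) (lft (rgt (rgt u - 1) - 1))"

lemma computable_subjobs: "computable (\<lambda>y. list_encode (subjobs y))"
proof -
  have 1: "computable (\<lambda>y. if lft (rgt (job_x y)) < length (funs L)
      then Suc (prod_encode (job 1 (job_k y + funs L ! lft (rgt (job_x y))) (job_d y + funs L ! lft (rgt (job_x y))) 0
        (fun_base (lft (rgt (job_x y))) (job_k y) (job_s y)) (rgt (rgt (job_x y))), 0)) else 0)"
    by (rule computable_finite_case[where G = "\<lambda>f y. Suc (prod_encode (job 1 (job_k y + funs L ! f)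
          (job_d y + funs L ! f) 0 (fun_base f (job_k y) (job_s y)) (rgt (rgt (job_x y))), 0))"])
      (intro computable_intros computable_job computable_job_fields computable_fun_base)+
  have 2: "computable (\<lambda>y. if lft (rgt (job_x y)) < length (rels L)
      then Suc (prod_encode (job 1 (job_k y + rels L ! lft (rgt (job_x y))) (rels L ! lft (rgt (job_x y))) 0
        (rel_base (lft (rgt (job_x y))) (job_k y)) (rgt (rgt (job_x y))), 0)) else 0)"
    by (rule computable_finite_case[where G = "\<lambda>f y. Suc (prod_encode (job 1 (job_k y + rels L ! f)
          (rels L ! f) 0 (rel_base f (job_k y)) (rgt (rgt (job_x y))), 0))"])
      (intro computable_intros computable_job computable_job_fields computable_rel_base)+
  show ?thesis
    unfolding subjobs_def Let_def if_distrib[of list_encode] list_encode.simps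
    by (intro 1 2 computable_intros computable_job computable_job_fields)
qed

lemma computable_combine: "computable combine"
proof -
  have tm: "computable (\<lambda>u. fm_code (at_blocks \<Delta> (job_k (lft u))
      [job_s (lft u), job_d (lft u) + rgt (job_x (lft u))] (eq_fm \<Delta>)))"
    by (intro computable_at_blocks_2 computable_intros computable_job_fields)
  have eq: "computable (\<lambda>u. fm_code (at_blocks \<Delta> (job_k (lft u) + 2) [0, 1] (eq_fm \<Delta>)))"
    by (intro computable_at_blocks_2 computable_intros computable_job_fields)
  have 1: "computable (\<lambda>u. if lft (rgt (job_x (lft u))) < length (funs L)
      then ex_blocks_code \<Delta> (funs L ! lft (rgt (job_x (lft u)))) (job_k (lft u)) (lft (rgt u - 1))
      else fm_code (Eq (Var 0) (Var 0)))"
    by (rule computable_finite_case[where G = "\<lambda>f u. ex_blocks_code \<Delta> (funs L ! f) (job_k (lft u)) (lft (rgt u - 1))"])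
      (intro computable_intros computable_job_fields computable_ex_blocks_code)+
  have 2: "computable (\<lambda>u. if lft (rgt (job_x (lft u))) < length (rels L)
      then ex_blocks_code \<Delta> (rels L ! lft (rgt (job_x (lft u)))) (job_k (lft u)) (lft (rgt u - 1))
      else fm_code (Eq (Var 0) (Var 0)))"
    by (rule computable_finite_case[where G = "\<lambda>f u. ex_blocks_code \<Delta> (rels L ! f) (job_k (lft u)) (lft (rgt u - 1))"])
      (intro computable_intros computable_job_fields computable_ex_blocks_code)+
  show ?thesis
    unfolding combine_def[abs_def] job_value_def Let_def
    by (intro tm eq 1 2 computable_intros computable_job_fields computable_ex_blocks_code computable_conj_code)
qed

lemma prod_decode_0: "prod_decode 0 = (0, 0)"
  using prod_encode_inverse[of "(0, 0)"] by (simp add: prod_encode_def)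

lemma rgt_le: "rgt z \<le> z" and lft_le: "lft z \<le> z"
  using le_prod_encode_2[of "rgt z" "lft z"] le_prod_encode_1[of "lft z" "rgt z"] by simp_all

text \<open>A nonzero tag is essential: \<open>prod_encode (0, 1)\<close> is 1.\<close>

lemma rgt_less: "lft z \<noteq> 0 \<Longrightarrow> rgt z < z"
proof -
  assume "lft z \<noteq> 0"
  moreover have "n \<le> triangle n" for n by (induction n) auto
  from this[of "lft z + rgt z"] have "lft z + rgt z \<le> triangle (lft z + rgt z)" .
  moreover have "z = triangle (lft z + rgt z) + lft z"
    using prod_decode_inverse[of z] by (simp add: prod_encode_def split: prod.splits)
  ultimately show ?thesis by linarith
qed

text \<open>Only the passage from an equation, whose tag is 0, to its two terms may keep the code,
  and it lowers the mode. In all other cases the code drops, and the factor 3 outweighs the mode of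
  a subjob, which is at most 2.\<close>

lemma subjobs_decrease:
  assumes "c \<in> set (subjobs y)"
  shows "3 * job_x c + job_mode c < 3 * job_x y + job_mode y"
proof -
  define x where "x = job_x y"
  have le: "lft (rgt x) \<le> rgt x" "rgt (rgt x) \<le> rgt x" "rgt x \<le> x"
    by (rule lft_le rgt_le)+
  have less: "lft x \<noteq> 0 \<Longrightarrow> rgt x < x" by (rule rgt_less)
  have dec: "lft (x - 1) \<le> x - 1" "rgt (x - 1) \<le> x - 1" by (rule lft_le rgt_le)+
  show ?thesis
    using assms le less dec
    unfolding subjobs_def Let_def x_def[symmetric]
    by (auto split: if_splits simp del: One_nat_def)
qed

theorem computable_trt_fm:
  "\<exists>F. computable F \<and> (\<forall>k \<phi>. F (prod_encode (k, fm_code \<phi>)) = fm_code (trt_fm k \<phi>))"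
proof -
  obtain F where F: "computable F"
    "\<And>y. F y = combine (prod_encode (y, list_encode (rev (map F (list_decode (list_encode (subjobs y)))))))"
    by (rule computable_tree_recursion[OF computable_subjobs computable_combine,
          of "\<lambda>y. 3 * job_x y + job_mode y"])
      (use subjobs_decrease in auto)
  \<comment> \<open>Missing results are read as 0, by truncated subtraction and because 0 decodes to
    a pair of zeros.\<close>
  have F0: "F y = job_value y 0 0" if "subjobs y = []" for y
    using F(2)[of y] that by (simp add: combine_def prod_decode_0)
  have F1: "F y = job_value y (F c) 0" if "subjobs y = [c]" for y c
    using F(2)[of y] that by (simp add: combine_def prod_decode_0)
  have F2: "F y = job_value y (F c') (F c)" if "subjobs y = [c, c']" for y c c'
    using F(2)[of y] that by (simp add: combine_def)
  \<comment> \<open>Correctness for the entries is assumed, so that this serves inside the induction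
    on terms as well as for atomic formulas afterwards.\<close>
  have list: "F (job 1 k d s (fm_code \<phi>) (list_encode (map tm_code ts))) = fm_code (trt_tms k d s ts \<phi>)"
    if "\<And>t k d s b. t \<in> set ts \<Longrightarrow> F (job 0 k d s b (tm_code t)) = fm_code (trt_tm k d s t)"
    for k d s \<phi> ts
    using that
  proof (induction ts arbitrary: s)
    case Nil
    show ?case by (subst F0) (simp_all add: subjobs_def job_value_def)
  next
    case (Cons t ts)
    show ?case
      by (subst F2[of _ "job 0 k d s 0 (tm_code t)" "job 1 k d (Suc s) (fm_code \<phi>) (list_encode (map tm_code ts))"])
        (simp_all add: subjobs_def job_value_def Cons.prems Cons.IH[unfolded One_nat_def] conj_code_def)
  qed
  have tm: "F (job 0 k d s b (tm_code t)) = fm_code (trt_tm k d s t)" for k d s b t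
  proof (induction t arbitrary: k d s b)
    case (Var i)
    show ?case by (subst F0) (simp_all add: subjobs_def job_value_def)
  next
    case (Fn f ts)
    show ?case
    proof (cases "f < length (funs L)")
      case True
      let ?m = "funs L ! f"
      have "F (job 0 k d s b (tm_code (Fn f ts))) =
          ex_blocks_code \<Delta> ?m k (F (job 1 (k + ?m) (d + ?m) 0 (fun_base f k s) (list_encode (map tm_code ts))))"
        by (subst F1[of _ "job 1 (k + ?m) (d + ?m) 0 (fun_base f k s) (list_encode (map tm_code ts))"])
          (simp_all add: subjobs_def job_value_def True)
      then show ?thesis
        using True list[OF Fn] by (simp add: fun_base_def Let_def fm_code_ex_blocks)
    next
      case False
      then show ?thesis by (subst F0) (simp_all add: subjobs_def job_value_def)
    qed
  qed
  have fm: "F (job 2 k 0 0 0 (fm_code \<phi>)) = fm_code (trt_fm k \<phi>)" for k \<phi>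
  proof (induction \<phi> arbitrary: k)
    case (Eq s t)
    show ?case
      by (subst F2[of _ "job 0 (k + 2) 2 0 0 (tm_code s)" "job 0 (k + 2) 2 1 0 (tm_code t)"])
        (simp_all add: subjobs_def job_value_def tm conj_code_def fm_code_ex_blocks)
  next
    case (Rel r ts)
    show ?case
    proof (cases "r < length (rels L)")
      case True
      let ?m = "rels L ! r"
      have "F (job 2 k 0 0 0 (fm_code (Rel r ts))) =
          ex_blocks_code \<Delta> ?m k (F (job 1 (k + ?m) ?m 0 (rel_base r k) (list_encode (map tm_code ts))))"
        by (subst F1[of _ "job 1 (k + ?m) ?m 0 (rel_base r k) (list_encode (map tm_code ts))"])
          (simp_all add: subjobs_def job_value_def True)
      then show ?thesis
        using True list[OF tm] by (simp add: rel_base_def Let_def fm_code_ex_blocks)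
    next
      case False
      then show ?thesis by (subst F0) (simp_all add: subjobs_def job_value_def)
    qed
  next
    case (Neg \<phi>)
    show ?case
      by (subst F1[of _ "job 2 k 0 0 0 (fm_code \<phi>)"]) (simp_all add: subjobs_def job_value_def Neg)
  next
    case (Conj \<phi> \<psi>)
    show ?case
      by (subst F2[of _ "job 2 k 0 0 0 (fm_code \<phi>)" "job 2 k 0 0 0 (fm_code \<psi>)"])
        (simp_all add: subjobs_def job_value_def Conj conj_code_def)
  next
    case (Ex \<phi>)
    show ?case
      by (subst F1[of _ "job 2 (Suc k) 0 0 0 (fm_code \<phi>)"])
        (simp_all add: subjobs_def job_value_def Ex fm_code_ex_blocks)
  qed
  have "computable (\<lambda>z. F (job 2 (lft z) 0 0 0 (rgt z)))"
    by (intro computable_comp[OF F(1)] computable_job computable_intros)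
  moreover have "F (job 2 (lft z) 0 0 0 (rgt z)) = fm_code (trt_fm k \<phi>)" if "z = prod_encode (k, fm_code \<phi>)"
    for z k \<phi>
    using that fm by simp
  ultimately show ?thesis by (intro exI[of _ "\<lambda>z. F (job 2 (lft z) 0 0 0 (rgt z))"]) blast
qed

end

text \<open>Both \<open>n\<close> and \<open>M\<close> are inputs, since the number of parameters is
  known only after the map witnessing richness has been applied.\<close>

definition cover_code :: "nat \<Rightarrow> nat \<Rightarrow> nat \<Rightarrow> nat \<Rightarrow> fm \<Rightarrow> nat \<Rightarrow> nat \<Rightarrow> nat \<Rightarrow> nat" where
  "cover_code d l c r \<chi> n M v = (ex_code ^^ (n * d + M))
    (rec_nat
      (rec_nat v (\<lambda>i. conj_code (fm_code (rename (cover_index d l c r n M i) \<chi>))) n)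
      (\<lambda>i. conj_code (fm_code (Eq (Var (n * d + i)) (Var (n * d + M + (n * l + i)))))) M)"

lemma fm_code_cover: "fm_code (cover d l c r \<chi> n M \<psi>) = cover_code d l c r \<chi> n M (fm_code \<psi>)"
proof -
  have "fm_code (conjs P k \<phi>) = rec_nat (fm_code \<phi>) (\<lambda>i. conj_code (fm_code (P i))) k" for P k \<phi>
    by (induction k) (simp_all add: conj_code_def)
  then show ?thesis by (simp only: cover_def cover_code_def fm_code_Ex_pow)
qed

lemma computable_cover_code:
  assumes n: "computable n" and M: "computable M" and v: "computable v"
  shows "computable (\<lambda>x. cover_code d l c r \<chi> (n x) (M x) (v x))"
proof -
  note nM = computable_comp[OF n] computable_comp[OF M]
  have "computable (\<lambda>z. cover_index d l c r (n (lft z)) (M (lft z)) (lft (rgt z)) j)" for j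
    unfolding cover_index_def by (intro computable_intros nM)
  then have 1: "computable (\<lambda>z. fm_code (rename (cover_index d l c r (n (lft z)) (M (lft z)) (lft (rgt z))) \<chi>))"
    by (rule computable_rename)
  have 2: "computable (\<lambda>x. rec_nat (v x) (\<lambda>i. conj_code (fm_code (rename (cover_index d l c r (n x) (M x) i) \<chi>))) (n x))"
    by (intro computable_rec[OF v _ n] computable_conj_code 1 computable_intros)
  have "computable (\<lambda>x. rec_nat
      (rec_nat (v x) (\<lambda>i. conj_code (fm_code (rename (cover_index d l c r (n x) (M x) i) \<chi>))) (n x))
      (\<lambda>i. conj_code (fm_code (Eq (Var (n x * d + i)) (Var (n x * d + M x + (n x * l + i)))))) (M x))"
    unfolding fm_code.simps tm_code.simps
    by (intro computable_rec[OF 2 _ M] computable_conj_code computable_intros nM)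
  then show ?thesis
    unfolding cover_code_def
    by (intro computable_funpow computable_ex_code computable_intros n M)
qed

section \<open>Transfer of richness\<close>

lemma bi_interpretation_commute:
  "bi_interpretation \<Gamma> \<Delta> A q B p \<Longrightarrow> bi_interpretation \<Delta> \<Gamma> B p A q"
  unfolding bi_interpretation_def by blast

lemma bi_interpretation_npars:
  assumes "bi_interpretation \<Gamma> \<Delta> A [] B []"
  shows "npars \<Gamma> = 0" "npars \<Delta> = 0"
  using assms unfolding bi_interpretation_def interpretation_via_def by (auto simp: tuples_def)

context
  fixes A :: "'a struct" and B :: "'b struct"
  assumes A: "is_struct A" and B: "is_struct B"
begin

lemma rich_transfer:
  assumes "bi_interpretation \<Gamma> \<Delta> A q B p" "rich B"
  shows "rich A"
  using bi_interpretation_transfer[OF A B assms(1)] assms(2) unfolding rich_def Let_def by meson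

lemma fo_equiv_no_params: "fo_equiv M n \<phi> 0 \<psi> r \<Longrightarrow> fo_equiv M n \<phi> 0 \<psi> []"
  by (simp add: fo_equiv_def)

lemma absolutely_rich_transfer:
  assumes "bi_interpretation \<Gamma> \<Delta> A [] B []" "absolutely_rich B"
  shows "absolutely_rich A"
  unfolding absolutely_rich_def
proof (intro allI impI)
  fix k \<phi> assume "wsol A k \<phi>"
  with bi_interpretation_transfer[OF A B assms(1)] assms(2)
  obtain \<psi> r where "fo_equiv A k \<phi> ((npars \<Gamma> + 0) * dim \<Delta> + npars \<Delta>) \<psi> r"
    unfolding absolutely_rich_def Let_def by meson
  then have "fo_equiv A k \<phi> 0 \<psi> r" using bi_interpretation_npars[OF assms(1)] by simp
  then show "\<exists>\<psi>. fo_equiv A k \<phi> 0 \<psi> []" by (blast dest: fo_equiv_no_params)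
qed

text \<open>The set \<open>X\<close> of admissible numbers of parameters lets one proof cover both
  effective notions: it is everything for effective richness and contains only 0 in the absolute
  case.\<close>

lemma effective_transfer:
  assumes bi: "bi_interpretation \<Gamma> \<Delta> A q B p" and S: "computable_fm_map S"
    and S_equiv: "\<And>n \<phi>. wsol B n \<phi> \<Longrightarrow> \<exists>m \<in> X. \<exists>\<psi> r. S (n, \<phi>) = (m, \<psi>) \<and> fo_equiv B n \<phi> m \<psi> r"
  shows "\<exists>T. computable_fm_map T \<and> (\<forall>k \<phi>. wsol A k \<phi> \<longrightarrow>
    (\<exists>m \<in> (\<lambda>m. (npars \<Gamma> + m) * dim \<Delta> + npars \<Delta>) ` X. \<exists>\<psi> r. T (k, \<phi>) = (m, \<psi>) \<and> fo_equiv A k \<phi> m \<psi> r))"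
proof -
  obtain \<Omega> \<tau> \<chi> where
    tr: "\<And>k \<phi>. wsol A k \<phi> \<Longrightarrow>
        wsol B (k * dim \<Gamma> + npars \<Gamma>) (cover 1 (dim \<Gamma>) 0 0 \<tau> k (npars \<Gamma>) (tr_fm \<Omega> k \<phi>))"
      "\<And>k \<phi> m \<psi> r. wsol A k \<phi> \<Longrightarrow>
        fo_equiv B (k * dim \<Gamma> + npars \<Gamma>) (cover 1 (dim \<Gamma>) 0 0 \<tau> k (npars \<Gamma>) (tr_fm \<Omega> k \<phi>)) m \<psi> r \<Longrightarrow>
        \<exists>r'. fo_equiv A k \<phi> ((npars \<Gamma> + m) * dim \<Delta> + npars \<Delta>) (first_order_translation \<Gamma> \<Delta> \<chi> k m \<psi>) r'"
    using bi_interpretation_transfer[OF A B bi] unfolding Let_def by blast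
  let ?T = "\<lambda>k \<phi>. cover 1 (dim \<Gamma>) 0 0 \<tau> k (npars \<Gamma>) (tr_fm \<Omega> k \<phi>)"
  obtain F where F: "computable F"
    "\<And>k \<phi>. F (prod_encode (k, fm_code \<phi>)) = fm_code (trt_fm (HF_lang (lang A)) \<Omega> k \<phi>)"
    using computable_trt_fm by blast
  obtain G where G: "computable G"
    "\<And>k \<phi>. G (prod_encode (k, fm_code \<phi>)) = fm_code (trt_fm (lang B) \<Delta> k \<phi>)"
    using computable_trt_fm by blast
  obtain H where H: "computable H"
    "\<And>n \<phi> m \<psi>. S (n, \<phi>) = (m, \<psi>) \<Longrightarrow> H (prod_encode (n, fm_code \<phi>)) = prod_encode (m, fm_code \<psi>)"
    using S unfolding computable_fm_map_def by blast
  let ?d = "dim \<Gamma> * dim \<Delta>" and ?c = "npars \<Gamma> * dim \<Delta>"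
  let ?r = "?c + npars \<Delta>" and ?M = "\<lambda>m. (npars \<Gamma> + m) * dim \<Delta> + npars \<Delta>"
    and ?K = "\<lambda>k m. k * dim \<Gamma> + npars \<Gamma> + m"
  \<comment> \<open>\<open>computable_fm_map\<close> demands the right value at every formula,
    well-formed or not. Hence \<open>trt_fm\<close>, which is computable throughout and agrees with
    \<open>tr_fm\<close> on the formulas that matter.\<close>
  define s where "s k \<phi> = S (k * dim \<Gamma> + npars \<Gamma>,
      cover 1 (dim \<Gamma>) 0 0 \<tau> k (npars \<Gamma>) (trt_fm (HF_lang (lang A)) \<Omega> k \<phi>))" for k \<phi>
  define T where "T = (\<lambda>(k, \<phi>). let (m, \<psi>) = s k \<phi> in
      (?M m, cover ?d 1 ?c ?r \<chi> k (?M m) (trt_fm (lang B) \<Delta> (?K k m) \<psi>)))"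
  \<comment> \<open>\<open>f\<close> and \<open>g\<close> carry out \<open>s\<close> and
    \<open>T\<close> on codes: \<open>f\<close> yields the number of parameters together with the
    equivalent in B, and \<open>g\<close> brings this back to A.\<close>
  define f where "f x = H (prod_encode (lft x * dim \<Gamma> + npars \<Gamma>,
      cover_code 1 (dim \<Gamma>) 0 0 \<tau> (lft x) (npars \<Gamma>) (F x)))" for x
  define g where "g x = prod_encode (?M (lft (f x)),
      cover_code ?d 1 ?c ?r \<chi> (lft x) (?M (lft (f x)))
        (G (prod_encode (?K (lft x) (lft (f x)), rgt (f x)))))" for x
  have f: "computable f"
    unfolding f_def[abs_def]
    by (intro computable_comp[OF H(1)] computable_intros computable_cover_code F(1))
  have "computable g"
    unfolding g_def[abs_def]
    by (intro computable_intros computable_cover_code computable_comp[OF G(1)] computable_comp[OF f])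
  moreover have "g (prod_encode (k, fm_code \<phi>)) = prod_encode (m, fm_code \<psi>)" if "T (k, \<phi>) = (m, \<psi>)" for k \<phi> m \<psi>
  proof -
    obtain m' \<psi>' where S': "s k \<phi> = (m', \<psi>')" by fastforce
    have "f (prod_encode (k, fm_code \<phi>)) = prod_encode (m', fm_code \<psi>')"
      using H(2)[OF S'[unfolded s_def]] by (simp add: f_def F(2) fm_code_cover)
    then show ?thesis
      using that S' by (auto simp: g_def T_def G(2) fm_code_cover)
  qed
  ultimately have "computable_fm_map T"
    unfolding computable_fm_map_def by blast
  moreover have "\<exists>m \<in> ?M ` X. \<exists>\<psi> r. T (k, \<phi>) = (m, \<psi>) \<and> fo_equiv A k \<phi> m \<psi> r" if \<phi>: "wsol A k \<phi>" for k \<phi>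
  proof -
    have "trt_fm (HF_lang (lang A)) \<Omega> k \<phi> = tr_fm \<Omega> k \<phi>"
      using \<phi> by (intro trt_fm_eq) (simp add: wsol_def)
    then have s: "s k \<phi> = S (k * dim \<Gamma> + npars \<Gamma>, ?T k \<phi>)"
      by (simp only: s_def)
    obtain m \<psi> r where m: "m \<in> X" "s k \<phi> = (m, \<psi>)"
      and \<psi>: "fo_equiv B (k * dim \<Gamma> + npars \<Gamma>) (?T k \<phi>) m \<psi> r"
      using S_equiv[OF tr(1)[OF \<phi>]] unfolding s by blast
    have "wf_fm (lang B) (?K k m) \<psi>" using \<psi> by (simp add: fo_equiv_def)
    then have "trt_fm (lang B) \<Delta> (?K k m) \<psi> = tr_fm \<Delta> (?K k m) \<psi>" by (rule trt_fm_eq)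
    then have "T (k, \<phi>) = (?M m, first_order_translation \<Gamma> \<Delta> \<chi> k m \<psi>)"
      using m(2) by (simp add: T_def first_order_translation_def)
    then show ?thesis using tr(2)[OF \<phi> \<psi>] m(1) by blast
  qed
  ultimately show ?thesis by blast
qed

lemma effectively_rich_transfer:
  assumes bi: "bi_interpretation \<Gamma> \<Delta> A q B p" and "effectively_rich B"
  shows "effectively_rich A"
proof -
  obtain S where "computable_fm_map S"
    "\<And>n \<phi>. wsol B n \<phi> \<Longrightarrow> \<exists>m \<in> UNIV. \<exists>\<psi> r. S (n, \<phi>) = (m, \<psi>) \<and> fo_equiv B n \<phi> m \<psi> r"
    using assms(2) unfolding effectively_rich_def by blast
  from effective_transfer[OF bi this] show ?thesis unfolding effectively_rich_def by blast
qed

lemma effectively_absolutely_rich_transfer: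
  assumes bi: "bi_interpretation \<Gamma> \<Delta> A [] B []" and "effectively_absolutely_rich B"
  shows "effectively_absolutely_rich A"
proof -
  obtain S where "computable_fm_map S"
    "\<And>n \<phi>. wsol B n \<phi> \<Longrightarrow> \<exists>m \<in> {0}. \<exists>\<psi> r. S (n, \<phi>) = (m, \<psi>) \<and> fo_equiv B n \<phi> m \<psi> r"
    using assms(2) unfolding effectively_absolutely_rich_def by blast
  from effective_transfer[OF bi this] show ?thesis
    unfolding effectively_absolutely_rich_def bi_interpretation_npars[OF bi]
    using fo_equiv_no_params by simp blast
qed

end

theorem theorem4p2:
  fixes A :: "'a struct" and B :: "'b struct"
  assumes "is_struct A" and "is_struct B"
  shows "(bi_interpretable A B \<and> rich B \<longrightarrow> rich A) \<and>
    (absolutely_bi_interpretable A B \<and> absolutely_rich B \<longrightarrow> absolutely_rich A) \<and>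
    (bi_interpretable A B \<longrightarrow> (effectively_rich A \<longleftrightarrow> effectively_rich B)) \<and>
    (absolutely_bi_interpretable A B \<longrightarrow>
       (effectively_absolutely_rich A \<longleftrightarrow> effectively_absolutely_rich B))"
proof -
  have commute: "bi_interpretation \<Delta> \<Gamma> B p A q" if "bi_interpretation \<Gamma> \<Delta> A q B p" for \<Gamma> \<Delta> p q
    using that by (rule bi_interpretation_commute)
  show ?thesis
    unfolding bi_interpretable_def absolutely_bi_interpretable_def
    using rich_transfer[OF assms] absolutely_rich_transfer[OF assms]
      effectively_rich_transfer[OF assms] effectively_rich_transfer[OF assms(2,1) commute]
      effectively_absolutely_rich_transfer[OF assms]
      effectively_absolutely_rich_transfer[OF assms(2,1) commute]
    by metis
qed

end
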